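(* Let $\alpha\in(0,1]$ and let $N\subset\mathbb{N}$ be an infinite subset. For $n\in N$ let $X_n$ be a random variable with law $\mu_\alpha^n$, and let $f_n,F_n:\mathbb{R}^n\to\mathbb{R}$ be measurable functions. Let $(v(n))_{n\in N}$ be a sequence going to $+\infty$. For $\delta>0$, $n\in N$ and $x\in\mathbb{R}$ define $$I_{n,\delta}(x)=\inf\{\|h\|_{\ell^\alpha}^\alpha : |F_n(h)-x|<\delta,\ h\in\mathbb{R}^n\},\qquad I_\alpha(x)=\sup_{\delta>0}\inf_{n\in N}I_{n,\delta}(x),$$ $$I^+_{n,\delta}(x)=\inf\{\|h\|_{\ell^\alpha}^\alpha : |F_n(h)-x|<\delta,\ h\in\mathbb{R}_+^n\}.$$ Assume: (i) For any $r>0$, $$\sup_{h_n\in rB_{\ell^\alpha}} \big|f_n(X_n+v(n)^{1/\alpha}h_n)-F_n(h_n)\big|\to 0$$ in probability as $n\to+\infty$, $n\in N$. (ii) For any $\delta>0$ and $r>0$ there is a sequence $t_\delta(n)$ such that $$\mathbb{E}\sup_{\|h\|_{\ell^2}\le t_\delta(n)}\mathcal{L}_n(h)\le\delta,\qquad\text{where}\quad \mathcal{L}_n(h)=\sup_{x\in X_n+rv(n)^{1/\alpha}B_{\ell^\alpha}} |f_n(x+h)-f_n(x)|,$$ and such that $(\log n)^{\alpha/2}=o\big(\log\frac{t_\delta(n)^2}{v(n)}\big)$ if $\alpha\ne1$, or $v(n)=o(t_\delta(n)^2)$ if $\alpha=1$. (iii) For any $r>0$, $\bigcup_{n\in N}F_n(rB_{\ell^\alpha})$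 is relatively compact in $\mathbb{R}$. (iv)' For any $x\in\mathbb{R}$, $$I_\alpha(x)=\sup_{\delta>0}\ \limsup_{n\to+\infty,\ n\in N} I^+_{n,\delta}(x).$$ Then $(f_n(X_n))_{n\in N}$ satisfies a large deviations principle with speed $v(n)$ and good rate function $I_\alpha$.
   Context: $\mu_\alpha$ is the probability measure on $\mathbb{R}_+=[0,+\infty)$ with density $Z_\alpha^{-1}e^{-x^\alpha}$ with respect to Lebesgue measure ($Z_\alpha$ the normalizing constant), and $\mu_\alpha^n$ is its $n$-fold product. For $p>0$ and $h\in\mathbb{R}^n$, $\|h\|_{\ell^p}=(\sum_{i=1}^n|h_i|^p)^{1/p}$ and $B_{\ell^p}=\{h\in\mathbb{R}^n:\|h\|_{\ell^p}\le1\}$. The infimum of the empty set is $+\infty$. Large deviations principle (LDP): random variables $(Z_n)$ in a topological space $\mathcal{X}$ with its Borel $\sigma$-field satisfy an LDP with speed $v(n)\to+\infty$ and rate function $J:\mathcal{X}\to[0,+\infty]$ if $J$ is lower semicontinuous and for every Borel set $B$, $$-\inf_{B^\circ}J\le\liminf_n\frac1{v(n)}\log\mathbb{P}(Z_n\in B)\le\limsup_n\frac1{v(n)}\log\mathbb{P}(Z_n\in B)\le-\inf_{\overline B}J.$$ $J$ is a good rate function if all level sets $\{J\le t\}$, $t\in[0,+\infty)$, are compact. *)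

theory Defs
  imports "HOL-Probability.Probability"
begin

text \<open>
  Points of the Euclidean space of dimension \<open>n\<close> are functions on \<open>{..<n}\<close>, extended by
  \<open>undefined\<close>; this is the underlying set of the product \<^term>\<open>PiM {..<n} (\<lambda>_. borel)\<close>, so that
  the dimension can vary inside a statement. All operations below are coordinatewise.
\<close>

abbreviation Rn :: "nat \<Rightarrow> (nat \<Rightarrow> real) set" where
  "Rn n \<equiv> PiE {..<n} (\<lambda>_. UNIV)"

abbreviation borel_Rn :: "nat \<Rightarrow> (nat \<Rightarrow> real) measure" where
  "borel_Rn n \<equiv> PiM {..<n} (\<lambda>_. borel)"

definition Rn_nonneg :: "nat \<Rightarrow> (nat \<Rightarrow> real) set" where
  "Rn_nonneg n = {h \<in> Rn n. \<forall>i<n. 0 \<le> h i}"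

definition vadd :: "nat \<Rightarrow> (nat \<Rightarrow> real) \<Rightarrow> (nat \<Rightarrow> real) \<Rightarrow> (nat \<Rightarrow> real)" where
  "vadd n x y = (\<lambda>i\<in>{..<n}. x i + y i)"

definition vscale :: "nat \<Rightarrow> real \<Rightarrow> (nat \<Rightarrow> real) \<Rightarrow> (nat \<Rightarrow> real)" where
  "vscale n c x = (\<lambda>i\<in>{..<n}. c * x i)"

definition lp_norm :: "real \<Rightarrow> nat \<Rightarrow> (nat \<Rightarrow> real) \<Rightarrow> real" where
  "lp_norm p n h = (\<Sum>i<n. \<bar>h i\<bar> powr p) powr (1 / p)"

definition lp_ball :: "real \<Rightarrow> nat \<Rightarrow> (nat \<Rightarrow> real) set" where
  "lp_ball p n = {h \<in> Rn n. lp_norm p n h \<le> 1}"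

definition mu :: "real \<Rightarrow> real measure" where
  "mu \<alpha> = density lborel
     (\<lambda>x. ennreal (indicator {0..} x * exp (- (x powr \<alpha>)) /
        (LINT y:{0..}|lborel. exp (- (y powr \<alpha>)))))"

definition mu_prod :: "real \<Rightarrow> nat \<Rightarrow> (nat \<Rightarrow> real) measure" where
  "mu_prod \<alpha> n = PiM {..<n} (\<lambda>_. mu \<alpha>)"

text \<open>The filter of the limits as \<open>n\<close> tends to infinity while staying in \<open>N\<close>.\<close>

definition along :: "nat set \<Rightarrow> nat filter" where
  "along N = inf sequentially (principal N)"

text \<open>
  Suprema over uncountable index sets of Borel functions are universally measurable, but in general
  not Borel measurable. Convergence in probability and expectation of such a quantity are therefore
  written with the outer measure and the upper integral, which agree with the measure and the
  integral of the completed space whenever the set or the function is measurable there.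
\<close>

definition tends_to_zero_in_prob ::
  "nat filter \<Rightarrow> (nat \<Rightarrow> 'a measure) \<Rightarrow> (nat \<Rightarrow> 'a \<Rightarrow> ennreal) \<Rightarrow> bool" where
  "tends_to_zero_in_prob \<F> M Y \<longleftrightarrow>
     (\<forall>\<epsilon>>0::real.
       ((\<lambda>n. outer_measure_of (M n) {\<omega> \<in> space (M n). ennreal \<epsilon> < Y n \<omega>}) \<longlongrightarrow> 0) \<F>)"

definition upper_expectation :: "'a measure \<Rightarrow> ('a \<Rightarrow> ennreal) \<Rightarrow> ennreal" where
  "upper_expectation M Y =
     (INF g \<in> {g \<in> borel_measurable M. \<forall>\<omega>\<in>space M. Y \<omega> \<le> g \<omega>}. \<integral>\<^sup>+\<omega>. g \<omega> \<partial>M)"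

definition local_osc ::
  "real \<Rightarrow> nat \<Rightarrow> real \<Rightarrow> ((nat \<Rightarrow> real) \<Rightarrow> real) \<Rightarrow> (nat \<Rightarrow> real) \<Rightarrow> (nat \<Rightarrow> real) \<Rightarrow> ennreal" where
  "local_osc \<alpha> n \<rho> \<phi> X h =
     (SUP x \<in> vadd n X ` vscale n \<rho> ` lp_ball \<alpha> n. ennreal \<bar>\<phi> (vadd n x h) - \<phi> x\<bar>)"

definition I_loc ::
  "real \<Rightarrow> (nat \<Rightarrow> (nat \<Rightarrow> real) \<Rightarrow> real) \<Rightarrow> nat \<Rightarrow> real \<Rightarrow> real \<Rightarrow> ereal" where
  "I_loc \<alpha> F n \<delta> x = (INF h \<in> {h \<in> Rn n. \<bar>F n h - x\<bar> < \<delta>}. ereal (lp_norm \<alpha> n h powr \<alpha>))"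

definition I_loc_plus ::
  "real \<Rightarrow> (nat \<Rightarrow> (nat \<Rightarrow> real) \<Rightarrow> real) \<Rightarrow> nat \<Rightarrow> real \<Rightarrow> real \<Rightarrow> ereal" where
  "I_loc_plus \<alpha> F n \<delta> x =
     (INF h \<in> {h \<in> Rn_nonneg n. \<bar>F n h - x\<bar> < \<delta>}. ereal (lp_norm \<alpha> n h powr \<alpha>))"

definition I_rate ::
  "real \<Rightarrow> (nat \<Rightarrow> (nat \<Rightarrow> real) \<Rightarrow> real) \<Rightarrow> nat set \<Rightarrow> real \<Rightarrow> ereal" where
  "I_rate \<alpha> F N x = (SUP \<delta> \<in> {0<..}. INF n \<in> N. I_loc \<alpha> F n \<delta> x)"

definition eln :: "real \<Rightarrow> ereal" where
  "eln p = (if p = 0 then - \<infinity> else ereal (ln p))"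

definition lower_semicont :: "('b::topological_space \<Rightarrow> ereal) \<Rightarrow> bool" where
  "lower_semicont J \<longleftrightarrow> (\<forall>x. J x \<le> Liminf (at x) J)"

definition satisfies_LDP ::
  "nat set \<Rightarrow> (nat \<Rightarrow> 'a measure) \<Rightarrow> (nat \<Rightarrow> 'a \<Rightarrow> 'b::topological_space) \<Rightarrow>
     (nat \<Rightarrow> real) \<Rightarrow> ('b \<Rightarrow> ereal) \<Rightarrow> bool" where
  "satisfies_LDP N M Z v J \<longleftrightarrow>
     (\<forall>n\<in>N. Z n \<in> M n \<rightarrow>\<^sub>M borel) \<and>
     filterlim v at_top (along N) \<and>
     (\<forall>x. 0 \<le> J x) \<and> lower_semicont J \<and>
     (\<forall>B\<in>sets borel.
        let p = (\<lambda>n. ereal (1 / v n) * eln (measure (M n) {\<omega> \<in> space (M n). Z n \<omega> \<in> B}))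
        in - (INF x \<in> interior B. J x) \<le> Liminf (along N) p \<and>
           Liminf (along N) p \<le> Limsup (along N) p \<and>
           Limsup (along N) p \<le> - (INF x \<in> closure B. J x))"

definition good_rate :: "('b::topological_space \<Rightarrow> ereal) \<Rightarrow> bool" where
  "good_rate J \<longleftrightarrow> (\<forall>t\<ge>0::real. compact {x. J x \<le> ereal t})"

end

theory Submission
  imports Defs "HOL-Real_Asymp.Real_Asymp"
begin

text \<open>
  Why the principle holds. A deviation of \<open>f n (X n)\<close> is produced in the cheapest way by adding to a
  typical sample a displacement \<open>v\<^bsup>1/\<alpha>\<^esup> h\<close>, which moves the value to about \<open>F n h\<close> and costs
  \<open>v \<cdot> \<parallel>h\<parallel>\<^sup>\<alpha>\<close> in the exponent.

  Lower bound. Since \<open>x \<mapsto> x\<^sup>\<alpha>\<close> is subadditive, a translation of a set by a vector \<open>k\<close> with nonnegative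
  coordinates decreases its probability by a factor of at least \<open>exp (- \<Sum>k\<^sub>i\<^sup>\<alpha>)\<close> (\<open>mu_prod_shift\<close>). Translating the
  typical samples by \<open>v\<^bsup>1/\<alpha>\<^esup> h\<close> gives \<open>lower_probability_bound\<close>.

  Upper bound. It rests on a concentration inequality with the sharp constant for large displacements: two Borel sets that
  are at cost distance at least \<open>s\<close> satisfy \<open>P A \<cdot> P C \<le> exp (- s)\<close> (\<open>separated_sets_product\<close>). The
  cost of a coordinate is \<open>ln (kern \<theta> (S x - S y))\<close>, where \<open>S\<close> is the potential that maps the law to the exponential
  law. It is quadratic for small and linear with slope \<open>\<theta> < 1\<close> for large differences. The inequality is proved in
  the two-function form of Maurey's property, by a transport argument in dimension one
  (\<open>two_function_ineq\<close>) and by Fubini's theorem in higher dimension (\<open>two_function_ineq_product\<close>).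

  As \<open>S x\<close> equals \<open>x\<^sup>\<alpha>\<close> up to a logarithm, each coordinate displacement either costs almost its full
  price \<open>\<bar>x - y\<bar>\<^sup>\<alpha>\<close> or is small and has a quadratic cost, with a constant that is polynomial in \<open>ln n\<close>
  (\<open>coordinate_dichotomy\<close>); the growth of \<open>t\<close> absorbs such constants
  (\<open>eventually_coordinate_dichotomy\<close>). Hence a point at cost less than \<open>(1 - \<epsilon>) \<tau> v\<close> from a typical
  sample differs from it by \<open>v\<^bsup>1/\<alpha>\<^esup> h1 + h2\<close> with \<open>\<parallel>h1\<parallel>\<^sup>\<alpha> \<le> \<tau>\<close> and \<open>h2\<close> small in \<open>\<ell>\<^sup>2\<close>
  (\<open>cheap_displacement_split\<close>), and its value is close to \<open>F n h1\<close>. If \<open>\<tau>\<close> is below the infimum of the rate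
  function on a closed set \<open>B\<close>, compactness keeps all those values \<open>F n h1\<close> away from \<open>B\<close>
  (\<open>uniformly_far_from_closed_set\<close>). So the points with value in \<open>B\<close> are separated from the typical samples,
  and the concentration inequality yields \<open>upper_probability_bound\<close>.

  The typical samples are described by suprema over uncountable sets and need not form a Borel set. The
  points separated from a given set do form a closed set that contains them, and the concentration
  inequality is applied to this closed set (\<open>prob_le_of_separated\<close>).
\<close>

section \<open>The cost kernel\<close>

text \<open>
  The function \<open>ln (kern \<theta> d)\<close> is the transport cost of a displacement \<open>d\<close>. It is of order
  \<open>d\<^sup>2\<close> near \<open>0\<close> and has slope \<open>\<theta>\<close> at infinity, so it is almost \<open>\<bar>d\<bar>\<close>, the exact cost for the exponential
  law, when \<open>\<theta>\<close> is close to \<open>1\<close>. The formula comes from \<open>\<psi>\<^sup>2 - 4 \<psi>'\<^sup>2\<close> with \<open>\<psi> d = cosh (\<theta> d / 2)\<close>, which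
  is what a differential inequality below requires (see \<open>kern_half\<close>).
\<close>

definition kern :: "real \<Rightarrow> real \<Rightarrow> real" where
  "kern \<theta> d = (1 + \<theta>\<^sup>2) / 2 + (1 - \<theta>\<^sup>2) / 2 * cosh (\<theta> * d)"

lemma kern_minus [simp]: "kern \<theta> (- d) = kern \<theta> d"
  by (simp add: kern_def)

lemma kern_half: "kern \<theta> d = (cosh (\<theta> * d / 2))\<^sup>2 - \<theta>\<^sup>2 * (sinh (\<theta> * d / 2))\<^sup>2"
proof -
  have "cosh (\<theta> * d) = (cosh (\<theta> * d / 2))\<^sup>2 + (sinh (\<theta> * d / 2))\<^sup>2"
    using cosh_double[of "\<theta> * d / 2"] by simp
  moreover have "(cosh (\<theta> * d / 2))\<^sup>2 = (sinh (\<theta> * d / 2))\<^sup>2 + 1"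
    by (rule cosh_square_eq)
  ultimately show ?thesis unfolding kern_def by (simp add: field_simps)
qed

lemma kern_ge_exp:
  assumes "0 < \<theta>" "\<theta> < 1"
  shows "(1 - \<theta>\<^sup>2) / 4 * exp (\<theta> * \<bar>d\<bar>) \<le> kern \<theta> d"
proof -
  have "\<theta>\<^sup>2 < 1" using assms by (simp add: power_less_one_iff abs_square_less_1)
  moreover have "exp (\<theta> * \<bar>d\<bar>) / 2 \<le> cosh (\<theta> * d)"
  proof (cases "d \<ge> 0")
    case True then show ?thesis by (simp add: cosh_def)
  next
    case False then show ?thesis by (simp add: cosh_def)
  qed
  ultimately have "(1 - \<theta>\<^sup>2) / 2 * (exp (\<theta> * \<bar>d\<bar>) / 2) \<le> (1 - \<theta>\<^sup>2) / 2 * cosh (\<theta> * d)"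
    by (intro mult_left_mono) auto
  moreover have "(1 - \<theta>\<^sup>2) / 2 * (exp (\<theta> * \<bar>d\<bar>) / 2) = (1 - \<theta>\<^sup>2) / 4 * exp (\<theta> * \<bar>d\<bar>)"
    by simp
  moreover have "0 \<le> (1 + \<theta>\<^sup>2) / 2" by simp
  ultimately show ?thesis unfolding kern_def by linarith
qed

lemma kern_ge_one:
  assumes "0 < \<theta>" "\<theta> < 1"
  shows "1 \<le> kern \<theta> d"
proof -
  have "\<theta>\<^sup>2 < 1" using assms by (simp add: power_less_one_iff abs_square_less_1)
  then have "(1 - \<theta>\<^sup>2) / 2 * 1 \<le> (1 - \<theta>\<^sup>2) / 2 * cosh (\<theta> * d)"
    by (intro mult_left_mono cosh_real_ge_1) auto
  then show ?thesis unfolding kern_def by (simp add: field_simps)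
qed

lemma kern_pos:
  assumes "0 < \<theta>" "\<theta> < 1"
  shows "0 < kern \<theta> d"
  using kern_ge_one[OF assms, of d] by linarith

lemma cosh_shift_le: "cosh (x::real) \<le> exp \<bar>x - y\<bar> * cosh y"
proof -
  have "exp x \<le> exp (\<bar>x - y\<bar> + y)" "exp (- x) \<le> exp (\<bar>x - y\<bar> - y)" by auto
  then have "exp x \<le> exp \<bar>x - y\<bar> * exp y" "exp (- x) \<le> exp \<bar>x - y\<bar> * exp (- y)"
    by (simp_all only: exp_add[symmetric] diff_conv_add_uminus)
  then show ?thesis by (simp add: cosh_def field_simps)
qed

text \<open>
  The cost is \<open>1\<close>-Lipschitz. This is what makes functions that are regularized by an
  infimal convolution with the cost continuous.
\<close>

lemma kern_shift_le:
  assumes "0 < \<theta>" "\<theta> < 1"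
  shows "kern \<theta> x \<le> exp \<bar>x - y\<bar> * kern \<theta> y"
proof -
  have t: "\<theta>\<^sup>2 < 1" using assms by (simp add: power_less_one_iff abs_square_less_1)
  have "\<bar>\<theta> * x - \<theta> * y\<bar> \<le> \<bar>x - y\<bar>"
    using assms mult_left_le_one_le[of "\<bar>x-y\<bar>" \<theta>] by (simp add: right_diff_distrib[symmetric] abs_mult)
  then have "cosh (\<theta> * x) \<le> exp \<bar>x - y\<bar> * cosh (\<theta> * y)"
    using cosh_shift_le[of "\<theta> * x" "\<theta> * y"]
    by (smt (verit) cosh_real_ge_1 exp_le_cancel_iff mult_right_mono)
  then have "(1 - \<theta>\<^sup>2) / 2 * cosh (\<theta> * x) \<le> (1 - \<theta>\<^sup>2) / 2 * (exp \<bar>x - y\<bar> * cosh (\<theta> * y))"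
    using t by (intro mult_left_mono) auto
  moreover have "(1 + \<theta>\<^sup>2) / 2 * 1 \<le> (1 + \<theta>\<^sup>2) / 2 * exp \<bar>x - y\<bar>"
    by (intro mult_left_mono) auto
  moreover have "exp \<bar>x - y\<bar> * kern \<theta> y =
      (1 + \<theta>\<^sup>2) / 2 * exp \<bar>x - y\<bar> + (1 - \<theta>\<^sup>2) / 2 * (exp \<bar>x - y\<bar> * cosh (\<theta> * y))"
    unfolding kern_def by (simp only: distrib_left mult_ac)
  ultimately show ?thesis unfolding kern_def by linarith
qed

lemma cosh_ge_quadratic: "1 + x\<^sup>2 / 2 \<le> cosh (x::real)"
proof -
  have c: "cosh x = 1 + 2 * (sinh (x/2))\<^sup>2"
    using cosh_double[of "x/2"] cosh_square_eq[of "x/2"] by simp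
  have nn: "y \<le> sinh y" if "0 \<le> y" for y :: real
  proof -
    have "\<exists>z. DERIV (\<lambda>y. sinh y - y) u :> z \<and> 0 \<le> z" for u :: real
      by (rule exI[of _ "cosh u - 1"]) (auto intro!: derivative_eq_intros simp: cosh_real_ge_1)
    from DERIV_nonneg_imp_nondecreasing[OF that this] show ?thesis by simp
  qed
  have "\<bar>x/2\<bar> \<le> \<bar>sinh (x/2)\<bar>"
  proof (cases "x \<ge> 0")
    case True then show ?thesis using nn[of "x/2"] by auto
  next
    case False then show ?thesis using nn[of "-(x/2)"] by auto
  qed
  then have "(x/2)\<^sup>2 \<le> (sinh (x/2))\<^sup>2" by (simp only: abs_le_square_iff)
  then show ?thesis unfolding c by (simp add: power2_eq_square field_simps)
qed

lemma ln_kern_ge_quadratic: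
  assumes "0 < \<theta>" "\<theta> < 1" and d: "\<bar>d\<bar> \<le> D" and c: "c = (1 - \<theta>\<^sup>2) * \<theta>\<^sup>2 / 4"
  shows "d\<^sup>2 * (c / (1 + c * D\<^sup>2)) \<le> ln (kern \<theta> d)"
proof -
  have t: "\<theta>\<^sup>2 < 1" using assms by (simp add: power_less_one_iff abs_square_less_1)
  have c0: "c > 0" unfolding c using t assms by simp
  have "(1 - \<theta>\<^sup>2) / 2 * (1 + (\<theta> * d)\<^sup>2 / 2) \<le> (1 - \<theta>\<^sup>2) / 2 * cosh (\<theta> * d)"
    using t by (intro mult_left_mono cosh_ge_quadratic) auto
  then have k: "1 + c * d\<^sup>2 \<le> kern \<theta> d" unfolding kern_def c by (simp add: field_simps)
  let ?z = "c * d\<^sup>2"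
  have z: "?z \<ge> 0" using c0 by simp
  have "d\<^sup>2 \<le> D\<^sup>2" using d by (metis abs_ge_zero power2_abs power_mono)
  then have zD: "?z \<le> c * D\<^sup>2" using c0 by (intro mult_left_mono) auto
  have "d\<^sup>2 * (c / (1 + c * D\<^sup>2)) = ?z / (1 + c * D\<^sup>2)" by simp
  also have "\<dots> \<le> ?z / (1 + ?z)" using z zD c0 by (intro divide_left_mono) (auto intro!: mult_pos_pos add_pos_nonneg)
  also have "\<dots> \<le> ln (1 + ?z)"
  proof -
    have "ln (1 / (1 + ?z)) \<le> 1 / (1 + ?z) - 1" using z by (intro ln_le_minus_one) auto
    then show ?thesis using z by (simp add: ln_div field_simps)
  qed
  also have "\<dots> \<le> ln (kern \<theta> d)" using k z by (intro ln_mono) auto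
  finally show ?thesis .
qed

section \<open>A two-function inequality on the half-line\<close>

text \<open>
  The inverse of \<open>x \<mapsto> \<integral>\<^sub>0\<^sup>x g / \<integral>\<^sub>0\<^sup>R g\<close>, which transports the uniform law of the unit interval to
  the normalized measure with density \<open>g\<close>.
\<close>

lemma quantile_exists:
  fixes g :: "real \<Rightarrow> real"
  assumes cont: "continuous_on {0..R} g" and pos: "\<And>x. x \<in> {0..R} \<Longrightarrow> 0 < g x" and R: "0 < R"
  obtains X where "continuous_on {0..1} X" "X 0 = 0" "\<And>t. t \<in> {0..1} \<Longrightarrow> X t \<in> {0..R}"
    "\<And>t. 0 < t \<Longrightarrow> t < 1 \<Longrightarrow> 0 < X t"
    "\<And>t. 0 < t \<Longrightarrow> t < 1 \<Longrightarrow> X t < R"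
    "\<And>t. 0 < t \<Longrightarrow> t < 1 \<Longrightarrow> (X has_real_derivative (integral {0..R} g / g (X t))) (at t)"
    "0 < integral {0..R} g"
proof -
  define G where "G x = integral {0..x} g" for x
  have der: "(G has_real_derivative g x) (at x within {0..R})" if "x \<in> {0..R}" for x
    unfolding G_def by (rule integral_has_real_derivative[OF cont that])
  have der': "(G has_real_derivative g x) (at x)" if "0 < x" "x < R" for x
    using der[of x] that at_within_interior[of x "{0..R}"] by (auto simp: interior_atLeastAtMost_real)
  have contG: "continuous_on {0..R} G"
    by (rule DERIV_continuous_on[OF der])
  have mono: "G x < G y" if "x \<in> {0..R}" "y \<in> {0..R}" "x < y" for x y
  proof (rule DERIV_pos_imp_increasing_open[OF \<open>x < y\<close>])
    show "\<exists>z. (G has_real_derivative z) (at u) \<and> 0 < z" if "x < u" "u < y" for u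
      using der'[of u] pos[of u] that \<open>x \<in> _\<close> \<open>y \<in> _\<close> by auto
    show "continuous_on {x..y} G" using that by (intro continuous_on_subset[OF contG]) auto
  qed
  have G0: "G 0 = 0" by (simp add: G_def)
  define I where "I = G R"
  have I: "I > 0" using mono[of 0 R] R by (simp add: I_def G0)
  define F where "F x = G x / I" for x
  have monoF: "F x < F y" if "x \<in> {0..R}" "y \<in> {0..R}" "x < y" for x y
    using mono[OF that] I by (simp add: F_def divide_strict_right_mono)
  have inj: "inj_on F {0..R}"
    by (rule inj_onI) (metis monoF less_irrefl linorder_neqE_linordered_idom)
  have contF: "continuous_on {0..R} F" unfolding F_def using contG I by (intro continuous_intros) auto
  have F0: "F 0 = 0" and F1: "F R = 1" using I by (simp_all add: F_def G0 I_def)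
  have img: "F ` {0..R} = {0..1}"
  proof
    show "F ` {0..R} \<subseteq> {0..1}"
    proof safe
      fix x assume x: "x \<in> {0..R}"
      have "F 0 \<le> F x" using monoF[of 0 x] x by (cases "x = 0") auto
      moreover have "F x \<le> F R" using monoF[of x R] x by (cases "x = R") auto
      ultimately show "F x \<in> {0..1}" by (simp add: F0 F1)
    qed
    show "{0..1} \<subseteq> F ` {0..R}"
    proof
      fix t :: real assume "t \<in> {0..1}"
      then obtain x where "0 \<le> x" "x \<le> R" "F x = t"
        using IVT'[of F 0 t R] F0 F1 contF R by auto
      then show "t \<in> F ` {0..R}" by auto
    qed
  qed
  define X where "X = the_inv_into {0..R} F"
  have XF: "X (F x) = x" if "x \<in> {0..R}" for x
    unfolding X_def using the_inv_into_f_f[OF inj that] .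
  have FX: "F (X t) = t" "X t \<in> {0..R}" if "t \<in> {0..1}" for t
    using that unfolding X_def img[symmetric] 
    by (auto intro: f_the_inv_into_f[OF inj] the_inv_into_into[OF inj] simp: subset_refl)
       (metis atLeastAtMost_iff img imageI inj order_refl the_inv_into_into)+
  have contX: "continuous_on {0..1} X"
    using continuous_on_inv[OF contF compact_Icc] XF img by auto
  have X0: "X 0 = 0" using XF[of 0] F0 R by simp
  have Xin: "0 < X t" "X t < R" if "0 < t" "t < 1" for t
  proof -
    have "X t \<noteq> 0" using FX(1)[of t] that F0 by force
    moreover have "X t \<noteq> R" using FX(1)[of t] that F1 by force
    ultimately show "0 < X t" "X t < R" using FX(2)[of t] that by auto
  qed
  have derX: "(X has_real_derivative (I / g (X t))) (at t)" if t: "0 < t" "t < 1" for t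
  proof -
    have "(F has_real_derivative (g (X t) / I)) (at (X t))"
      unfolding F_def using der'[OF Xin[OF t]] by (rule DERIV_cdivide)
    moreover have "g (X t) / I \<noteq> 0" using pos[of "X t"] Xin[OF t] I by auto
    moreover have "isCont X t"
      using contX t continuous_on_interior[of "{0..1}" X t] by (auto simp: interior_atLeastAtMost_real)
    ultimately have "(X has_real_derivative inverse (g (X t) / I)) (at t)"
      using t FX(1) by (intro DERIV_inverse_function[where a=0 and b=1]) auto
    then show ?thesis by simp
  qed
  show ?thesis
    by (rule that[of X]) (use contX X0 FX Xin derX I in \<open>auto simp: I_def G_def\<close>)
qed

text \<open>
  The potential \<open>S = - ln (1 - \<integral>\<^sub>0\<^sup>x w)\<close> pushes the law with density \<open>w\<close> forward to the
  standard exponential law: \<open>w = S' exp (- S)\<close>. Costs are therefore measured in the coordinate \<open>S\<close>.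
\<close>

lemma survival_potential_deriv:
  fixes w :: "real \<Rightarrow> real"
  assumes wc: "continuous_on {0..} w" and w1: "\<And>x. 0 \<le> x \<Longrightarrow> integral {0..x} w < 1"
    and S: "\<And>x. S x = - ln (1 - integral {0..x} w)" and x: "0 < x"
  shows "(S has_real_derivative w x * exp (S x)) (at x)"
proof -
  have "((\<lambda>x. integral {0..x} w) has_real_derivative w x) (at x within {0..x+1})"
    using x by (intro integral_has_real_derivative continuous_on_subset[OF wc]) auto
  then have "((\<lambda>x. integral {0..x} w) has_real_derivative w x) (at x)"
    using x at_within_interior[of x "{0..x+1}"] by (auto simp: interior_atLeastAtMost_real)
  then have "((\<lambda>x. - ln (1 - integral {0..x} w)) has_real_derivative - (1 / (1 - integral {0..x} w) * (0 - w x))) (at x)"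
    using w1[of x] x by (auto intro!: derivative_eq_intros)
  then show ?thesis using w1[of x] x unfolding S[abs_def] by (simp add: exp_minus ln_inverse inverse_eq_divide)
qed

lemma survival_potential_continuous:
  fixes w :: "real \<Rightarrow> real"
  assumes wc: "continuous_on {0..} w" and w1: "\<And>x. 0 \<le> x \<Longrightarrow> integral {0..x} w < 1"
    and S: "\<And>x. S x = - ln (1 - integral {0..x} w)"
  shows "continuous_on {0..R} S"
proof -
  have "continuous_on {0..R} (\<lambda>x. integral {0..x} w)"
    by (intro indefinite_integral_continuous_1 integrable_continuous_real continuous_on_subset[OF wc]) auto
  then show ?thesis unfolding S[abs_def]
    using w1 by (intro continuous_intros) force+
qed

text \<open>
  Maurey's property for the exponential law, in the coordinate \<open>S\<close>. Parametrize the two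
  measures \<open>a w\<close> and \<open>b w\<close>, of masses \<open>A\<close> and \<open>B\<close>, by their quantiles \<open>X t\<close> and \<open>Y t\<close>. With \<open>m\<close> and
  \<open>d\<close> the half sum and the difference of \<open>S (X t)\<close> and \<open>S (Y t)\<close>, the function \<open>- exp (- m) cosh (\<theta> d / 2)\<close>
  starts at \<open>-1\<close>, stays negative, and its derivative is at least \<open>sqrt (A B)\<close>, by the inequality of
  arithmetic and geometric means and the hypothesis on \<open>a\<close> and \<open>b\<close>.
\<close>

lemma two_function_ineq_continuous:
  fixes w a b S :: "real \<Rightarrow> real"
  assumes th: "0 < \<theta>" "\<theta> < 1"
    and wc: "continuous_on {0..} w" and wpos: "\<And>x. 0 \<le> x \<Longrightarrow> 0 < w x"
    and w1: "\<And>x. 0 \<le> x \<Longrightarrow> integral {0..x} w < 1"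
    and S: "\<And>x. S x = - ln (1 - integral {0..x} w)"
    and ac: "continuous_on {0..} a" and apos: "\<And>x. 0 \<le> x \<Longrightarrow> 0 < a x"
    and bc: "continuous_on {0..} b" and bpos: "\<And>x. 0 \<le> x \<Longrightarrow> 0 < b x"
    and ab: "\<And>x y. 0 \<le> x \<Longrightarrow> 0 \<le> y \<Longrightarrow> a x * b y \<le> kern \<theta> (S x - S y)"
    and R: "0 < R"
  shows "integral {0..R} (\<lambda>x. a x * w x) * integral {0..R} (\<lambda>x. b x * w x) \<le> 1"
proof -
  let ?g = "\<lambda>x. a x * w x" and ?h = "\<lambda>x. b x * w x"
  have gc: "continuous_on {0..R} ?g" and hc: "continuous_on {0..R} ?h"
    by (intro continuous_on_mult continuous_on_subset[OF ac] continuous_on_subset[OF bc]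
        continuous_on_subset[OF wc]; auto)+
  have gp: "x \<in> {0..R} \<Longrightarrow> 0 < ?g x" and hp: "x \<in> {0..R} \<Longrightarrow> 0 < ?h x" for x
    using apos bpos wpos by auto
  define A where "A = integral {0..R} ?g"
  define B where "B = integral {0..R} ?h"
  obtain X where X: "continuous_on {0..1} X" "X 0 = 0" "\<And>t. t \<in> {0..1} \<Longrightarrow> X t \<in> {0..R}"
    "\<And>t. 0 < t \<Longrightarrow> t < 1 \<Longrightarrow> 0 < X t"
    "\<And>t. 0 < t \<Longrightarrow> t < 1 \<Longrightarrow> (X has_real_derivative (A / ?g (X t))) (at t)" and A: "0 < A"
  proof (rule quantile_exists[OF gc gp R, folded A_def])
    fix X assume "continuous_on {0..1} X" "X 0 = 0" "\<And>t. t \<in> {0..1} \<Longrightarrow> X t \<in> {0..R}"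
      "\<And>t. 0 < t \<Longrightarrow> t < 1 \<Longrightarrow> 0 < X t"
      "\<And>t. 0 < t \<Longrightarrow> t < 1 \<Longrightarrow> (X has_real_derivative (A / ?g (X t))) (at t)" "0 < A"
    then show thesis by (rule that)
  qed assumption
  obtain Y where Y: "continuous_on {0..1} Y" "Y 0 = 0" "\<And>t. t \<in> {0..1} \<Longrightarrow> Y t \<in> {0..R}"
    "\<And>t. 0 < t \<Longrightarrow> t < 1 \<Longrightarrow> 0 < Y t"
    "\<And>t. 0 < t \<Longrightarrow> t < 1 \<Longrightarrow> (Y has_real_derivative (B / ?h (Y t))) (at t)" and B: "0 < B"
  proof (rule quantile_exists[OF hc hp R, folded B_def])
    fix X assume "continuous_on {0..1} X" "X 0 = 0" "\<And>t. t \<in> {0..1} \<Longrightarrow> X t \<in> {0..R}"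
      "\<And>t. 0 < t \<Longrightarrow> t < 1 \<Longrightarrow> 0 < X t"
      "\<And>t. 0 < t \<Longrightarrow> t < 1 \<Longrightarrow> (X has_real_derivative (B / ?h (X t))) (at t)" "0 < B"
    then show thesis by (rule that)
  qed assumption
  have Sc: "continuous_on {0..R} S" by (rule survival_potential_continuous[OF wc w1 S])
  define u where "u t = S (X t)" for t
  define z where "z t = S (Y t)" for t
  have uc: "continuous_on {0..1} u" unfolding u_def
    by (rule continuous_on_compose2[OF Sc X(1)]) (use X(3) in auto)
  have zc: "continuous_on {0..1} z" unfolding z_def
    by (rule continuous_on_compose2[OF Sc Y(1)]) (use Y(3) in auto)
  have ud: "(u has_real_derivative (A * exp (u t) / a (X t))) (at t)" if t: "0 < t" "t < 1" for t
  proof -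
    have "(u has_real_derivative w (X t) * exp (S (X t)) * (A / ?g (X t))) (at t)"
      unfolding u_def
      by (rule DERIV_chain2[OF survival_potential_deriv[OF wc w1 S X(4)[OF t]] X(5)[OF t]])
    then show ?thesis using wpos[of "X t"] apos[of "X t"] X(4)[OF t] by (simp add: u_def field_simps)
  qed
  have zd: "(z has_real_derivative (B * exp (z t) / b (Y t))) (at t)" if t: "0 < t" "t < 1" for t
  proof -
    have "(z has_real_derivative w (Y t) * exp (S (Y t)) * (B / ?h (Y t))) (at t)"
      unfolding z_def
      by (rule DERIV_chain2[OF survival_potential_deriv[OF wc w1 S Y(4)[OF t]] Y(5)[OF t]])
    then show ?thesis using wpos[of "Y t"] bpos[of "Y t"] Y(4)[OF t] by (simp add: z_def field_simps)
  qed
  \<comment> \<open>The linear term makes the claimed lower bound of the derivative a monotonicity statement.\<close>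
  define \<Phi> where "\<Phi> t = - exp (- (u t + z t) / 2) * cosh (\<theta> * (u t - z t) / 2) - sqrt (A * B) * t" for t
  have "\<Phi> 0 \<le> \<Phi> 1"
  proof (rule DERIV_nonneg_imp_increasing_open[where f = \<Phi> and a = 0 and b = 1])
    show "continuous_on {0..1} \<Phi>" unfolding \<Phi>_def by (intro continuous_intros uc zc) auto
    fix t :: real assume t: "0 < t" "t < 1"
    define p where "p = A * exp (u t) / a (X t)"
    define q where "q = B * exp (z t) / b (Y t)"
    define ch where "ch = cosh (\<theta> * (u t - z t) / 2)"
    define sh where "sh = sinh (\<theta> * (u t - z t) / 2)"
    define E where "E = exp (- (u t + z t) / 2)"
    have E: "E > 0" by (simp add: E_def)
    have up: "(u has_real_derivative p) (at t)" and zq: "(z has_real_derivative q) (at t)"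
      using ud[OF t] zd[OF t] by (simp_all add: p_def q_def)
    have pp: "p > 0" "q > 0" unfolding p_def q_def
      using A B apos[of "X t"] bpos[of "Y t"] X(4)[OF t] Y(4)[OF t] by auto
    have der: "(\<Phi> has_real_derivative (E * (p * (ch / 2 - \<theta> * sh / 2) + q * (ch / 2 + \<theta> * sh / 2)) - sqrt (A * B))) (at t)"
      unfolding \<Phi>_def
      by (auto intro!: derivative_eq_intros up zq simp: E_def ch_def sh_def) (simp add: field_simps)
    have chsh: "\<bar>sh\<bar> \<le> ch" unfolding sh_def ch_def
      by (smt (verit) cosh_minus_sinh cosh_plus_sinh exp_gt_zero)
    moreover have "\<bar>\<theta> * sh\<bar> \<le> \<bar>sh\<bar>" using th mult_left_le_one_le[of "\<bar>sh\<bar>" \<theta>]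
      by (simp add: abs_mult)
    ultimately have tsh: "\<bar>\<theta> * sh\<bar> \<le> ch" by linarith
    \<comment> \<open>Up to the positive factor \<open>E\<close>, the coefficients of \<open>p / 2\<close> and \<open>q / 2\<close> in the derivative. Their product is \<open>\<psi>\<^sup>2 - 4 \<psi>'\<^sup>2\<close>, the kernel.\<close>
    define c1 where "c1 = ch - \<theta> * sh"
    define c2 where "c2 = ch + \<theta> * sh"
    have c12: "c1 \<ge> 0" "c2 \<ge> 0" using tsh unfolding c1_def c2_def by linarith+
    have ck: "c1 * c2 = kern \<theta> (u t - z t)" unfolding c1_def c2_def kern_half ch_def sh_def
      by (simp add: power2_eq_square algebra_simps)
    have am: "sqrt ((p * c1) * (q * c2)) \<le> (p * c1 + q * c2) / 2"
      using arith_geo_mean_sqrt[of "p * c1" "q * c2"] pp c12 by simp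
    have k: "a (X t) * b (Y t) \<le> kern \<theta> (u t - z t)"
      using ab[of "X t" "Y t"] X(4)[OF t] Y(4)[OF t] by (simp add: u_def z_def)
    have abp: "a (X t) > 0" "b (Y t) > 0" using apos[of "X t"] bpos[of "Y t"] X(4)[OF t] Y(4)[OF t] by auto
    have EE: "E\<^sup>2 * exp (u t) * exp (z t) = 1"
      unfolding E_def power2_eq_square exp_add[symmetric] by (simp add: field_simps)
    have "E\<^sup>2 * ((p * c1) * (q * c2)) = A * B * (E\<^sup>2 * exp (u t) * exp (z t)) * (c1 * c2) / (a (X t) * b (Y t))"
      unfolding p_def q_def using abp by (simp add: field_simps)
    also have "\<dots> = A * B * (kern \<theta> (u t - z t) / (a (X t) * b (Y t)))"
      unfolding EE ck by simp
    finally have e: "E\<^sup>2 * ((p * c1) * (q * c2)) = A * B * (kern \<theta> (u t - z t) / (a (X t) * b (Y t)))" .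
    \<comment> \<open>This is the only place where the hypothesis on \<open>a\<close> and \<open>b\<close> enters.\<close>
    have "1 \<le> kern \<theta> (u t - z t) / (a (X t) * b (Y t))" using k abp by simp
    then have "A * B * 1 \<le> E\<^sup>2 * ((p * c1) * (q * c2))" unfolding e using A B
      by (intro mult_left_mono) auto
    then have "sqrt (A * B) \<le> sqrt (E\<^sup>2 * ((p * c1) * (q * c2)))" by (simp only: real_sqrt_le_iff mult_1_right)
    also have "\<dots> = E * sqrt ((p * c1) * (q * c2))" using E by (simp add: real_sqrt_mult)
    also have "\<dots> \<le> E * ((p * c1 + q * c2) / 2)" using am E by (intro mult_left_mono) auto
    also have "\<dots> = E * (p * (ch / 2 - \<theta> * sh / 2) + q * (ch / 2 + \<theta> * sh / 2))"
      unfolding c1_def c2_def by (simp add: field_simps)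
    finally show "\<exists>y. (\<Phi> has_real_derivative y) (at t) \<and> 0 \<le> y" using der by force
  qed simp
  moreover have "\<Phi> 0 = -1" by (simp add: \<Phi>_def u_def z_def X(2) Y(2) S)
  moreover have "\<Phi> 1 \<le> - sqrt (A * B)"
    unfolding \<Phi>_def by (simp add: cosh_real_nonneg)
  ultimately have "sqrt (A * B) \<le> 1" by linarith
  then show ?thesis unfolding A_def B_def by (simp add: real_sqrt_le_1_iff)
qed

text \<open>
  The best \<open>b'\<close> for a given \<open>a\<close> is \<open>b' y = inf\<^sub>x kern \<theta> (S x - S y) / a x\<close>. It inherits the
  Lipschitz bound of the cost, so \<open>ln b'\<close> is continuous, whatever the regularity of \<open>a\<close>.
\<close>

lemma log_continuous_majorant:
  fixes a b S :: "real \<Rightarrow> real"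
  assumes th: "0 < \<theta>" "\<theta> < 1" and Sc: "continuous_on {0..} S"
    and a0: "\<And>x. 0 \<le> x \<Longrightarrow> 0 \<le> a x" and b0: "\<And>x. 0 \<le> x \<Longrightarrow> 0 \<le> b x"
    and x0: "0 \<le> x0" "0 < a x0" and y0: "0 \<le> y0" "0 < b y0"
    and ab: "\<And>x y. 0 \<le> x \<Longrightarrow> 0 \<le> y \<Longrightarrow> a x * b y \<le> kern \<theta> (S x - S y)"
  obtains b' where "continuous_on {0..} b'" "\<And>y. 0 \<le> y \<Longrightarrow> 0 < b' y"
    "\<And>y. 0 \<le> y \<Longrightarrow> b y \<le> b' y"
    "\<And>x y. 0 \<le> x \<Longrightarrow> 0 \<le> y \<Longrightarrow> a x * b' y \<le> kern \<theta> (S x - S y)"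
proof -
  let ?k = "\<lambda>x y. kern \<theta> (S x - S y)"
  have kp: "0 < ?k x y" for x y by (rule kern_pos[OF th])
  have kk: "?k x z \<le> exp \<bar>S y - S z\<bar> * ?k x y" for x y z
    using kern_shift_le[OF th, of "S x - S z" "S x - S y"] by simp
  \<comment> \<open>The majorant is \<open>1 / h\<close>.\<close>
  define h where "h y = (SUP x\<in>{0..}. a x / ?k x y)" for y
  have bdd: "bdd_above ((\<lambda>x. a x / ?k x y) ` {0..})" for y
  proof (rule bdd_aboveI2)
    fix x :: real assume x: "x \<in> {0..}"
    have "a x * b y0 \<le> exp \<bar>S y - S y0\<bar> * ?k x y" using ab[of x y0] x y0 kk[of x y0 y] by simp
    then show "a x / ?k x y \<le> exp \<bar>S y - S y0\<bar> / b y0" using y0 kp[of x y] by (simp add: field_simps)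
  qed
  have hge: "a x / ?k x y \<le> h y" if "0 \<le> x" for x y
    unfolding h_def by (rule cSUP_upper[OF _ bdd]) (use that in auto)
  have hpos: "0 < h y" for y
    using hge[OF x0(1), of y] x0 kp[of x0 y] by (smt (verit) divide_pos_pos)
  have hle: "h y \<le> exp \<bar>S y - S z\<bar> * h z" for y z
  proof -
    have "a x / ?k x y \<le> exp \<bar>S y - S z\<bar> * h z" if "x \<in> {0..}" for x
    proof -
      have "a x * ?k x z \<le> a x * (exp \<bar>S y - S z\<bar> * ?k x y)" using a0[of x] that
        by (intro mult_left_mono kk) auto
      then have "a x / ?k x y \<le> exp \<bar>S y - S z\<bar> * (a x / ?k x z)"
        using kp[of x y] kp[of x z] by (simp add: field_simps)
      also have "\<dots> \<le> exp \<bar>S y - S z\<bar> * h z" using hge[of x z] that by (intro mult_left_mono) auto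
      finally show ?thesis .
    qed
    then show ?thesis unfolding h_def[of y] by (intro cSUP_least) auto
  qed
  have lnh: "\<bar>ln (h y) - ln (h z)\<bar> \<le> \<bar>S y - S z\<bar>" for y z
  proof -
    have 1: "ln (h y) \<le> \<bar>S y - S z\<bar> + ln (h z)" for y z
    proof -
      have "ln (h y) \<le> ln (exp \<bar>S y - S z\<bar> * h z)" using hle[of y z] hpos[of y] by (intro ln_mono) auto
      then show ?thesis using hpos[of z] by (simp add: ln_mult)
    qed
    show ?thesis using 1[of y z] 1[of z y] by (simp add: abs_minus_commute abs_le_iff)
  qed
  have lc: "continuous_on {0..} (\<lambda>y. ln (h y))"
    unfolding continuous_on_iff
  proof (intro ballI allI impI)
    fix x e :: real assume "x \<in> {0..}" "0 < e"
    then obtain d where "d > 0" "\<forall>x'\<in>{0..}. dist x' x < d \<longrightarrow> dist (S x') (S x) < e"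
      using Sc unfolding continuous_on_iff by blast
    then show "\<exists>d>0. \<forall>x'\<in>{0..}. dist x' x < d \<longrightarrow> dist (ln (h x')) (ln (h x)) < e"
      using lnh by (metis dist_real_def order.strict_trans1)
  qed
  have hc: "continuous_on {0..} h"
    using continuous_on_exp[OF lc] hpos by simp
  show ?thesis
  proof (rule that[of "\<lambda>y. 1 / h y"])
    show "continuous_on {0..} (\<lambda>y. 1 / h y)" using hc hpos
      by (intro continuous_intros) (auto simp: less_imp_neq[THEN not_sym])
    show "0 < 1 / h y" if "0 \<le> y" for y using hpos[of y] by simp
    show "b y \<le> 1 / h y" if "0 \<le> y" for y
    proof (cases "b y = 0")
      case True then show ?thesis using hpos[of y] by simp
    next
      case False
      then have bp: "b y > 0" using b0[OF that] by simp
      have "h y \<le> 1 / b y" unfolding h_def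
        using ab[OF _ that] kp by (intro cSUP_least) (auto simp: bp field_simps)
      then show ?thesis using bp hpos[of y] by (simp add: field_simps)
    qed
    show "a x * (1 / h y) \<le> ?k x y" if "0 \<le> x" "0 \<le> y" for x y
      using hge[OF that(1), of y] hpos[of y] kp[of x y] by (simp add: field_simps)
  qed
qed

lemma nn_integral_indicator_Icc:
  fixes g :: "real \<Rightarrow> real"
  assumes "continuous_on {0..R} g" "\<And>x. x \<in> {0..R} \<Longrightarrow> 0 \<le> g x"
  shows "(\<integral>\<^sup>+x. ennreal (indicator {0..R} x * g x) \<partial>lborel) = ennreal (integral {0..R} g)"
  by (rule nn_integral_has_integral_lebesgue[OF assms(2)])
     (use assms(1) in \<open>auto intro: integrable_integral integrable_continuous_real\<close>)

lemma nn_integral_half_line_SUP: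
  fixes g :: "real \<Rightarrow> real"
  assumes gc: "continuous_on {0..} g" and g0: "\<And>x. 0 \<le> x \<Longrightarrow> 0 \<le> g x"
  shows "(\<integral>\<^sup>+x. ennreal (indicator {0..} x * g x) \<partial>lborel) = (SUP k::nat. ennreal (integral {0..real (Suc k)} g))"
proof -
  have m: "(\<lambda>x. indicator {0..real (Suc k)} x * g x) \<in> borel_measurable borel" for k
    using borel_measurable_continuous_on_indicator[of "{0..real (Suc k)}" g] continuous_on_subset[OF gc]
    by auto
  have "(\<integral>\<^sup>+x. ennreal (indicator {0..} x * g x) \<partial>lborel)
      = (\<integral>\<^sup>+x. (SUP k::nat. ennreal (indicator {0..real (Suc k)} x * g x)) \<partial>lborel)"
  proof (intro nn_integral_cong)
    fix x :: real
    show "ennreal (indicator {0..} x * g x) = (SUP k::nat. ennreal (indicator {0..real (Suc k)} x * g x))"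
    proof (cases "0 \<le> x")
      case True
      obtain k :: nat where k: "x \<le> real k" using real_arch_simple by blast
      show ?thesis
      proof (rule antisym)
        show "ennreal (indicator {0..} x * g x) \<le> (SUP k::nat. ennreal (indicator {0..real (Suc k)} x * g x))"
          by (rule SUP_upper2[of k]) (use True k in auto)
        show "(SUP k::nat. ennreal (indicator {0..real (Suc k)} x * g x)) \<le> ennreal (indicator {0..} x * g x)"
          using True g0[of x] by (intro SUP_least ennreal_leI) (auto simp: indicator_def)
      qed
    qed auto
  qed
  also have "\<dots> = (SUP k::nat. \<integral>\<^sup>+x. ennreal (indicator {0..real (Suc k)} x * g x) \<partial>lborel)"
  proof (rule nn_integral_monotone_convergence_SUP)
    show "incseq (\<lambda>k x. ennreal (indicator {0..real (Suc k)} x * g x))"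
      using g0 by (auto simp: incseq_def le_fun_def indicator_def intro!: ennreal_leI)
    show "(\<lambda>x. ennreal (indicator {0..real (Suc k)} x * g x)) \<in> borel_measurable lborel" for k
      using m[of k] by simp
  qed
  also have "\<dots> = (SUP k::nat. ennreal (integral {0..real (Suc k)} g))"
    using g0 by (intro SUP_cong refl nn_integral_indicator_Icc continuous_on_subset[OF gc]) auto
  finally show ?thesis .
qed

lemma integral_less_one:
  fixes w :: "real \<Rightarrow> real"
  assumes wc: "continuous_on {0..} w" and wpos: "\<And>x. 0 \<le> x \<Longrightarrow> 0 < w x"
    and mass: "(\<integral>\<^sup>+x. ennreal (indicator {0..} x * w x) \<partial>lborel) = 1" and x: "0 \<le> x"
  shows "integral {0..x} w < 1"
proof -
  obtain k :: nat where k: "x < real k" using reals_Archimedean2 by blast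
  have int: "w integrable_on {a..b}" if "0 \<le> a" for a b
    by (intro integrable_continuous_real continuous_on_subset[OF wc]) (use that in auto)
  have "integral {0..real (Suc k)} w = integral {0..x} w + integral {x..real (Suc k)} w"
    using int[of 0 "real (Suc k)"] x k by (subst Henstock_Kurzweil_Integration.integral_combine) auto
  moreover have "0 < integral {x..real (Suc k)} w"
  proof -
    have "0 \<le> integral {x..real (Suc k)} w" 
      using wpos x by (intro Henstock_Kurzweil_Integration.integral_nonneg int) (auto intro: less_imp_le)
    moreover have "integral {x..real (Suc k)} w \<noteq> 0"
    proof
      assume "integral {x..real (Suc k)} w = 0"
      then have "\<forall>t\<in>{x..real (Suc k)}. w t = 0"
        using wpos x k by (subst (asm) integral_eq_0_iff) (auto intro: less_imp_le continuous_on_subset[OF wc])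
      then show False using wpos[OF x] x k by force
    qed
    ultimately show ?thesis by simp
  qed
  moreover have "ennreal (integral {0..real (Suc k)} w) \<le> 1"
    using SUP_upper[of k UNIV "\<lambda>k. ennreal (integral {0..real (Suc k)} w)"]
      nn_integral_half_line_SUP[OF wc less_imp_le[OF wpos]] mass by simp
  then have "integral {0..real (Suc k)} w \<le> 1"
    by (simp add: ennreal_le_1)
  ultimately show ?thesis by linarith
qed

text \<open>
  Replacing first \<open>b\<close> and then \<open>a\<close> by its best majorant reduces measurable functions to
  continuous positive ones. The bounded intervals then exhaust the half-line.
\<close>

lemma two_function_ineq:
  fixes w S :: "real \<Rightarrow> real" and a b :: "real \<Rightarrow> ennreal"
  assumes th: "0 < \<theta>" "\<theta> < 1"
    and wc: "continuous_on {0..} w" and wpos: "\<And>x. 0 \<le> x \<Longrightarrow> 0 < w x"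
    and mass: "(\<integral>\<^sup>+x. ennreal (indicator {0..} x * w x) \<partial>lborel) = 1"
    and S: "\<And>x. S x = - ln (1 - integral {0..x} w)"
    and \<mu>: "\<mu> = density lborel (\<lambda>x. ennreal (indicator {0..} x * w x))"
    and am[measurable]: "a \<in> borel_measurable borel" and bm[measurable]: "b \<in> borel_measurable borel"
    and ab: "\<And>x y. a x * b y \<le> ennreal (kern \<theta> (S x - S y))"
  shows "(\<integral>\<^sup>+x. a x \<partial>\<mu>) * (\<integral>\<^sup>+x. b x \<partial>\<mu>) \<le> 1"
proof -
  note w1 = integral_less_one[OF wc wpos mass]
  have wm[measurable]: "(\<lambda>x. indicator {0..} x * w x) \<in> borel_measurable borel"
    using borel_measurable_continuous_on_indicator[OF _ wc] by simp
  have eq: "(\<integral>\<^sup>+x. c x \<partial>\<mu>) = (\<integral>\<^sup>+x. ennreal (indicator {0..} x * w x) * c x \<partial>lborel)"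
    if [measurable]: "c \<in> borel_measurable borel" for c
    unfolding \<mu> by (subst nn_integral_density) auto
  have ex: "\<exists>x\<ge>0. c x \<noteq> 0" if "c \<in> borel_measurable borel" "(\<integral>\<^sup>+x. c x \<partial>\<mu>) \<noteq> 0" for c
  proof (rule ccontr)
    assume "\<not> ?thesis"
    then have "(\<integral>\<^sup>+x. c x \<partial>\<mu>) = (\<integral>\<^sup>+x. 0 \<partial>(lborel :: real measure))"
      unfolding eq[OF that(1)] by (intro nn_integral_cong) (auto simp: indicator_def)
    then show False using that by simp
  qed
  show ?thesis
  proof (cases "(\<integral>\<^sup>+x. a x \<partial>\<mu>) = 0 \<or> (\<integral>\<^sup>+x. b x \<partial>\<mu>) = 0")
    case True then show ?thesis by auto
  next
    case False
    then obtain x0 y0 where x0: "0 \<le> x0" "a x0 \<noteq> 0" and y0: "0 \<le> y0" "b y0 \<noteq> 0"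
      using ex[OF am] ex[OF bm] by blast
    have afin: "a x \<noteq> \<top>" for x using ab[of x y0] y0(2) by (auto simp: ennreal_top_mult top_unique)
    have bfin: "b y \<noteq> \<top>" for y using ab[of x0 y] x0(2) by (auto simp: ennreal_mult_top top_unique)
    define ar where "ar x = enn2real (a x)" for x
    define br where "br x = enn2real (b x)" for x
    have ar: "a x = ennreal (ar x)" "0 \<le> ar x" and br: "b x = ennreal (br x)" "0 \<le> br x" for x
      using afin[of x] bfin[of x] by (simp_all add: ar_def br_def less_top)
    have abr: "ar x * br y \<le> kern \<theta> (S x - S y)" for x y
      using ab[of x y] kern_pos[OF th, of "S x - S y"] unfolding ar br
      by (simp add: ennreal_mult[symmetric] ar(2) br(2) ennreal_le_iff)
    have pa: "0 < ar x0" and pb: "0 < br y0" using x0 y0 ar[of x0] br[of y0] by (auto simp: less_le)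
    have Sc: "continuous_on {0..} S"
      unfolding continuous_on_eq_continuous_within
    proof
      fix x :: real assume x: "x \<in> {0..}"
      have "continuous (at x within {0..x+1}) S"
        using survival_potential_continuous[OF wc w1 S, of "x+1"] x
        by (simp add: continuous_on_eq_continuous_within)
      moreover have "at x within {0..} = at x within {0..x+1}"
        using x by (intro at_within_nhd[of x "{..<x+1}"]) auto
      ultimately show "continuous (at x within {0..}) S" by (simp add: continuous_within)
    qed
    obtain b' where b': "continuous_on {0..} b'" "\<And>y. 0 \<le> y \<Longrightarrow> 0 < b' y"
      "\<And>y. 0 \<le> y \<Longrightarrow> br y \<le> b' y" "\<And>x y. 0 \<le> x \<Longrightarrow> 0 \<le> y \<Longrightarrow> ar x * b' y \<le> kern \<theta> (S x - S y)"
      by (rule log_continuous_majorant[OF th Sc ar(2) br(2) x0(1) pa y0(1) pb abr]) (assumption | rule that)+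
    have ba: "b' x * ar y \<le> kern \<theta> (S x - S y)" if "0 \<le> x" "0 \<le> y" for x y
      using b'(4)[OF that(2,1)] kern_minus[of \<theta> "S y - S x"] by (simp add: mult.commute)
    obtain a' where a': "continuous_on {0..} a'" "\<And>y. 0 \<le> y \<Longrightarrow> 0 < a' y"
      "\<And>y. 0 \<le> y \<Longrightarrow> ar y \<le> a' y" "\<And>x y. 0 \<le> x \<Longrightarrow> 0 \<le> y \<Longrightarrow> b' x * a' y \<le> kern \<theta> (S x - S y)"
      by (rule log_continuous_majorant[OF th Sc less_imp_le[OF b'(2)] ar(2) y0(1) b'(2)[OF y0(1)] x0(1) pa ba]) (assumption | rule that)+
    have ab': "a' x * b' y \<le> kern \<theta> (S x - S y)" if "0 \<le> x" "0 \<le> y" for x y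
      using a'(4)[OF that(2,1)] kern_minus[of \<theta> "S y - S x"] by (simp add: mult.commute)
    have le: "(\<integral>\<^sup>+x. c x \<partial>\<mu>) \<le> (SUP k::nat. ennreal (integral {0..real (Suc k)} (\<lambda>x. c' x * w x)))"
      if "c \<in> borel_measurable borel" "continuous_on {0..} c'" "\<And>y. 0 \<le> y \<Longrightarrow> 0 < c' y"
        "\<And>y. 0 \<le> y \<Longrightarrow> c y \<le> ennreal (c' y)" for c c'
    proof -
      have "(\<integral>\<^sup>+x. c x \<partial>\<mu>) \<le> (\<integral>\<^sup>+x. ennreal (indicator {0..} x * (c' x * w x)) \<partial>lborel)"
        unfolding eq[OF that(1)]
      proof (intro nn_integral_mono)
        fix x :: real
        show "ennreal (indicator {0..} x * w x) * c x \<le> ennreal (indicator {0..} x * (c' x * w x))"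
        proof (cases "0 \<le> x")
          case True
          have "ennreal (w x) * c x \<le> ennreal (w x) * ennreal (c' x)" using that(4)[OF True] by (intro mult_left_mono) auto
          then show ?thesis using True wpos[OF True] that(3)[OF True] by (simp add: ennreal_mult mult.commute)
        qed auto
      qed
      also have "\<dots> = (SUP k::nat. ennreal (integral {0..real (Suc k)} (\<lambda>x. c' x * w x)))"
        using wpos that(3) by (intro nn_integral_half_line_SUP continuous_on_mult that wc) (auto intro: less_imp_le)
      finally show ?thesis .
    qed
    define A where "A k = integral {0..real (Suc k)} (\<lambda>x. a' x * w x)" for k :: nat
    define B where "B k = integral {0..real (Suc k)} (\<lambda>x. b' x * w x)" for k :: nat
    have int: "(\<lambda>x. c x * w x) integrable_on {0..r}" if "continuous_on {0..} c" for c r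
      by (intro integrable_continuous_real continuous_on_mult continuous_on_subset[OF that] continuous_on_subset[OF wc]) auto
    have nn: "0 \<le> a' x * w x" "0 \<le> b' x * w x" if "0 \<le> x" for x
      using a'(2)[OF that] b'(2)[OF that] wpos[OF that] by simp_all
    have A0: "0 \<le> A k" and B0: "0 \<le> B k" for k
      unfolding A_def B_def
      by (rule Henstock_Kurzweil_Integration.integral_nonneg; use nn a'(1) b'(1) int in auto)+
    have mono: "A j \<le> A k" "B j \<le> B k" if "j \<le> k" for j k
      unfolding A_def B_def
      by (rule integral_subset_le; use nn that a'(1) b'(1) int in auto)+
    have "A j * B k \<le> 1" for j k
    proof -
      have "A j * B k \<le> A (max j k) * B (max j k)"
        by (intro mult_mono mono A0 B0) auto
      also have "\<dots> \<le> 1" unfolding A_def B_def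
        by (rule two_function_ineq_continuous[OF th wc wpos w1 S a'(1,2) b'(1,2) ab']) auto
      finally show ?thesis .
    qed
    then have AB: "ennreal (A j) * ennreal (B k) \<le> 1" for j k
      by (simp add: ennreal_mult[symmetric] A0 B0 ennreal_le_1)
    have "(\<integral>\<^sup>+x. a x \<partial>\<mu>) * (\<integral>\<^sup>+x. b x \<partial>\<mu>) \<le> (SUP j. ennreal (A j)) * (SUP k. ennreal (B k))"
      unfolding A_def B_def
      by (intro mult_mono le am bm a' b') (auto simp: ar br a' b' intro!: ennreal_leI)
    also have "\<dots> = (SUP k. SUP j. ennreal (A j) * ennreal (B k))"
      by (simp add: SUP_mult_left_ennreal SUP_mult_right_ennreal)
    also have "\<dots> \<le> 1" by (intro SUP_least AB)
    finally show ?thesis .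
  qed
qed

section \<open>Product measures\<close>

text \<open>
  The two-function form tensorizes as the Prekopa-Leindler inequality does: for a fixed last
  coordinate of each argument, the induction hypothesis bounds the product of the two partial integrals,
  and these partial integrals satisfy the one-dimensional hypothesis. No supremum or infimum over an
  uncountable set has to be measured.
\<close>

lemma two_function_ineq_product:
  fixes \<mu> :: "real measure" and k :: "real \<Rightarrow> real \<Rightarrow> real" and a b :: "(nat \<Rightarrow> real) \<Rightarrow> ennreal"
  assumes ps: "prob_space \<mu>" and sets[measurable_cong]: "sets \<mu> = sets borel" and k: "\<And>x y. 0 < k x y"
    and one: "\<And>a b. a \<in> borel_measurable borel \<Longrightarrow> b \<in> borel_measurable borel \<Longrightarrow>
       (\<And>x y. a x * b y \<le> ennreal (k x y)) \<Longrightarrow> (\<integral>\<^sup>+x. a x \<partial>\<mu>) * (\<integral>\<^sup>+x. b x \<partial>\<mu>) \<le> 1"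
    and "a \<in> borel_measurable (PiM {..<n} (\<lambda>_. \<mu>))" "b \<in> borel_measurable (PiM {..<n} (\<lambda>_. \<mu>))"
    and "\<And>x y. x \<in> Rn n \<Longrightarrow> y \<in> Rn n \<Longrightarrow> a x * b y \<le> ennreal (\<Prod>i<n. k (x i) (y i))"
  shows "(\<integral>\<^sup>+x. a x \<partial>PiM {..<n} (\<lambda>_. \<mu>)) * (\<integral>\<^sup>+x. b x \<partial>PiM {..<n} (\<lambda>_. \<mu>)) \<le> 1"
  using assms(5-7)
proof (induction n arbitrary: a b)
  case 0
  interpret prob_space \<mu> by fact
  interpret P: product_sigma_finite "\<lambda>_::nat. \<mu>" by standard
  have "a (\<lambda>_. undefined) * b (\<lambda>_. undefined) \<le> 1"
    using 0(3)[of "\<lambda>_. undefined" "\<lambda>_. undefined"] by simp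
  then show ?case by (simp add: P.nn_integral_empty)
next
  case (Suc n)
  interpret prob_space \<mu> by fact
  interpret P: product_sigma_finite "\<lambda>_::nat. \<mu>" by standard
  let ?P = "PiM {..<n} (\<lambda>_. \<mu>)"
  have spaceP: "space ?P = Rn n" using sets_eq_imp_space_eq[OF sets] by (simp add: space_PiM)
  have ins: "{..<Suc n} = insert n {..<n}" by (rule lessThan_Suc)
  interpret F: finite_product_sigma_finite "\<lambda>_::nat. \<mu>" "{..<n}" by standard auto
  note [measurable] = Suc.prems(1,2)[unfolded ins]
  have split: "(\<integral>\<^sup>+x. c x \<partial>PiM {..<Suc n} (\<lambda>_. \<mu>)) = (\<integral>\<^sup>+y. (\<integral>\<^sup>+x. c (x(n := y)) \<partial>?P) \<partial>\<mu>)"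
    if "c \<in> borel_measurable (PiM {..<Suc n} (\<lambda>_. \<mu>))" for c
    using that unfolding ins by (subst P.product_nn_integral_insert_rev) auto
  define ma where "ma u = (\<integral>\<^sup>+x. a (x(n := u)) \<partial>?P)" for u
  define mb where "mb u = (\<integral>\<^sup>+x. b (x(n := u)) \<partial>?P)" for u
  have atm: "ma \<in> borel_measurable borel" and btm: "mb \<in> borel_measurable borel"
    unfolding ma_def mb_def measurable_cong_sets[OF sets[symmetric] refl] by measurable
  have upd: "(\<lambda>x. x(n := u)) \<in> ?P \<rightarrow>\<^sub>M PiM {..<Suc n} (\<lambda>_. \<mu>)" for u
    by (rule measurable_fun_upd[where J = "{..<n}"])
       (auto simp: ins measurable_ident_sets sets_eq_imp_space_eq[OF sets])
  have am: "(\<lambda>x. a (x(n := u))) \<in> borel_measurable ?P" and bm: "(\<lambda>x. b (x(n := u))) \<in> borel_measurable ?P" for u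
    by (rule measurable_compose[OF upd Suc.prems(1)] measurable_compose[OF upd Suc.prems(2)])+
  have "ma u * mb v \<le> ennreal (k u v)" for u v
  proof -
    let ?c = "ennreal (1 / k u v)"
    have "(\<integral>\<^sup>+x. ?c * a (x(n := u)) \<partial>?P) * (\<integral>\<^sup>+x. b (x(n := v)) \<partial>?P) \<le> 1"
    proof (rule Suc.IH)
      fix x y assume xy: "x \<in> Rn n" "y \<in> Rn n"
      have "a (x(n := u)) * b (y(n := v)) \<le> ennreal (\<Prod>i<Suc n. k ((x(n := u)) i) ((y(n := v)) i))"
        by (rule Suc.prems(3)) (use xy in \<open>auto simp: PiE_def extensional_def\<close>)
      also have "(\<Prod>i<Suc n. k ((x(n := u)) i) ((y(n := v)) i)) = (\<Prod>i<n. k (x i) (y i)) * k u v"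
        by simp
      finally have "a (x(n := u)) * b (y(n := v)) \<le> ennreal ((\<Prod>i<n. k (x i) (y i)) * k u v)" .
      then have "?c * (a (x(n := u)) * b (y(n := v))) \<le> ?c * ennreal ((\<Prod>i<n. k (x i) (y i)) * k u v)"
        by (intro mult_left_mono) auto
      also have "\<dots> = ennreal (\<Prod>i<n. k (x i) (y i))"
        using less_imp_neq[OF k[of u v]] by (simp add: ennreal_mult'[symmetric] prod_nonneg less_imp_le k)
      finally show "?c * a (x(n := u)) * b (y(n := v)) \<le> ennreal (\<Prod>i<n. k (x i) (y i))"
        by (simp add: mult.assoc)
    qed (use am bm in measurable)
    also have "(\<integral>\<^sup>+x. ?c * a (x(n := u)) \<partial>?P) = ?c * ma u" unfolding ma_def
      by (rule nn_integral_cmult[OF am])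
    finally have "?c * ma u * mb v \<le> 1" unfolding mb_def .
    then have "ennreal (k u v) * (?c * ma u * mb v) \<le> ennreal (k u v) * 1" by (intro mult_left_mono) auto
    moreover have "ennreal (k u v) * (?c * ma u * mb v) = (ennreal (k u v) * ?c) * (ma u * mb v)"
      by (simp only: mult.assoc)
    moreover have "ennreal (k u v) * ?c = 1" using k[of u v] by (simp add: ennreal_mult'[symmetric] less_imp_le)
    ultimately show ?thesis by simp
  qed
  then have "(\<integral>\<^sup>+x. ma x \<partial>\<mu>) * (\<integral>\<^sup>+x. mb x \<partial>\<mu>) \<le> 1" by (rule one[OF atm btm])
  then show ?case unfolding ma_def mb_def split[OF Suc.prems(1)] split[OF Suc.prems(2)] .
qed

text \<open>
  Concentration in the form that is used: two sets at cost distance at least \<open>s\<close> cannot both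
  have a probability much larger than \<open>exp (- s)\<close>.
\<close>

lemma separated_sets_product:
  fixes \<mu> :: "real measure" and k :: "real \<Rightarrow> real \<Rightarrow> real" and A C :: "(nat \<Rightarrow> real) set"
  assumes ps: "prob_space \<mu>" and sets: "sets \<mu> = sets borel" and k: "\<And>x y. 0 < k x y"
    and one: "\<And>a b. a \<in> borel_measurable borel \<Longrightarrow> b \<in> borel_measurable borel \<Longrightarrow>
       (\<And>x y. a x * b y \<le> ennreal (k x y)) \<Longrightarrow> (\<integral>\<^sup>+x. a x \<partial>\<mu>) * (\<integral>\<^sup>+x. b x \<partial>\<mu>) \<le> 1"
    and A: "A \<in> sets (PiM {..<n} (\<lambda>_. \<mu>))" and C: "C \<in> sets (PiM {..<n} (\<lambda>_. \<mu>))"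
    and sep: "\<And>x y. x \<in> C \<Longrightarrow> y \<in> A \<Longrightarrow> exp s \<le> (\<Prod>i<n. k (x i) (y i))"
  shows "measure (PiM {..<n} (\<lambda>_. \<mu>)) C * measure (PiM {..<n} (\<lambda>_. \<mu>)) A \<le> exp (- s)"
proof -
  let ?P = "PiM {..<n} (\<lambda>_. \<mu>)"
  interpret prob_space \<mu> by fact
  interpret PP: product_prob_space "\<lambda>_::nat. \<mu>" "{..<n}" by standard
  note [measurable] = A C
  have "(\<integral>\<^sup>+x. ennreal (exp s) * indicator C x \<partial>?P) * (\<integral>\<^sup>+x. indicator A x \<partial>?P) \<le> 1"
  proof (rule two_function_ineq_product[OF ps sets k one])
    fix x y
    show "ennreal (exp s) * indicator C x * indicator A y \<le> ennreal (\<Prod>i<n. k (x i) (y i))"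
      using sep[of x y] by (auto simp: indicator_def intro!: ennreal_leI)
  qed auto
  then have "ennreal (exp s) * emeasure ?P C * emeasure ?P A \<le> 1"
    by (simp add: nn_integral_cmult_indicator)
  then have "ennreal (exp s * measure ?P C * measure ?P A) \<le> 1"
    by (simp add: PP.P.emeasure_eq_measure ennreal_mult)
  then have "exp s * (measure ?P C * measure ?P A) \<le> 1" by (simp add: ennreal_le_1 mult.assoc)
  then show ?thesis by (simp add: exp_minus field_simps)
qed

section \<open>The one-dimensional law and its survival potential\<close>

lemma powr_subadditive:
  fixes a b :: real
  assumes "0 \<le> a" "0 \<le> b" "0 < \<alpha>" "\<alpha> \<le> 1"
  shows "(a + b) powr \<alpha> \<le> a powr \<alpha> + b powr \<alpha>"
proof (cases "a + b = 0")
  case True then show ?thesis using assms by simp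
next
  case False
  then have s: "a + b > 0" using assms by auto
  have *: "t \<le> t powr \<alpha>" if "0 \<le> t" "t \<le> 1" for t :: real
    using powr_mono'[of \<alpha> 1 t] that assms by simp
  have "1 = a / (a + b) + b / (a + b)" using s by (simp add: add_divide_distrib[symmetric])
  also have "\<dots> \<le> (a / (a + b)) powr \<alpha> + (b / (a + b)) powr \<alpha>"
    using assms s by (intro add_mono *) (auto simp: field_simps)
  also have "\<dots> = (a powr \<alpha> + b powr \<alpha>) / (a + b) powr \<alpha>"
    using assms s by (simp add: powr_divide add_divide_distrib)
  finally show ?thesis using s by (simp add: field_simps)
qed

text \<open>
  The integrand decays faster than \<open>(1 + x)\<^sup>-\<^sup>2\<close>.
\<close>

lemma nn_integral_exp_powr_finite:
  fixes c \<alpha> :: real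
  assumes "0 < c" "0 < \<alpha>"
  shows "(\<integral>\<^sup>+x. ennreal (indicator {0..} x * exp (- (c * x powr \<alpha>))) \<partial>lborel) < \<infinity>"
proof -
  have "((\<lambda>x::real. exp (- (c * x powr \<alpha>)) * (1 + x)^2) \<longlongrightarrow> 0) at_top"
    using assms by real_asymp
  then have "eventually (\<lambda>x::real. exp (- (c * x powr \<alpha>)) * (1 + x)^2 < 1) at_top"
    by (rule order_tendstoD(2)) simp
  then obtain X0 where X0: "\<And>x. x \<ge> X0 \<Longrightarrow> exp (- (c * x powr \<alpha>)) * (1 + x)^2 < 1"
    unfolding eventually_at_top_linorder by blast
  have ft: "(\<integral>\<^sup>+x. ennreal (1 / (1 + x)^2) * indicator {0..} x \<partial>lborel) = ennreal (0 - (- (1 / (1 + 0))))"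
  proof (rule nn_integral_FTC_atLeast)
    show "((\<lambda>x. - (1 / (1 + x))) has_real_derivative 1 / (1 + x)^2) (at x)" if "0 \<le> x" for x :: real
      using that by (auto intro!: derivative_eq_intros simp: power2_eq_square)
    show "((\<lambda>x::real. - (1 / (1 + x))) \<longlongrightarrow> 0) at_top" by real_asymp
  qed (auto)
  have "(\<integral>\<^sup>+x. ennreal (indicator {0..} x * exp (- (c * x powr \<alpha>))) \<partial>lborel)
     \<le> (\<integral>\<^sup>+x. indicator {0..max 0 X0} x + ennreal (1 / (1 + x)^2) * indicator {0..} x \<partial>lborel)"
  proof (intro nn_integral_mono)
    fix x :: real
    show "ennreal (indicator {0..} x * exp (- (c * x powr \<alpha>)))
       \<le> indicator {0..max 0 X0} x + ennreal (1 / (1 + x)^2) * indicator {0..} x"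
    proof (cases "0 \<le> x")
      case x: True
      show ?thesis
      proof (cases "x \<le> X0")
        case True
        have "ennreal (exp (- (c * x powr \<alpha>))) \<le> 1" using assms by (simp add: ennreal_le_1)
        then show ?thesis using x True by (auto intro: add_increasing2)
      next
        case False
        then have "exp (- (c * x powr \<alpha>)) \<le> 1 / (1 + x)^2" using X0[of x] x by (simp add: field_simps)
        then have "ennreal (exp (- (c * x powr \<alpha>))) \<le> ennreal (1 / (1 + x)^2)" by (rule ennreal_leI)
        then show ?thesis using x by (auto intro: add_increasing)
      qed
    qed auto
  qed
  also have "\<dots> = emeasure lborel {0..max 0 X0} + (\<integral>\<^sup>+x. ennreal (1 / (1 + x)^2) * indicator {0..} x \<partial>lborel)"
    by (subst nn_integral_add) auto
  also have "\<dots> < \<infinity>" unfolding ft by simp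
  finally show ?thesis .
qed

abbreviation mu_mass :: "real \<Rightarrow> real" where
  "mu_mass \<alpha> \<equiv> LINT y:{0..}|lborel. exp (- (y powr \<alpha>))"

definition mu_dens :: "real \<Rightarrow> real \<Rightarrow> real" where
  "mu_dens \<alpha> x = exp (- (x powr \<alpha>)) / mu_mass \<alpha>"

text \<open>
  Every coordinate of the law is standard exponential in the variable \<open>mu_pot \<alpha>\<close>. The
  integral vanishes for negative \<open>x\<close>, so the potential is extended by \<open>0\<close>.
\<close>

definition mu_pot :: "real \<Rightarrow> real \<Rightarrow> real" where
  "mu_pot \<alpha> x = - ln (1 - integral {0..x} (mu_dens \<alpha>))"

context
  fixes \<alpha> :: real
  assumes alpha: "0 < \<alpha>" "\<alpha> \<le> 1"
begin

lemma exp_powr_continuous: "continuous_on {0..} (\<lambda>x. exp (- (c * x powr \<alpha>)))"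
  using alpha by (intro continuous_intros continuous_on_powr') auto

lemma mu_mass_nn: "(\<integral>\<^sup>+x. ennreal (indicator {0..} x * exp (- (x powr \<alpha>))) \<partial>lborel) = ennreal (mu_mass \<alpha>)"
  and mu_mass_pos: "0 < mu_mass \<alpha>"
proof -
  have m: "(\<lambda>x. indicator {0..} x * exp (- (x powr \<alpha>))) \<in> borel_measurable borel"
    using borel_measurable_continuous_on_indicator[OF _ exp_powr_continuous[of 1]] by simp
  have fin: "(\<integral>\<^sup>+x. ennreal (indicator {0..} x * exp (- (x powr \<alpha>))) \<partial>lborel) < \<infinity>"
    using nn_integral_exp_powr_finite[of 1 \<alpha>] alpha by simp
  have int: "integrable lborel (\<lambda>x. indicator {0..} x * exp (- (x powr \<alpha>)))"
  proof (rule integrableI_bounded)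
    show "(\<integral>\<^sup>+ x. ennreal (norm (indicator {0..} x * exp (- (x powr \<alpha>)))) \<partial>lborel) < \<infinity>"
      using fin by (simp add: abs_mult)
  qed (use m in simp)
  show eq: "(\<integral>\<^sup>+x. ennreal (indicator {0..} x * exp (- (x powr \<alpha>))) \<partial>lborel) = ennreal (mu_mass \<alpha>)"
    using nn_integral_eq_integral[OF int] by (simp add: set_lebesgue_integral_def)
  have "0 < (\<integral>\<^sup>+x. ennreal (exp (- 1)) * indicator {0..1::real} x \<partial>lborel)"
    by (simp add: nn_integral_cmult_indicator)
  also have "\<dots> \<le> (\<integral>\<^sup>+x. ennreal (indicator {0..} x * exp (- (x powr \<alpha>))) \<partial>lborel)"
    using alpha by (intro nn_integral_mono) (auto simp: indicator_def powr_le1 intro!: ennreal_leI)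
  finally show "0 < mu_mass \<alpha>" unfolding eq by simp
qed

lemma mu_dens_continuous: "continuous_on {0..} (mu_dens \<alpha>)"
  unfolding mu_dens_def[abs_def]
  by (rule continuous_on_divide[OF exp_powr_continuous[of 1, simplified] continuous_on_const])
     (use mu_mass_pos in simp)

lemma mu_dens_pos: "0 < mu_dens \<alpha> x"
  using mu_mass_pos by (simp add: mu_dens_def)

lemma mu_dens_total: "(\<integral>\<^sup>+x. ennreal (indicator {0..} x * mu_dens \<alpha> x) \<partial>lborel) = 1"
proof -
  have m: "(\<lambda>x. indicator {0..} x * exp (- (x powr \<alpha>))) \<in> borel_measurable borel"
    using borel_measurable_continuous_on_indicator[OF _ exp_powr_continuous[of 1]] by simp
  have "(\<integral>\<^sup>+x. ennreal (indicator {0..} x * mu_dens \<alpha> x) \<partial>lborel)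
     = (\<integral>\<^sup>+x. ennreal (1 / mu_mass \<alpha>) * ennreal (indicator {0..} x * exp (- (x powr \<alpha>))) \<partial>lborel)"
    using mu_mass_pos by (intro nn_integral_cong) (auto simp: mu_dens_def indicator_def ennreal_mult'[symmetric])
  also have "\<dots> = ennreal (1 / mu_mass \<alpha>) * ennreal (mu_mass \<alpha>)"
    using m by (subst nn_integral_cmult) (auto simp: mu_mass_nn)
  also have "\<dots> = 1" using mu_mass_pos by (simp add: ennreal_mult'[symmetric])
  finally show ?thesis .
qed

lemma mu_eq_density: "mu \<alpha> = density lborel (\<lambda>x. ennreal (indicator {0..} x * mu_dens \<alpha> x))"
  by (simp add: mu_def mu_dens_def)

lemma sets_mu: "sets (mu \<alpha>) = sets borel" by (simp add: mu_def)

lemma mu_dens_measurable: "(\<lambda>x. indicator {0..} x * mu_dens \<alpha> x) \<in> borel_measurable borel"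
  using borel_measurable_continuous_on_indicator[OF _ mu_dens_continuous] by simp

lemma prob_space_mu: "prob_space (mu \<alpha>)"
  by (rule prob_spaceI)
     (use mu_dens_measurable in \<open>simp add: mu_eq_density emeasure_density mu_dens_total\<close>)

lemma mu_pot_eq_ln: "mu_pot \<alpha> x = - ln (1 - integral {0..x} (mu_dens \<alpha>))"
  by (simp add: mu_pot_def)

lemma mu_dens_integral_lt_1: "0 \<le> x \<Longrightarrow> integral {0..x} (mu_dens \<alpha>) < 1"
  by (rule integral_less_one[OF mu_dens_continuous mu_dens_pos mu_dens_total])

lemma emeasure_mu_tail:
  assumes "0 \<le> x"
  shows "emeasure (mu \<alpha>) {x<..} = ennreal (exp (- mu_pot \<alpha> x))"
proof -
  interpret prob_space "mu \<alpha>" by (rule prob_space_mu)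
  have "emeasure (mu \<alpha>) {..x} = (\<integral>\<^sup>+t. ennreal (indicator {0..x} t * mu_dens \<alpha> t) \<partial>lborel)"
    unfolding mu_eq_density using mu_dens_measurable
    by (subst emeasure_density) (auto intro!: nn_integral_cong simp: indicator_def)
  also have "\<dots> = ennreal (integral {0..x} (mu_dens \<alpha>))"
    by (intro nn_integral_indicator_Icc continuous_on_subset[OF mu_dens_continuous])
       (auto intro: less_imp_le mu_dens_pos)
  finally have "measure (mu \<alpha>) {..x} = integral {0..x} (mu_dens \<alpha>)"
    by (intro measure_eq_emeasure_eq_ennreal Henstock_Kurzweil_Integration.integral_nonneg
          integrable_continuous_real continuous_on_subset[OF mu_dens_continuous])
       (auto intro: less_imp_le mu_dens_pos)
  moreover have "measure (mu \<alpha>) {x<..} = 1 - measure (mu \<alpha>) {..x}"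
    using prob_compl[of "{..x}"] sets_eq_imp_space_eq[OF sets_mu] sets_mu by (simp add: Compl_eq_Diff_UNIV[symmetric] Compl_atMost)
  ultimately show ?thesis
    using mu_dens_integral_lt_1[OF assms] by (simp add: emeasure_eq_measure mu_pot_def)
qed

text \<open>
  Subadditivity of \<open>x \<mapsto> x\<^sup>\<alpha>\<close>: a translation by \<open>h \<ge> 0\<close> lowers the density by a factor of at
  least \<open>exp (- h\<^sup>\<alpha>)\<close>. It gives the lower bound of the large deviation principle, and here also the upper
  bound of the potential.
\<close>

lemma mu_shift:
  assumes [measurable]: "\<phi> \<in> borel_measurable borel" and h: "0 \<le> h"
  shows "ennreal (exp (- (h powr \<alpha>))) * (\<integral>\<^sup>+y. \<phi> (y + h) \<partial>mu \<alpha>) \<le> (\<integral>\<^sup>+x. \<phi> x \<partial>mu \<alpha>)"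
proof -
  note [measurable] = mu_dens_measurable
  have eq: "(\<integral>\<^sup>+x. c x \<partial>mu \<alpha>) = (\<integral>\<^sup>+x. ennreal (indicator {0..} x * mu_dens \<alpha> x) * c x \<partial>lborel)"
    if [measurable]: "c \<in> borel_measurable borel" for c
    unfolding mu_eq_density by (subst nn_integral_density) auto
  have "ennreal (exp (- (h powr \<alpha>))) * (\<integral>\<^sup>+y. \<phi> (y + h) \<partial>mu \<alpha>)
     = (\<integral>\<^sup>+y. ennreal (exp (- (h powr \<alpha>))) * (ennreal (indicator {0..} y * mu_dens \<alpha> y) * \<phi> (y + h)) \<partial>lborel)"
    by (subst eq, simp, subst nn_integral_cmult, auto)
  also have "\<dots> \<le> (\<integral>\<^sup>+y. ennreal (indicator {0..} (h + 1 * y) * mu_dens \<alpha> (h + 1 * y)) * \<phi> (h + 1 * y) \<partial>lborel)"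
  proof (intro nn_integral_mono)
    fix y :: real
    show "ennreal (exp (- (h powr \<alpha>))) * (ennreal (indicator {0..} y * mu_dens \<alpha> y) * \<phi> (y + h))
      \<le> ennreal (indicator {0..} (h + 1 * y) * mu_dens \<alpha> (h + 1 * y)) * \<phi> (h + 1 * y)"
    proof (cases "0 \<le> y")
      case True
      have "exp (- (h powr \<alpha>)) * exp (- (y powr \<alpha>)) \<le> exp (- ((h + y) powr \<alpha>))"
        using powr_subadditive[OF h True alpha] by (simp add: exp_add[symmetric])
      then have "exp (- (h powr \<alpha>)) * mu_dens \<alpha> y \<le> mu_dens \<alpha> (h + y)"
        using mu_mass_pos by (simp add: mu_dens_def divide_right_mono)
      then have "ennreal (exp (- (h powr \<alpha>))) * ennreal (mu_dens \<alpha> y) * \<phi> (y + h) \<le> ennreal (mu_dens \<alpha> (h + y)) * \<phi> (h + y)"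
        by (simp add: ennreal_mult'[symmetric] add.commute mult_right_mono ennreal_leI)
      then show ?thesis using True h by (simp add: mult.assoc)
    qed auto
  qed
  also have "\<dots> = (\<integral>\<^sup>+x. \<phi> x \<partial>mu \<alpha>)"
    by (subst eq, simp, subst nn_integral_real_affine[where c=1 and t=h], auto)
  finally show ?thesis .
qed

lemma mu_pot_le: 
  assumes "0 \<le> x" shows "mu_pot \<alpha> x \<le> x powr \<alpha>"
proof -
  have "mu_pot \<alpha> 0 = 0" by (simp add: mu_pot_def)
  then have e: "emeasure (mu \<alpha>) {0<..} = 1" using emeasure_mu_tail[of 0] by simp
  have "ennreal (exp (- (x powr \<alpha>))) * (\<integral>\<^sup>+y. indicator {x<..} (y + x) \<partial>mu \<alpha>) \<le> (\<integral>\<^sup>+y. indicator {x<..} y \<partial>mu \<alpha>)"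
    by (rule mu_shift) (use assms in auto)
  also have "(\<integral>\<^sup>+y. indicator {x<..} (y + x) \<partial>mu \<alpha>) = (\<integral>\<^sup>+y. indicator {0<..} y \<partial>mu \<alpha>)"
    by (intro nn_integral_cong) (auto simp: indicator_def)
  finally have "ennreal (exp (- (x powr \<alpha>))) \<le> ennreal (exp (- mu_pot \<alpha> x))"
    using emeasure_mu_tail[OF assms] e by (simp add: sets_mu)
  then show ?thesis by simp
qed

lemma mu_pot_nonneg:
  assumes "0 \<le> x" shows "0 \<le> mu_pot \<alpha> x"
proof -
  interpret prob_space "mu \<alpha>" by (rule prob_space_mu)
  have "ennreal (exp (- mu_pot \<alpha> x)) \<le> 1" using emeasure_mu_tail[OF assms] emeasure_le_1 by metis
  then show ?thesis by (simp add: ennreal_le_1)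
qed

text \<open>
  Cut the tail integral at \<open>2\<^bsup>1/\<alpha>\<^esup> x\<close>. Before that point the density is at most its value at \<open>x\<close>;
  beyond it, \<open>t\<^sup>\<alpha> \<ge> x\<^sup>\<alpha> + t\<^sup>\<alpha> / 2\<close>. The prefactor has to be polynomial: it enters the constants of the
  quadratic regime, which may grow only polynomially in \<open>ln n\<close>.
\<close>

lemma mu_tail_le:
  obtains C where "1 \<le> C" "\<And>x. 0 \<le> x \<Longrightarrow> exp (- mu_pot \<alpha> x) \<le> C * (1 + x) * exp (- (x powr \<alpha>))"
proof -
  note [measurable] = mu_dens_measurable
  define J where "J = enn2real (\<integral>\<^sup>+x. ennreal (indicator {0..} x * exp (- (x powr \<alpha> / 2))) \<partial>lborel)"
  have J: "(\<integral>\<^sup>+x. ennreal (indicator {0..} x * exp (- (x powr \<alpha> / 2))) \<partial>lborel) = ennreal J" "0 \<le> J"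
    unfolding J_def using nn_integral_exp_powr_finite[of "1/2" \<alpha>] alpha by (simp_all add: less_top)
  \<comment> \<open>The point \<open>q x\<close> at which \<open>t\<^sup>\<alpha>\<close> reaches \<open>2 x\<^sup>\<alpha>\<close>.\<close>
  define q where "q = 2 powr (1 / \<alpha>)"
  have q: "1 \<le> q" unfolding q_def using alpha by (intro ge_one_powr_ge_zero) auto
  let ?Z = "mu_mass \<alpha>"
  have le: "exp (- mu_pot \<alpha> x) \<le> ((q * x + J) / ?Z) * exp (- (x powr \<alpha>))" if x: "0 \<le> x" for x
  proof -
    have m: "(\<lambda>x. indicator {0..} x * exp (- (x powr \<alpha> / 2))) \<in> borel_measurable borel"
      using borel_measurable_continuous_on_indicator[OF _ exp_powr_continuous[of "1/2"]] by simp
    let ?e = "exp (- (x powr \<alpha>)) / ?Z"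
    have "ennreal (exp (- mu_pot \<alpha> x)) = (\<integral>\<^sup>+t. ennreal (indicator {0..} t * mu_dens \<alpha> t) * indicator {x<..} t \<partial>lborel)"
      unfolding emeasure_mu_tail[OF x, symmetric] mu_eq_density by (subst emeasure_density) auto
    also have "\<dots> \<le> (\<integral>\<^sup>+t. ennreal ?e * indicator {x..q * x} t + ennreal ?e * ennreal (indicator {0..} t * exp (- (t powr \<alpha> / 2))) \<partial>lborel)"
    proof (intro nn_integral_mono)
      fix t :: real
      show "ennreal (indicator {0..} t * mu_dens \<alpha> t) * indicator {x<..} t
         \<le> ennreal ?e * indicator {x..q * x} t + ennreal ?e * ennreal (indicator {0..} t * exp (- (t powr \<alpha> / 2)))"
      proof (cases "x < t")
        case True
        show ?thesis
        proof (cases "t \<le> q * x")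
          case t: True
          have "mu_dens \<alpha> t \<le> ?e" using True x alpha mu_mass_pos
            by (auto simp: mu_dens_def intro!: divide_right_mono powr_mono2)
          then have "ennreal (mu_dens \<alpha> t) \<le> ennreal ?e" by (rule ennreal_leI)
          then show ?thesis using True t x by (auto intro: order_trans add_increasing2)
        next
          case False
          have "2 * x powr \<alpha> = (q * x) powr \<alpha>"
            using x alpha by (simp add: q_def powr_mult powr_powr)
          also have "\<dots> \<le> t powr \<alpha>" using False x q alpha by (intro powr_mono2) auto
          finally have "exp (- (t powr \<alpha>)) \<le> exp (- (x powr \<alpha>)) * exp (- (t powr \<alpha> / 2))"
            by (simp add: exp_add[symmetric])
          then have "mu_dens \<alpha> t \<le> ?e * exp (- (t powr \<alpha> / 2))"
            using mu_mass_pos by (simp add: mu_dens_def divide_right_mono)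
          then have "ennreal (mu_dens \<alpha> t) \<le> ennreal ?e * ennreal (exp (- (t powr \<alpha> / 2)))"
            using mu_mass_pos by (simp add: ennreal_mult'[symmetric] ennreal_leI)
          then show ?thesis using True x by (auto intro: order_trans)
        qed
      qed auto
    qed
    also have "\<dots> = ennreal ?e * ennreal (q * x - x) + ennreal ?e * ennreal J"
    proof -
      have "x \<le> q * x" using q x by (simp add: mult_le_cancel_right1)
      then show ?thesis using m 
        by (subst nn_integral_add, simp, simp) (simp add: nn_integral_cmult nn_integral_cmult_indicator J)
    qed
    also have "\<dots> \<le> ennreal (?e * (q * x) + ?e * J)"
      using mu_mass_pos J(2) x q by (simp add: ennreal_mult'[symmetric] ennreal_plus[symmetric] mult_le_cancel_right1 del: ennreal_plus)
         (auto intro!: ennreal_leI mult_left_mono divide_right_mono)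
    finally have "exp (- mu_pot \<alpha> x) \<le> ?e * (q * x) + ?e * J"
      using mu_mass_pos J(2) x q by (subst (asm) ennreal_le_iff) auto
    then show ?thesis by (simp add: add_divide_distrib distrib_left distrib_right mult.commute)
  qed
  define C where "C = max 1 ((q + J) / ?Z)"
  show ?thesis
  proof (rule that[of C])
    show "1 \<le> C" by (simp add: C_def)
    fix x :: real assume x: "0 \<le> x"
    have "(q * x + J) \<le> (q + J) * (1 + x)" using q J x by (simp add: algebra_simps)
    then have "(q * x + J) / ?Z \<le> ((q + J) / ?Z) * (1 + x)" using mu_mass_pos by (simp add: divide_right_mono)
    also have "\<dots> \<le> C * (1 + x)" using x by (intro mult_right_mono) (auto simp: C_def)
    finally have "((q * x + J) / ?Z) * exp (- (x powr \<alpha>)) \<le> C * (1 + x) * exp (- (x powr \<alpha>))"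
      by (intro mult_right_mono) auto
    with le[OF x] show "exp (- mu_pot \<alpha> x) \<le> C * (1 + x) * exp (- (x powr \<alpha>))" by linarith
  qed
qed

text \<open>
  Besides the tail estimate, its two consequences: the potential equals \<open>x\<^sup>\<alpha>\<close> up to a
  logarithm, and its derivative, the hazard rate of the law, is at least of order \<open>1 / (1 + x)\<close>.
\<close>

lemma mu_pot_bounds:
  obtains C where "1 \<le> C" 
    "\<And>x. 0 \<le> x \<Longrightarrow> exp (- mu_pot \<alpha> x) \<le> C * (1 + x) * exp (- (x powr \<alpha>))"
    "\<And>x. 0 \<le> x \<Longrightarrow> x powr \<alpha> - ln (C * (1 + x)) \<le> mu_pot \<alpha> x"
    "\<And>x y. 0 \<le> y \<Longrightarrow> y \<le> x \<Longrightarrow> x - y \<le> C * (1 + x) * (mu_pot \<alpha> x - mu_pot \<alpha> y)"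
proof -
  obtain C0 where C0: "1 \<le> C0" "\<And>x. 0 \<le> x \<Longrightarrow> exp (- mu_pot \<alpha> x) \<le> C0 * (1 + x) * exp (- (x powr \<alpha>))"
    using mu_tail_le by blast
  let ?Z = "mu_mass \<alpha>"
  define C where "C = C0 * max 1 ?Z"
  have C: "1 \<le> C" "C0 \<le> C" "C0 * ?Z \<le> C"
    using C0(1) mu_mass_pos mult_mono[of 1 C0 1 "max 1 ?Z"] mult_left_mono[of 1 "max 1 ?Z" C0] mult_left_mono[of ?Z "max 1 ?Z" C0]
    by (auto simp: C_def)
  have e: "exp (- mu_pot \<alpha> x) \<le> C * (1 + x) * exp (- (x powr \<alpha>))" if "0 \<le> x" for x
  proof -
    have "C0 * ((1 + x) * exp (- (x powr \<alpha>))) \<le> C * ((1 + x) * exp (- (x powr \<alpha>)))"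
      using C that by (intro mult_right_mono) auto
    then show ?thesis using C0(2)[OF that] by (simp add: mult.assoc)
  qed
  show ?thesis
  proof (rule that[OF C(1) e])
    fix x :: real assume x: "0 \<le> x"
    have "ln (exp (- mu_pot \<alpha> x)) \<le> ln (C * (1 + x) * exp (- (x powr \<alpha>)))"
      using e[OF x] by (intro ln_mono) auto
    also have "\<dots> = ln (C * (1 + x)) - x powr \<alpha>" using C(1) x
      by (subst ln_mult) auto
    finally show "x powr \<alpha> - ln (C * (1 + x)) \<le> mu_pot \<alpha> x" by simp
  next
    fix x y :: real assume y: "0 \<le> y" "y \<le> x"
    show "x - y \<le> C * (1 + x) * (mu_pot \<alpha> x - mu_pot \<alpha> y)"
    proof (cases "y = x")
      case False
      then have yx: "y < x" using y by simp
      have "continuous_on {y..x} (mu_pot \<alpha>)"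
        by (rule continuous_on_subset[OF survival_potential_continuous[OF mu_dens_continuous mu_dens_integral_lt_1 mu_pot_eq_ln, of x]])
           (use y in auto)
      moreover have der: "(mu_pot \<alpha> has_real_derivative mu_dens \<alpha> z * exp (mu_pot \<alpha> z)) (at z)" if "y < z" for z
        by (rule survival_potential_deriv[OF mu_dens_continuous mu_dens_integral_lt_1 mu_pot_eq_ln]) (use y that in auto)
      ultimately obtain l z where z: "y < z" "z < x" "(mu_pot \<alpha> has_real_derivative l) (at z)" "mu_pot \<alpha> x - mu_pot \<alpha> y = (x - y) * l"
        using MVT[of y x "mu_pot \<alpha>"] yx real_differentiable_def by blast
      have l: "l = mu_dens \<alpha> z * exp (mu_pot \<alpha> z)" using DERIV_unique[OF z(3) der[OF z(1)]] .
      have "1 \<le> C * (1 + x) * l"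
      proof -
        have "exp (- mu_pot \<alpha> z) \<le> C0 * (1 + z) * exp (- (z powr \<alpha>))" using C0(2)[of z] z y by simp
        then have "exp (mu_pot \<alpha> z) * exp (- mu_pot \<alpha> z) \<le> exp (mu_pot \<alpha> z) * (C0 * (1 + z) * exp (- (z powr \<alpha>)))"
          by (intro mult_left_mono) auto
        then have "1 \<le> exp (mu_pot \<alpha> z) * (C0 * (1 + z) * exp (- (z powr \<alpha>)))" by (simp add: exp_add[symmetric])
        also have "\<dots> = (C0 * ?Z) * (1 + z) * l" unfolding l mu_dens_def using mu_mass_pos by simp
        also have "\<dots> \<le> C * (1 + x) * l"
          using C z y C0(1) mu_mass_pos mu_dens_pos[of z] by (intro mult_right_mono mult_mono) (auto simp: l intro: less_imp_le)
        finally show ?thesis .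
      qed
      then have "(x - y) * 1 \<le> (x - y) * (C * (1 + x) * l)" using yx by (intro mult_left_mono) auto
      then show ?thesis unfolding z(4) by (simp add: mult_ac)
    qed simp
  qed
qed

lemma mu_pot_mono: "0 \<le> y \<Longrightarrow> y \<le> x \<Longrightarrow> mu_pot \<alpha> y \<le> mu_pot \<alpha> x"
proof -
  assume a: "0 \<le> y" "y \<le> x"
  obtain C where C: "1 \<le> C" "x - y \<le> C * (1 + x) * (mu_pot \<alpha> x - mu_pot \<alpha> y)"
    using mu_pot_bounds a by metis
  have "0 < C * (1 + x)" using C a by auto
  moreover have "0 \<le> C * (1 + x) * (mu_pot \<alpha> x - mu_pot \<alpha> y)" using C(2) a by linarith
  ultimately show ?thesis by (simp add: zero_le_mult_iff)
qed

end

lemma mu_pot_1: "0 \<le> x \<Longrightarrow> mu_pot 1 x = x"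
proof -
  assume x: "0 \<le> x"
  have ft: "(\<integral>\<^sup>+x. ennreal (exp (- x)) * indicator {0..} x \<partial>lborel) = ennreal (0 - (- exp (- 0)))"
  proof (rule nn_integral_FTC_atLeast)
    show "((\<lambda>x::real. - exp (- x)) \<longlongrightarrow> 0) at_top" by real_asymp
  qed (auto intro!: derivative_eq_intros)
  have "ennreal (mu_mass 1) = (\<integral>\<^sup>+x. ennreal (indicator {0..} x * exp (- (x powr 1))) \<partial>lborel)"
    by (rule mu_mass_nn[symmetric]) auto
  also have "\<dots> = (\<integral>\<^sup>+x. ennreal (exp (- x)) * indicator {0..} x \<partial>lborel)"
    by (intro nn_integral_cong) (auto simp: indicator_def)
  finally have "ennreal (mu_mass 1) = (\<integral>\<^sup>+x. ennreal (exp (- x)) * indicator {0..} x \<partial>lborel)" .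
  then have Z: "mu_mass 1 = 1" unfolding ft using mu_mass_pos[of 1] by simp
  have "((\<lambda>x. exp (- x)) has_integral (- exp (- x) - (- exp (- 0)))) {0..x}"
    by (rule fundamental_theorem_of_calculus[OF x])
       (auto intro!: derivative_eq_intros simp: has_real_derivative_iff_has_vector_derivative[symmetric])
  then have "(mu_dens 1 has_integral (1 - exp (- x))) {0..x}"
    by (subst has_integral_cong[where g = "\<lambda>x. exp (- x)"]) (unfold mu_dens_def Z, auto)
  then have "integral {0..x} (mu_dens 1) = 1 - exp (- x)" by (rule integral_unique)
  then show ?thesis by (simp add: mu_pot_def)
qed

section \<open>Cost versus displacement of one coordinate\<close>

lemma ln_kern_nonneg:
  assumes "0 < \<theta>" "\<theta> < 1" shows "0 \<le> ln (kern \<theta> d)"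
  using kern_ge_one[OF assms] by simp

lemma ln_kern_ge_linear:
  assumes th: "0 < \<theta>" "\<theta> < 1"
  shows "\<theta> * \<bar>d\<bar> - ln (4 / (1 - \<theta>\<^sup>2)) \<le> ln (kern \<theta> d)"
proof -
  have t: "\<theta>\<^sup>2 < 1" using assms by (simp add: power_less_one_iff abs_square_less_1)
  have "\<theta> * \<bar>d\<bar> - ln (4 / (1 - \<theta>\<^sup>2)) = ln ((1 - \<theta>\<^sup>2) / 4 * exp (\<theta> * \<bar>d\<bar>))"
    using t by (simp add: ln_mult ln_div)
  also have "\<dots> \<le> ln (kern \<theta> d)" using t by (intro ln_mono kern_ge_exp[OF th]) auto
  finally show ?thesis .
qed

lemma square_le_ln_kern:
  assumes th: "0 < \<theta>" "\<theta> < 1" and c: "c = (1 - \<theta>\<^sup>2) * \<theta>\<^sup>2 / 4" and d: "\<bar>d\<bar> \<le> D"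
  shows "d\<^sup>2 \<le> (1 + c * D\<^sup>2) / c * ln (kern \<theta> d)"
proof -
  have t: "\<theta>\<^sup>2 < 1" using assms by (simp add: power_less_one_iff abs_square_less_1)
  then have c0: "0 < c" using th by (simp add: c)
  then have "0 < 1 + c * D\<^sup>2" by (intro add_pos_nonneg) auto
  then show ?thesis using ln_kern_ge_quadratic[OF th d c] c0 by (simp add: field_simps)
qed

text \<open>
  For the exponential law the potential is the identity, so beyond a constant distance the
  cost is at least \<open>(1 - \<epsilon>) \<bar>x - y\<bar>\<close>, and below it the cost is quadratic.
\<close>

lemma coordinate_dichotomy_exponential:
  assumes eps: "0 < \<epsilon>" "\<epsilon> < 1"
  obtains \<theta> D where "0 < \<theta>" "\<theta> < 1" "0 < D"
    "\<And>x y. 0 \<le> x \<Longrightarrow> 0 \<le> y \<Longrightarrow>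
       (1 - \<epsilon>) * \<bar>x - y\<bar> \<le> ln (kern \<theta> (mu_pot 1 x - mu_pot 1 y)) \<or>
       (x - y)\<^sup>2 \<le> D * ln (kern \<theta> (mu_pot 1 x - mu_pot 1 y))"
proof -
  define \<theta> where "\<theta> = 1 - \<epsilon> / 2"
  have th: "0 < \<theta>" "\<theta> < 1" using eps by (auto simp: \<theta>_def)
  define C where "C = ln (4 / (1 - \<theta>\<^sup>2))"
  define D where "D = max 1 (2 * C / \<epsilon>)"
  define c where "c = (1 - \<theta>\<^sup>2) * \<theta>\<^sup>2 / 4"
  have "\<theta>\<^sup>2 < 1" using th by (simp add: power_less_one_iff abs_square_less_1)
  then have c0: "0 < c" using th by (simp add: c_def)
  show ?thesis
  proof (rule that[OF th, of "(1 + c * D\<^sup>2) / c"])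
    show "0 < (1 + c * D\<^sup>2) / c" using c0 by (intro divide_pos_pos add_pos_nonneg) auto
    fix x y :: real assume xy: "0 \<le> x" "0 \<le> y"
    let ?d = "x - y"
    have "(1 - \<epsilon>) * \<bar>?d\<bar> \<le> ln (kern \<theta> ?d) \<or> ?d\<^sup>2 \<le> (1 + c * D\<^sup>2) / c * ln (kern \<theta> ?d)"
    proof (cases "\<bar>?d\<bar> \<le> D")
      case True then show ?thesis using square_le_ln_kern[OF th c_def] by blast
    next
      case False
      then have "2 * C / \<epsilon> \<le> \<bar>?d\<bar>" by (simp add: D_def)
      then have "C \<le> \<epsilon> / 2 * \<bar>?d\<bar>" using eps by (simp add: field_simps)
      moreover have "\<theta> * \<bar>?d\<bar> - C \<le> ln (kern \<theta> ?d)" unfolding C_def by (rule ln_kern_ge_linear[OF th])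
      moreover have "\<theta> * \<bar>?d\<bar> = (1 - \<epsilon>) * \<bar>?d\<bar> + \<epsilon> / 2 * \<bar>?d\<bar>" by (simp add: \<theta>_def algebra_simps)
      ultimately show ?thesis by linarith
    qed
    then show "(1 - \<epsilon>) * \<bar>x - y\<bar> \<le> ln (kern \<theta> (mu_pot 1 x - mu_pot 1 y)) \<or>
       (x - y)\<^sup>2 \<le> (1 + c * D\<^sup>2) / c * ln (kern \<theta> (mu_pot 1 x - mu_pot 1 y))"
      using xy by (simp add: mu_pot_1)
  qed
qed

text \<open>
  Let the initial position satisfy \<open>y\<^sup>\<alpha> \<le> L\<close>. If the final position \<open>x\<close> is so large that
  \<open>x\<^sup>\<alpha>\<close> dominates \<open>L\<close>, then \<open>\<bar>x - y\<bar>\<^sup>\<alpha> \<le> x\<^sup>\<alpha>\<close> and the difference of the potentials is almost \<open>x\<^sup>\<alpha>\<close>.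
  Otherwise both positions lie in an interval whose length is polynomial in \<open>L\<close>, where the potential has a
  derivative bounded below and the cost is quadratic, with constants polynomial in \<open>L\<close>.
\<close>

lemma coordinate_dichotomy:
  assumes alpha: "0 < \<alpha>" "\<alpha> \<le> 1" and eps: "0 < \<epsilon>" "\<epsilon> < 1"
  obtains \<theta> A where "0 < \<theta>" "\<theta> < 1" "0 < A"
    "\<And>L x y. 1 \<le> L \<Longrightarrow> 0 \<le> x \<Longrightarrow> 0 \<le> y \<Longrightarrow> y powr \<alpha> \<le> L \<Longrightarrow>
       (1 - \<epsilon>) * \<bar>x - y\<bar> powr \<alpha> \<le> ln (kern \<theta> (mu_pot \<alpha> x - mu_pot \<alpha> y)) \<or>
       (x - y)\<^sup>2 \<le> A * L powr (2 / \<alpha> + 2) * ln (kern \<theta> (mu_pot \<alpha> x - mu_pot \<alpha> y))"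
proof -
  define \<theta> where "\<theta> = 1 - \<epsilon> / 4"
  have th: "0 < \<theta>" "\<theta> < 1" using eps by (auto simp: \<theta>_def)
  define C\<theta> where "C\<theta> = ln (4 / (1 - \<theta>\<^sup>2))"
  define c where "c = (1 - \<theta>\<^sup>2) * \<theta>\<^sup>2 / 4"
  have t2: "\<theta>\<^sup>2 < 1" using th by (simp add: power_less_one_iff abs_square_less_1)
  then have c0: "0 < c" using th by (simp add: c_def)
  obtain C where C: "1 \<le> C"
    "\<And>x. 0 \<le> x \<Longrightarrow> x powr \<alpha> - ln (C * (1 + x)) \<le> mu_pot \<alpha> x"
    "\<And>x y. 0 \<le> y \<Longrightarrow> y \<le> x \<Longrightarrow> x - y \<le> C * (1 + x) * (mu_pot \<alpha> x - mu_pot \<alpha> y)"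
    using mu_pot_bounds[OF alpha] by metis
  have "((\<lambda>u. (ln (C * (1 + u powr (1 / \<alpha>))) + C\<theta>) / u) \<longlongrightarrow> 0) at_top"
    using C(1) alpha by real_asymp
  then have "eventually (\<lambda>u. (ln (C * (1 + u powr (1 / \<alpha>))) + C\<theta>) / u < \<epsilon> / 4) at_top"
    by (rule order_tendstoD(2)) (use eps in simp)
  then obtain K0 where K0: "\<And>u. u \<ge> K0 \<Longrightarrow> (ln (C * (1 + u powr (1 / \<alpha>))) + C\<theta>) / u < \<epsilon> / 4"
    unfolding eventually_at_top_linorder by blast
  \<comment> \<open>Beyond \<open>K L\<close> the logarithm, the constant of the linear cost bound and \<open>L\<close> are each absorbed by a fraction of \<open>\<epsilon> u\<close>.\<close>
  define K where "K = max 1 (max K0 (4 / \<epsilon>))"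
  have K: "1 \<le> K" "K0 \<le> K" "4 / \<epsilon> \<le> K" by (auto simp: K_def)
  define A where "A = (C * 2 * K powr (1/\<alpha>))\<^sup>2 * (((1 + c) * K\<^sup>2) / c)"
  show ?thesis
  proof (rule that[OF th, of A])
    show "0 < A" unfolding A_def using C K c0 by (intro mult_pos_pos divide_pos_pos) auto
    fix L x y :: real
    assume L: "1 \<le> L" and x: "0 \<le> x" and y: "0 \<le> y" "y powr \<alpha> \<le> L"
    define d where "d = mu_pot \<alpha> x - mu_pot \<alpha> y"
    define u where "u = x powr \<alpha>"
    have lk: "0 \<le> ln (kern \<theta> d)" by (rule ln_kern_nonneg[OF th])
    have xu: "x = u powr (1/\<alpha>)" using x alpha by (simp add: u_def powr_powr)
    have KL: "K \<le> K * L" "L \<le> K * L" "1 \<le> K * L" 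
      using K L mult_left_mono[of 1 L K] mult_right_mono[of 1 K L] mult_mono[of 1 K 1 L] by auto
    show "(1 - \<epsilon>) * \<bar>x - y\<bar> powr \<alpha> \<le> ln (kern \<theta> (mu_pot \<alpha> x - mu_pot \<alpha> y)) \<or>
       (x - y)\<^sup>2 \<le> A * L powr (2 / \<alpha> + 2) * ln (kern \<theta> (mu_pot \<alpha> x - mu_pot \<alpha> y))"
    proof (cases "K * L \<le> u")
      case True
      have u: "u \<ge> K" "u > 0" using True KL(1) K(1) by linarith+
      have Lu: "L \<le> \<epsilon> / 4 * u"
      proof -
        have "4 / \<epsilon> * L \<le> K * L" using K L by (intro mult_right_mono) auto
        then have "4 / \<epsilon> * L \<le> u" using True by simp
        then show ?thesis using eps by (simp add: field_simps)
      qed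
      define l where "l = ln (C * (1 + x))"
      have l0: "0 \<le> l" unfolding l_def using C(1) x mult_mono[of 1 C 1 "1 + x"] by simp
      have lu: "l + C\<theta> \<le> \<epsilon> / 4 * u"
        using K0[of u] u K unfolding l_def xu by (simp add: field_simps)
      have "u - l \<le> mu_pot \<alpha> x" using C(2)[OF x] by (simp add: u_def l_def)
      moreover have "mu_pot \<alpha> y \<le> L" using mu_pot_le[OF alpha y(1)] y(2) by simp
      ultimately have "u - l - \<epsilon> / 4 * u \<le> d" using Lu by (simp add: d_def)
      then have "u - l - \<epsilon> / 4 * u \<le> \<bar>d\<bar>" by linarith
      then have "\<theta> * (u - l - \<epsilon> / 4 * u) \<le> \<theta> * \<bar>d\<bar>" using th by (intro mult_left_mono) auto
      moreover have "\<theta> * l \<le> l" using th l0 by (simp add: mult_left_le_one_le)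
      moreover have "\<theta> * (u - l - \<epsilon> / 4 * u) = (1 - \<epsilon> / 2) * u + (\<epsilon>/4)\<^sup>2 * u - \<theta> * l"
        by (simp add: \<theta>_def power2_eq_square field_simps)
      moreover have "0 \<le> (\<epsilon>/4)\<^sup>2 * u" using u by simp
      moreover have "\<theta> * \<bar>d\<bar> - C\<theta> \<le> ln (kern \<theta> d)" unfolding C\<theta>_def by (rule ln_kern_ge_linear[OF th])
      ultimately have "(1 - \<epsilon> / 2) * u - \<epsilon> / 4 * u \<le> ln (kern \<theta> d)" using lu by linarith
      moreover have "(1 - \<epsilon> / 2) * u - \<epsilon> / 4 * u = (1 - \<epsilon>) * u + \<epsilon> / 4 * u" by (simp add: algebra_simps)
      moreover have "0 \<le> \<epsilon> / 4 * u" using eps u by simp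
      ultimately have A: "(1 - \<epsilon>) * u \<le> ln (kern \<theta> d)" by linarith
      have "y powr \<alpha> \<le> x powr \<alpha>" using y(2) True KL(2) unfolding u_def by linarith
      then have "y \<le> x" using x y alpha by (metis linorder_not_le powr_less_mono2)
      then have "\<bar>x - y\<bar> powr \<alpha> \<le> u" unfolding u_def using y alpha by (intro powr_mono2) auto
      then have "(1 - \<epsilon>) * \<bar>x - y\<bar> powr \<alpha> \<le> (1 - \<epsilon>) * u" using eps by (intro mult_left_mono) auto
      then show ?thesis using A by (simp add: d_def)
    next
      case False
      define R where "R = (K * L) powr (1/\<alpha>)"
      have R1: "1 \<le> R" unfolding R_def using KL alpha by (intro ge_one_powr_ge_zero) auto
      have le_R: "z \<le> R" if "0 \<le> z" "z powr \<alpha> \<le> K * L" for z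
      proof -
        have "(z powr \<alpha>) powr (1/\<alpha>) \<le> R" unfolding R_def using that alpha by (intro powr_mono2) auto
        then show ?thesis using that alpha by (simp add: powr_powr)
      qed
      have xK: "x powr \<alpha> \<le> K * L" and yK: "y powr \<alpha> \<le> K * L" using False y(2) KL(2) unfolding u_def by linarith+
      have xR: "x \<le> R" and yR: "y \<le> R" using le_R[OF x xK] le_R[OF y(1) yK] by auto
      have dK: "\<bar>d\<bar> \<le> K * L"
        using mu_pot_le[OF alpha x] mu_pot_le[OF alpha y(1)] mu_pot_nonneg[OF alpha x] mu_pot_nonneg[OF alpha y(1)] xK yK
        unfolding d_def by linarith
      have dd: "\<bar>x - y\<bar> \<le> C * (1 + R) * \<bar>d\<bar>"
      proof (cases "y \<le> x")
        case True
        have "0 \<le> d" using mu_pot_mono[OF alpha y(1) True] by (simp add: d_def)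
        then have "C * (1 + x) * d \<le> C * (1 + R) * d" using xR C(1) by (intro mult_right_mono mult_left_mono) auto
        then show ?thesis using C(3)[OF y(1) True] True \<open>0 \<le> d\<close> by (simp add: d_def)
      next
        case False
        then have yx: "x \<le> y" by simp
        have "0 \<le> - d" using mu_pot_mono[OF alpha x yx] by (simp add: d_def)
        then have "C * (1 + y) * (- d) \<le> C * (1 + R) * (- d)" using yR C(1) by (intro mult_right_mono mult_left_mono) auto
        then show ?thesis using C(3)[OF x yx] yx \<open>0 \<le> - d\<close> by (simp add: d_def)
      qed
      also have "\<dots> \<le> C * (2 * R) * \<bar>d\<bar>" using R1 C(1) by (intro mult_right_mono mult_left_mono) auto
      finally have "\<bar>x - y\<bar>\<^sup>2 \<le> (C * (2 * R) * \<bar>d\<bar>)\<^sup>2" by (intro power_mono) auto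
      then have "(x - y)\<^sup>2 \<le> (C * 2 * R)\<^sup>2 * d\<^sup>2" by (simp add: power_mult_distrib)
      also have "\<dots> \<le> (C * 2 * R)\<^sup>2 * ((1 + c * (K * L)\<^sup>2) / c * ln (kern \<theta> d))"
        by (intro mult_left_mono square_le_ln_kern[OF th c_def dK]) auto
      also have "\<dots> \<le> (C * 2 * R)\<^sup>2 * ((1 + c) * (K * L)\<^sup>2 / c * ln (kern \<theta> d))"
      proof -
        have "1 \<le> (K * L)\<^sup>2" using KL(3) by (rule one_le_power)
        then have "1 + c * (K * L)\<^sup>2 \<le> (1 + c) * (K * L)\<^sup>2" by (simp add: algebra_simps)
        then show ?thesis using c0 lk by (intro mult_left_mono mult_right_mono divide_right_mono) auto
      qed
      also have "\<dots> = A * L powr (2 / \<alpha> + 2) * ln (kern \<theta> d)"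
      proof -
        have "L powr (2 / \<alpha> + 2) = (L powr (1/\<alpha>))\<^sup>2 * L\<^sup>2"
        proof -
          have "(L powr (1/\<alpha>))\<^sup>2 = L powr (2 / \<alpha>)" by (simp add: power2_eq_square flip: powr_add)
          moreover have "L powr 2 = L\<^sup>2" using L by simp
          ultimately show ?thesis by (simp only: powr_add)
        qed
        moreover have "R = K powr (1/\<alpha>) * L powr (1/\<alpha>)" unfolding R_def using K L by (simp add: powr_mult)
        ultimately show ?thesis unfolding A_def by (simp add: power_mult_distrib mult_ac)
      qed
      finally show ?thesis by (simp add: d_def)
    qed
  qed
qed

section \<open>The product law\<close>

lemma mu_prod_prob_space: "0 < \<alpha> \<Longrightarrow> \<alpha> \<le> 1 \<Longrightarrow> prob_space (mu_prod \<alpha> n)"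
  unfolding mu_prod_def by (intro prob_space_PiM prob_space_mu) 

lemma sets_mu_prod: "sets (mu_prod \<alpha> n) = sets (borel_Rn n)"
  unfolding mu_prod_def by (intro sets_PiM_cong) (auto simp: mu_def)

lemma space_mu_prod: "space (mu_prod \<alpha> n) = Rn n"
  using sets_eq_imp_space_eq[OF sets_mu_prod[of \<alpha> n]] by (simp add: space_PiM)

text \<open>
  Used with a half-line, both for the support of the law and for its largest coordinate.
\<close>

lemma mu_prod_coordinate_union_bound:
  assumes alpha: "0 < \<alpha>" "\<alpha> \<le> 1" and B[measurable]: "B \<in> sets borel"
  shows "measure (mu_prod \<alpha> n) {x \<in> Rn n. \<exists>i<n. x i \<in> B} \<le> n * measure (mu \<alpha>) B"
proof -
  interpret prob_space "mu \<alpha>" by (rule prob_space_mu[OF alpha])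
  interpret PP: product_prob_space "\<lambda>_::nat. mu \<alpha>" "{..<n}" by standard
  let ?P = "PiM {..<n} (\<lambda>_. mu \<alpha>)"
  note [measurable_cong] = sets_mu
  have sp: "space ?P = Rn n" using space_mu_prod[of \<alpha> n] by (simp add: mu_prod_def)
  have Bm: "B \<in> sets (mu \<alpha>)" by (simp add: mu_def)
  have eq: "measure ?P {x \<in> Rn n. x i \<in> B} = measure (mu \<alpha>) B" if "i < n" for i
  proof -
    have "measure (mu \<alpha>) B = measure (distr ?P (mu \<alpha>) (\<lambda>x. x i)) B"
      using PP.PiM_component[of i] that by simp
    also have "\<dots> = measure ?P ((\<lambda>x. x i) -` B \<inter> space ?P)"
      using that Bm by (intro measure_distr) auto
    also have "(\<lambda>x. x i) -` B \<inter> space ?P = {x \<in> Rn n. x i \<in> B}" unfolding sp by auto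
    finally show ?thesis by simp
  qed
  have S: "{x \<in> Rn n. x i \<in> B} \<in> sets ?P" if "i < n" for i
  proof -
    have "(\<lambda>x. x i) -` B \<inter> space ?P \<in> sets ?P"
      using that Bm by (intro measurable_sets[where A="mu \<alpha>"]) auto
    moreover have "(\<lambda>x. x i) -` B \<inter> space ?P = {x \<in> Rn n. x i \<in> B}" unfolding sp by auto
    ultimately show ?thesis by simp
  qed
  have "{x \<in> Rn n. \<exists>i<n. x i \<in> B} = (\<Union>i\<in>{..<n}. {x \<in> Rn n. x i \<in> B})" by auto
  then have "measure ?P {x \<in> Rn n. \<exists>i<n. x i \<in> B} \<le> (\<Sum>i<n. measure ?P {x \<in> Rn n. x i \<in> B})"
    using PP.P.finite_measure_subadditive_finite[of "{..<n}" "\<lambda>i. {x \<in> Rn n. x i \<in> B}"] S by auto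
  also have "\<dots> = n * measure (mu \<alpha>) B" using eq by simp
  finally show ?thesis by (simp add: mu_prod_def)
qed

lemma measure_mu_neg:
  assumes alpha: "0 < \<alpha>" "\<alpha> \<le> 1" shows "measure (mu \<alpha>) {..<0} = 0"
proof -
  have "emeasure (mu \<alpha>) {..<0} = (\<integral>\<^sup>+t. ennreal (indicator {0..} t * mu_dens \<alpha> t) * indicator {..<0} t \<partial>lborel)"
    unfolding mu_eq_density[OF alpha] using mu_dens_measurable[OF alpha] by (subst emeasure_density) auto
  also have "\<dots> = (\<integral>\<^sup>+t. 0 \<partial>(lborel :: real measure))"
    by (intro nn_integral_cong) (auto simp: indicator_def)
  finally have "emeasure (mu \<alpha>) {..<0} = 0" by simp
  then show ?thesis by (simp add: measure_def)
qed

lemma mu_prod_shift: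
  assumes alpha: "0 < \<alpha>" "\<alpha> \<le> 1"
    and "\<phi> \<in> borel_measurable (mu_prod \<alpha> n)" "\<And>i. i < n \<Longrightarrow> 0 \<le> h i"
  shows "ennreal (exp (- (\<Sum>i<n. h i powr \<alpha>))) * (\<integral>\<^sup>+y. \<phi> (vadd n y h) \<partial>mu_prod \<alpha> n) \<le> (\<integral>\<^sup>+x. \<phi> x \<partial>mu_prod \<alpha> n)"
  using assms(3,4)
proof (induction n arbitrary: \<phi>)
  case 0
  interpret prob_space "mu \<alpha>" by (rule prob_space_mu[OF alpha])
  interpret P: product_sigma_finite "\<lambda>_::nat. mu \<alpha>" by standard
  show ?case by (simp add: mu_prod_def P.nn_integral_empty vadd_def) (simp add: PiM_empty nn_integral_count_space_finite)
next
  case (Suc n)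
  interpret prob_space "mu \<alpha>" by (rule prob_space_mu[OF alpha])
  interpret P: product_sigma_finite "\<lambda>_::nat. mu \<alpha>" by standard
  note [measurable_cong] = sets_mu[OF alpha]
  let ?P = "PiM {..<n} (\<lambda>_. mu \<alpha>)"
  interpret F: finite_product_sigma_finite "\<lambda>_::nat. mu \<alpha>" "{..<n}" by standard auto
  have ins: "{..<Suc n} = insert n {..<n}" by (rule lessThan_Suc)
  have split: "(\<integral>\<^sup>+x. c x \<partial>mu_prod \<alpha> (Suc n)) = (\<integral>\<^sup>+u. (\<integral>\<^sup>+x. c (x(n := u)) \<partial>?P) \<partial>mu \<alpha>)"
    if "c \<in> borel_measurable (mu_prod \<alpha> (Suc n))" for c
    using that unfolding ins mu_prod_def by (subst P.product_nn_integral_insert_rev) auto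
  have pm[measurable]: "\<phi> \<in> borel_measurable (PiM (insert n {..<n}) (\<lambda>_. mu \<alpha>))"
    using Suc.prems(1) unfolding ins mu_prod_def .
  define \<psi> where "\<psi> u = (\<integral>\<^sup>+x. \<phi> (x(n := u)) \<partial>?P)" for u
  have psim: "\<psi> \<in> borel_measurable borel"
    unfolding \<psi>_def measurable_cong_sets[OF sets_mu[OF alpha, symmetric] refl] by measurable
  have upd: "(\<lambda>x. x(n := u)) \<in> ?P \<rightarrow>\<^sub>M PiM (insert n {..<n}) (\<lambda>_. mu \<alpha>)" for u
    by (rule measurable_fun_upd[where J = "{..<n}"])
       (auto simp: measurable_ident_sets sets_eq_imp_space_eq[OF sets_mu[OF alpha]])
  have phim: "(\<lambda>x. \<phi> (x(n := u))) \<in> borel_measurable ?P" for u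
    by (rule measurable_compose[OF upd pm])
  let ?e = "\<lambda>n. ennreal (exp (- (\<Sum>i<n. h i powr \<alpha>)))" and ?f = "ennreal (exp (- (h n powr \<alpha>)))"
  have vm: "vadd (Suc n) y h = (\<lambda>i\<in>{..<Suc n}. y i + h i)" for y by (simp add: vadd_def)
  have vmeas: "(\<lambda>y. vadd (Suc n) y h) \<in> mu_prod \<alpha> (Suc n) \<rightarrow>\<^sub>M mu_prod \<alpha> (Suc n)"
    unfolding vm mu_prod_def by measurable
  have vupd: "vadd (Suc n) (x(n := u)) h = (vadd n x h)(n := u + h n)" for x u
    by (auto simp: vadd_def restrict_def fun_eq_iff)
  have vmn: "(\<lambda>y. vadd n y h) \<in> ?P \<rightarrow>\<^sub>M ?P"
    unfolding vadd_def by measurable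
  have "?e (Suc n) * (\<integral>\<^sup>+y. \<phi> (vadd (Suc n) y h) \<partial>mu_prod \<alpha> (Suc n))
     = ?f * (?e n * (\<integral>\<^sup>+u. (\<integral>\<^sup>+x. \<phi> ((vadd n x h)(n := u + h n)) \<partial>?P) \<partial>mu \<alpha>))"
    by (subst split[OF measurable_compose[OF vmeas Suc.prems(1)]])
       (simp add: vupd ennreal_mult'[symmetric] exp_add[symmetric] mult.assoc[symmetric] add.commute)
  also have "?e n * (\<integral>\<^sup>+u. (\<integral>\<^sup>+x. \<phi> ((vadd n x h)(n := u + h n)) \<partial>?P) \<partial>mu \<alpha>)
     = (\<integral>\<^sup>+u. ?e n * (\<integral>\<^sup>+x. \<phi> ((vadd n x h)(n := u + h n)) \<partial>?P) \<partial>mu \<alpha>)"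
  proof (rule nn_integral_cmult[symmetric])
    have [measurable]: "(\<lambda>y. vadd n y h) \<in> ?P \<rightarrow>\<^sub>M ?P" by (rule vmn)
    have [measurable]: "h n \<in> space (mu \<alpha>)" by (simp add: sets_eq_imp_space_eq[OF sets_mu[OF alpha]])
    show "(\<lambda>u. \<integral>\<^sup>+x. \<phi> ((vadd n x h)(n := u + h n)) \<partial>?P) \<in> borel_measurable (mu \<alpha>)"
      by measurable
  qed
  also have "?f * \<dots> \<le> ?f * (\<integral>\<^sup>+u. \<psi> (u + h n) \<partial>mu \<alpha>)"
  proof (intro mult_left_mono nn_integral_mono)
    fix u
    show "?e n * (\<integral>\<^sup>+x. \<phi> ((vadd n x h)(n := u + h n)) \<partial>?P) \<le> \<psi> (u + h n)"
      unfolding \<psi>_def mu_prod_def[symmetric]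
      using Suc.IH[of "\<lambda>x. \<phi> (x(n := u + h n))"] phim Suc.prems(2) by (simp add: mu_prod_def)
  qed auto
  also have "\<dots> \<le> (\<integral>\<^sup>+u. \<psi> u \<partial>mu \<alpha>)"
    by (rule mu_shift[OF alpha psim]) (use Suc.prems(2) in simp)
  also have "\<dots> = (\<integral>\<^sup>+x. \<phi> x \<partial>mu_prod \<alpha> (Suc n))" unfolding split[OF Suc.prems(1)] \<psi>_def ..
  finally show ?case .
qed

section \<open>Separated sets and displacements in dimension n\<close>

lemma mu_pot_max: "mu_pot \<alpha> x = mu_pot \<alpha> (max 0 x)"
  by (cases "0 \<le> x") (auto simp: mu_pot_def max_def)

lemma mu_pot_continuous:
  assumes alpha: "0 < \<alpha>" "\<alpha> \<le> 1" shows "continuous_on UNIV (mu_pot \<alpha>)"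
proof -
  have "isCont (\<lambda>x. mu_pot \<alpha> (max 0 x)) x" for x
  proof -
    have "continuous_on {..<\<bar>x\<bar>+1} (\<lambda>x. mu_pot \<alpha> (max 0 x))"
      by (rule continuous_on_compose2[OF survival_potential_continuous[OF mu_dens_continuous[OF alpha] mu_dens_integral_lt_1[OF alpha] mu_pot_eq_ln[OF alpha], of "\<bar>x\<bar>+1"]])
         (auto intro!: continuous_intros)
    then show ?thesis by (subst (asm) continuous_on_eq_continuous_at) auto
  qed
  then show ?thesis unfolding mu_pot_max[symmetric] by (simp add: continuous_at_imp_continuous_on)
qed

lemma lp_norm_powr: "0 < p \<Longrightarrow> lp_norm p n h powr p = (\<Sum>i<n. \<bar>h i\<bar> powr p)"
  by (simp add: lp_norm_def powr_powr sum_nonneg)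

lemma mem_scaled_lp_ball:
  assumes "0 < p" "0 < r" "h \<in> Rn n" "(\<Sum>i<n. \<bar>h i\<bar> powr p) \<le> r powr p"
  shows "h \<in> vscale n r ` lp_ball p n"
proof
  show "h = vscale n r (vscale n (1 / r) h)"
    using assms by (auto simp: vscale_def restrict_def fun_eq_iff PiE_def extensional_def)
  have "(\<Sum>i<n. \<bar>vscale n (1 / r) h i\<bar> powr p) = (\<Sum>i<n. \<bar>h i\<bar> powr p / r powr p)"
    using assms by (intro sum.cong refl) (auto simp: vscale_def abs_mult powr_divide)
  also have "\<dots> = (\<Sum>i<n. \<bar>h i\<bar> powr p) / r powr p" by (simp add: sum_divide_distrib)
  also have "\<dots> \<le> 1" using assms by simp
  finally have "(\<Sum>i<n. \<bar>vscale n (1 / r) h i\<bar> powr p) powr (1/p) \<le> 1"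
    using assms(1) by (intro powr_le1) (auto simp: abs_of_nonneg sum_nonneg)
  then show "vscale n (1 / r) h \<in> lp_ball p n"
    unfolding lp_ball_def lp_norm_def mem_Collect_eq by (intro conjI) (auto simp: vscale_def)
qed

text \<open>
  The set is closed, being defined by a family of continuous conditions, hence Borel even though
  \<open>C\<close> is arbitrary. A point of the product is extended by zeros in order to use the product topology of the space of
  all sequences.
\<close>

lemma separated_points_measurable:
  assumes alpha: "0 < \<alpha>" "\<alpha> \<le> 1"
  shows "{y \<in> Rn n. \<forall>x\<in>C. s \<le> (\<Prod>i<n. kern \<theta> (mu_pot \<alpha> (x i) - mu_pot \<alpha> (y i)))} \<in> sets (borel_Rn n)"
proof -
  define g where "g x z = (\<Prod>i<n. kern \<theta> (mu_pot \<alpha> (x i) - mu_pot \<alpha> (z i)))" for x z :: "nat \<Rightarrow> real"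
  have "continuous_on UNIV (g x)" for x
    unfolding g_def kern_def
    by (intro continuous_intros continuous_on_compose2[OF mu_pot_continuous[OF alpha]] continuous_on_product_coordinates) auto
  then have "open {z. g x z < s}" for x
    by (intro open_Collect_less) (auto intro: continuous_on_const)
  then have "open (\<Union>x\<in>C. {z. g x z < s})" by blast
  then have U: "(\<Union>x\<in>C. {z. g x z < s}) \<in> sets (PiM UNIV (\<lambda>_. borel))"
    by (simp add: sets_PiM_equal_borel)
  define e where "e y = (\<lambda>i. if i < n then y i else (0::real))" for y
  have e: "e \<in> borel_Rn n \<rightarrow>\<^sub>M PiM UNIV (\<lambda>_. borel)"
  proof (rule measurable_PiM_single')
    fix i :: nat
    show "(\<lambda>y. e y i) \<in> borel_Rn n \<rightarrow>\<^sub>M borel"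
      unfolding e_def by (cases "i < n") auto
  qed (auto simp: space_PiM)
  have "{y \<in> Rn n. \<forall>x\<in>C. s \<le> g x y} = space (borel_Rn n) - (e -` (\<Union>x\<in>C. {z. g x z < s}) \<inter> space (borel_Rn n))"
    by (auto simp: space_PiM g_def e_def not_less)
  also have "\<dots> \<in> sets (borel_Rn n)"
    using measurable_sets[OF e U] by auto
  finally show ?thesis by (simp add: g_def)
qed

text \<open>
  The event \<open>E\<close> need not be determined by \<open>X\<close>, and the image of \<open>E\<close> under \<open>X\<close> need not be measurable.
  It is contained in the set of all points at cost distance at least \<open>s\<close> from the part of \<open>C\<close> in the
  orthant, which is Borel and has therefore probability at least \<open>1 / 2\<close>.
\<close>

lemma prob_le_of_separated:
  assumes alpha: "0 < \<alpha>" "\<alpha> \<le> 1" and th: "0 < \<theta>" "\<theta> < 1"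
    and P: "prob_space P" and X: "X \<in> P \<rightarrow>\<^sub>M borel_Rn n" and law: "distr P (borel_Rn n) X = mu_prod \<alpha> n"
    and C: "C \<in> sets (borel_Rn n)" and E: "E \<in> sets P" "1 / 2 \<le> measure P E"
    and sep: "\<And>\<omega> x. \<omega> \<in> E \<Longrightarrow> x \<in> C \<Longrightarrow> x \<in> Rn_nonneg n \<Longrightarrow>
      exp s \<le> (\<Prod>i<n. kern \<theta> (mu_pot \<alpha> (x i) - mu_pot \<alpha> (X \<omega> i)))"
  shows "measure P {\<omega> \<in> space P. X \<omega> \<in> C} \<le> 2 * exp (- s)"
proof -
  interpret P: prob_space P by fact
  interpret Q: prob_space "mu_prod \<alpha> n" by (rule mu_prod_prob_space[OF alpha])
  let ?Q = "mu_prod \<alpha> n"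
  have meas: "measure ?Q A = measure P {\<omega> \<in> space P. X \<omega> \<in> A}" if "A \<in> sets (borel_Rn n)" for A
    unfolding law[symmetric] using measure_distr[OF X that] by (simp add: vimage_def Int_def conj_commute)
  \<comment> \<open>The law does not charge points with a negative coordinate, so \<open>C\<close> may be restricted to the orthant.\<close>
  define W where "W = {x \<in> Rn n. \<exists>i<n. x i \<in> {..<(0::real)}}"
  have W: "W \<in> sets (borel_Rn n)"
  proof -
    have "W = (\<Union>i\<in>{..<n}. (\<lambda>x. x i) -` {..<0} \<inter> space (borel_Rn n))" by (auto simp: W_def space_PiM)
    also have "\<dots> \<in> sets (borel_Rn n)" by measurable
    finally show ?thesis .
  qed
  have W0: "measure ?Q W = 0"
    using mu_prod_coordinate_union_bound[OF alpha, of "{..<0}" n] measure_mu_neg[OF alpha] measure_nonneg[of ?Q W]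
    unfolding W_def by (intro antisym) auto
  define C' where "C' = C - W"
  have C': "C' \<in> sets (borel_Rn n)" using C W by (simp add: C'_def)
  have C'n: "x \<in> Rn_nonneg n" if "x \<in> C'" for x
  proof -
    have "x \<in> Rn n" "x \<notin> W" using that sets.sets_into_space[OF C] by (auto simp: C'_def space_PiM)
    then show ?thesis unfolding W_def Rn_nonneg_def by (auto simp: not_less) (metis linorder_not_le)
  qed
  define A where "A = {y \<in> Rn n. \<forall>x\<in>C'. exp s \<le> (\<Prod>i<n. kern \<theta> (mu_pot \<alpha> (x i) - mu_pot \<alpha> (y i)))}"
  have A: "A \<in> sets (borel_Rn n)" unfolding A_def by (rule separated_points_measurable[OF alpha])
  have "E \<subseteq> {\<omega> \<in> space P. X \<omega> \<in> A}"
  proof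
    fix \<omega> assume w: "\<omega> \<in> E"
    then have "\<omega> \<in> space P" using sets.sets_into_space[OF E(1)] by auto
    moreover have "X \<omega> \<in> Rn n" using measurable_space[OF X \<open>\<omega> \<in> space P\<close>] by (simp add: space_PiM)
    ultimately show "\<omega> \<in> {\<omega> \<in> space P. X \<omega> \<in> A}"
      using sep[OF w] C'n by (auto simp: A_def C'_def)
  qed
  then have "measure P E \<le> measure P {\<omega> \<in> space P. X \<omega> \<in> A}"
    using measurable_sets[OF X A] by (intro P.finite_measure_mono) (auto simp: vimage_def Int_def conj_commute)
  then have mA: "1 / 2 \<le> measure ?Q A" using E(2) meas[OF A] by simp
  have "measure ?Q C' * measure ?Q A \<le> exp (- s)"
    unfolding mu_prod_def
  proof (rule separated_sets_product[where k = "\<lambda>x y. kern \<theta> (mu_pot \<alpha> x - mu_pot \<alpha> y)"])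
    show "prob_space (mu \<alpha>)" "sets (mu \<alpha>) = sets borel" by (rule prob_space_mu[OF alpha], rule sets_mu[OF alpha])
    show "0 < kern \<theta> (mu_pot \<alpha> x - mu_pot \<alpha> y)" for x y by (rule kern_pos[OF th])
    show "A \<in> sets (PiM {..<n} (\<lambda>_. mu \<alpha>))" "C' \<in> sets (PiM {..<n} (\<lambda>_. mu \<alpha>))"
      using A C' sets_mu_prod[of \<alpha> n] by (simp_all add: mu_prod_def)
    show "exp s \<le> (\<Prod>i<n. kern \<theta> (mu_pot \<alpha> (x i) - mu_pot \<alpha> (y i)))" if "x \<in> C'" "y \<in> A" for x y
      using that by (auto simp: A_def)
    show "(\<integral>\<^sup>+ x. a x \<partial>mu \<alpha>) * (\<integral>\<^sup>+ x. b x \<partial>mu \<alpha>) \<le> 1"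
      if "a \<in> borel_measurable borel" "b \<in> borel_measurable borel"
        "\<And>x y. a x * b y \<le> ennreal (kern \<theta> (mu_pot \<alpha> x - mu_pot \<alpha> y))" for a b :: "real \<Rightarrow> ennreal"
      by (rule two_function_ineq[OF th mu_dens_continuous[OF alpha] mu_dens_pos[OF alpha] mu_dens_total[OF alpha]
            mu_pot_eq_ln[OF alpha] mu_eq_density[OF alpha] that])
  qed
  moreover have "measure ?Q C' * (1 / 2) \<le> measure ?Q C' * measure ?Q A"
    using mA by (intro mult_left_mono) auto
  ultimately have "measure ?Q C' \<le> 2 * exp (- s)" by linarith
  moreover have "measure ?Q C \<le> measure ?Q C' + measure ?Q W"
  proof -
    have "measure ?Q C \<le> measure ?Q (C' \<union> W)"
      using C C' W sets_mu_prod[of \<alpha> n] by (intro Q.finite_measure_mono) (auto simp: C'_def)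
    also have "\<dots> \<le> measure ?Q C' + measure ?Q W"
      using C' W sets_mu_prod[of \<alpha> n] by (intro measure_Un_le) auto
    finally show ?thesis .
  qed
  ultimately show ?thesis using W0 meas[OF C] by simp
qed

text \<open>
  The displacement \<open>x - y\<close> is split according to which alternative holds for each coordinate: the
  coordinates that pay the full price \<open>\<bar>x - y\<bar>\<^sup>\<alpha>\<close> form the part \<open>h1\<close>, controlled in \<open>\<ell>\<^sup>\<alpha>\<close>, and the others form the
  part \<open>h2\<close>, controlled in \<open>\<ell>\<^sup>2\<close>.
\<close>

lemma cheap_displacement_split:
  fixes x y c :: "nat \<Rightarrow> real"
  assumes alpha: "0 < \<alpha>" "\<alpha> \<le> 1" and eps: "\<epsilon> < 1" and v: "0 < v" and tau: "0 < \<tau>" and t: "0 \<le> t" and D: "0 \<le> D"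
    and x: "x \<in> Rn n" and y: "y \<in> Rn n"
    and c: "\<And>i. i < n \<Longrightarrow> 0 \<le> c i" "(\<Sum>i<n. c i) \<le> (1 - \<epsilon>) * \<tau> * v"
    and dich: "\<And>i. i < n \<Longrightarrow> (1 - \<epsilon>) * \<bar>x i - y i\<bar> powr \<alpha> \<le> c i \<or> (x i - y i)\<^sup>2 \<le> D * c i"
    and Dt: "D * ((1 - \<epsilon>) * \<tau> * v) \<le> t\<^sup>2"
  obtains h1 h2 where "h1 \<in> Rn n" "(\<Sum>i<n. \<bar>h1 i\<bar> powr \<alpha>) \<le> \<tau>" "h2 \<in> Rn n" "lp_norm 2 n h2 \<le> t"
    "x = vadd n (vadd n y (vscale n (v powr (1 / \<alpha>)) h1)) h2"
proof -
  define big where "big i \<longleftrightarrow> (1 - \<epsilon>) * \<bar>x i - y i\<bar> powr \<alpha> \<le> c i" for i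
  define q where "q = v powr (1 / \<alpha>)"
  have q: "0 < q" "q powr \<alpha> = v" using v alpha by (simp_all add: q_def powr_powr)
  define h1 where "h1 = (\<lambda>i\<in>{..<n}. if big i then (x i - y i) / q else 0)"
  define h2 where "h2 = (\<lambda>i\<in>{..<n}. if big i then 0 else x i - y i)"
  show ?thesis
  proof (rule that[of h1 h2])
    show "h1 \<in> Rn n" "h2 \<in> Rn n" by (auto simp: h1_def h2_def)
    have "(1 - \<epsilon>) * (\<Sum>i<n. \<bar>h1 i\<bar> powr \<alpha>) \<le> (\<Sum>i<n. c i / v)"
      unfolding sum_distrib_left
    proof (rule sum_mono)
      fix i assume "i \<in> {..<n}"
      then show "(1 - \<epsilon>) * \<bar>h1 i\<bar> powr \<alpha> \<le> c i / v"
        using c(1)[of i] v q by (auto simp: h1_def big_def powr_divide abs_divide divide_right_mono)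
    qed
    also have "\<dots> \<le> (1 - \<epsilon>) * \<tau>"
      using c(2) v by (simp add: sum_divide_distrib[symmetric] field_simps)
    finally show "(\<Sum>i<n. \<bar>h1 i\<bar> powr \<alpha>) \<le> \<tau>" using eps by simp
    have "(\<Sum>i<n. \<bar>h2 i\<bar> powr 2) \<le> (\<Sum>i<n. D * c i)"
    proof (rule sum_mono)
      fix i assume "i \<in> {..<n}"
      then show "\<bar>h2 i\<bar> powr 2 \<le> D * c i"
        using c(1)[of i] D dich[of i] by (auto simp: h2_def big_def)
    qed
    also have "\<dots> \<le> D * ((1 - \<epsilon>) * \<tau> * v)"
      unfolding sum_distrib_left[symmetric] by (intro mult_left_mono c(2) D)
    also note Dt
    finally have "(\<Sum>i<n. \<bar>h2 i\<bar> powr 2) powr (1/2) \<le> (t\<^sup>2) powr (1/2)"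
      by (intro powr_mono2) (auto intro: sum_nonneg)
    also have "\<dots> = t" using t by (simp add: powr_half_sqrt)
    finally show "lp_norm 2 n h2 \<le> t" by (simp add: lp_norm_def)
    show "x = vadd n (vadd n y (vscale n (v powr (1 / \<alpha>)) h1)) h2"
    proof
      fix i show "x i = vadd n (vadd n y (vscale n (v powr (1 / \<alpha>)) h1)) h2 i"
        using x q(1) unfolding q_def[symmetric]
        by (cases "i < n") (auto simp: vadd_def vscale_def h1_def h2_def PiE_def extensional_def)
    qed
  qed
qed

lemma eventually_along: "eventually Q (along N) \<longleftrightarrow> (\<exists>n0. \<forall>n\<ge>n0. n \<in> N \<longrightarrow> Q n)"
  by (simp add: along_def eventually_inf_principal eventually_sequentially)

lemma eventually_along_sequentially: "eventually Q sequentially \<Longrightarrow> eventually Q (along N)"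
  by (auto simp: eventually_along eventually_sequentially)

text \<open>
  The set \<open>B\<close> is a rare set of exceptional initial positions. It is empty for \<open>\<alpha> = 1\<close>. For \<open>\<alpha> < 1\<close> it consists of
  the positions with \<open>y\<^sup>\<alpha> > 2 ln n\<close>, which no coordinate reaches with high probability, and \<open>D\<close> is then
  polynomial in \<open>ln n\<close>, so that it is negligible against \<open>exp ((ln n)\<^bsup>\<alpha>/2\<^esup>)\<close> and thus against \<open>t\<^sup>2 / v\<close>.
\<close>

lemma eventually_coordinate_dichotomy:
  fixes t v :: "nat \<Rightarrow> real"
  assumes alpha: "0 < \<alpha>" "\<alpha> \<le> 1" and eps: "0 < \<epsilon>" "\<epsilon> < 1" and tau: "0 < \<tau>"
    and speed: "filterlim v at_top (along N)"
    and growth: "\<alpha> \<noteq> 1 \<Longrightarrow> \<forall>\<^sub>F n in along N. 0 < ln ((t n)\<^sup>2 / v n)"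
      "\<alpha> \<noteq> 1 \<Longrightarrow> (\<lambda>n. ln (real n) powr (\<alpha> / 2)) \<in> o[along N](\<lambda>n. ln ((t n)\<^sup>2 / v n))"
      "\<alpha> = 1 \<Longrightarrow> v \<in> o[along N](\<lambda>n. (t n)\<^sup>2)"
  obtains \<theta> where "0 < \<theta>" "\<theta> < 1"
    "\<forall>\<^sub>F n in along N. \<exists>D B. 0 \<le> D \<and> D * (\<tau> * v n) \<le> (t n)\<^sup>2 \<and> B \<in> sets borel \<and>
       measure (mu_prod \<alpha> n) {x \<in> Rn n. \<exists>i<n. x i \<in> B} < 1 / 8 \<and>
       (\<forall>x y. 0 \<le> x \<longrightarrow> 0 \<le> y \<longrightarrow> y \<notin> B \<longrightarrow>
          (1 - \<epsilon>) * \<bar>x - y\<bar> powr \<alpha> \<le> ln (kern \<theta> (mu_pot \<alpha> x - mu_pot \<alpha> y)) \<or>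
          (x - y)\<^sup>2 \<le> D * ln (kern \<theta> (mu_pot \<alpha> x - mu_pot \<alpha> y)))"
proof (cases "\<alpha> = 1")
  case True
  obtain \<theta> D where th: "0 < \<theta>" "\<theta> < 1" and D: "0 < D" and dich: "\<And>x y. 0 \<le> x \<Longrightarrow> 0 \<le> y \<Longrightarrow>
       (1 - \<epsilon>) * \<bar>x - y\<bar> \<le> ln (kern \<theta> (mu_pot 1 x - mu_pot 1 y)) \<or>
       (x - y)\<^sup>2 \<le> D * ln (kern \<theta> (mu_pot 1 x - mu_pot 1 y))"
    using coordinate_dichotomy_exponential[OF eps] by metis
  have "\<forall>\<^sub>F n in along N. norm (v n) \<le> 1 / (D * \<tau>) * norm ((t n)\<^sup>2)"
    by (rule landau_o.smallD[OF growth(3)[OF True]]) (use D tau in simp)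
  then show ?thesis
  proof (intro that[OF th], elim eventually_mono)
    fix n assume n: "norm (v n) \<le> 1 / (D * \<tau>) * norm ((t n)\<^sup>2)"
    then have "v n \<le> 1 / (D * \<tau>) * (t n)\<^sup>2" by simp
    then have "D * (\<tau> * v n) \<le> (t n)\<^sup>2" using D tau by (simp add: field_simps)
    then show "\<exists>D B. 0 \<le> D \<and> D * (\<tau> * v n) \<le> (t n)\<^sup>2 \<and> B \<in> sets borel \<and>
       measure (mu_prod \<alpha> n) {x \<in> Rn n. \<exists>i<n. x i \<in> B} < 1 / 8 \<and>
       (\<forall>x y. 0 \<le> x \<longrightarrow> 0 \<le> y \<longrightarrow> y \<notin> B \<longrightarrow>
          (1 - \<epsilon>) * \<bar>x - y\<bar> powr \<alpha> \<le> ln (kern \<theta> (mu_pot \<alpha> x - mu_pot \<alpha> y)) \<or>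
          (x - y)\<^sup>2 \<le> D * ln (kern \<theta> (mu_pot \<alpha> x - mu_pot \<alpha> y)))"
      using D dich True by (intro exI[of _ D] exI[of _ "{}"]) simp
  qed
next
  case False
  obtain \<theta> A where th: "0 < \<theta>" "\<theta> < 1" and A: "0 < A" and dich: "\<And>L x y. 1 \<le> L \<Longrightarrow> 0 \<le> x \<Longrightarrow> 0 \<le> y \<Longrightarrow> y powr \<alpha> \<le> L \<Longrightarrow>
       (1 - \<epsilon>) * \<bar>x - y\<bar> powr \<alpha> \<le> ln (kern \<theta> (mu_pot \<alpha> x - mu_pot \<alpha> y)) \<or>
       (x - y)\<^sup>2 \<le> A * L powr (2 / \<alpha> + 2) * ln (kern \<theta> (mu_pot \<alpha> x - mu_pot \<alpha> y))"
    using coordinate_dichotomy[OF alpha eps] by metis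
  obtain C where C: "1 \<le> C" "\<And>x. 0 \<le> x \<Longrightarrow> exp (- mu_pot \<alpha> x) \<le> C * (1 + x) * exp (- (x powr \<alpha>))"
    using mu_pot_bounds[OF alpha] by metis
  let ?L = "\<lambda>n::nat. 2 * ln (real n)"
  have "((\<lambda>n. real n * (C * (1 + ?L n powr (1/\<alpha>)) * exp (- ?L n))) \<longlongrightarrow> 0) sequentially"
    using alpha C(1) by real_asymp
  then have e1: "\<forall>\<^sub>F n in along N. real n * (C * (1 + ?L n powr (1/\<alpha>)) * exp (- ?L n)) < 1 / 8"
    by (intro eventually_along_sequentially order_tendstoD(2)) auto
  have e2: "\<forall>\<^sub>F n in along N. 1 \<le> ?L n"
    by (intro eventually_along_sequentially) real_asymp
  have "\<forall>\<^sub>F y in at_top. A * (2 * y) powr (2 / \<alpha> + 2) * \<tau> \<le> exp (y powr (\<alpha> / 2))"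
    using alpha A tau by real_asymp
  moreover have "filterlim (\<lambda>n. ln (real n)) at_top sequentially" by real_asymp
  ultimately have "\<forall>\<^sub>F n in sequentially. A * (?L n) powr (2 / \<alpha> + 2) * \<tau> \<le> exp (ln (real n) powr (\<alpha> / 2))"
    unfolding filterlim_iff by blast
  then have e3: "\<forall>\<^sub>F n in along N. A * (?L n) powr (2 / \<alpha> + 2) * \<tau> \<le> exp (ln (real n) powr (\<alpha> / 2))"
    by (rule eventually_along_sequentially)
  have e4: "\<forall>\<^sub>F n in along N. norm (ln (real n) powr (\<alpha> / 2)) \<le> 1 * norm (ln ((t n)\<^sup>2 / v n))"
    by (rule landau_o.smallD[OF growth(2)[OF False]]) simp
  have e5: "\<forall>\<^sub>F n in along N. 0 < v n"
    using speed unfolding filterlim_at_top_dense by blast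
  show ?thesis
  proof (intro that[OF th])
    show "\<forall>\<^sub>F n in along N. \<exists>D B. 0 \<le> D \<and> D * (\<tau> * v n) \<le> (t n)\<^sup>2 \<and> B \<in> sets borel \<and>
       measure (mu_prod \<alpha> n) {x \<in> Rn n. \<exists>i<n. x i \<in> B} < 1 / 8 \<and>
       (\<forall>x y. 0 \<le> x \<longrightarrow> 0 \<le> y \<longrightarrow> y \<notin> B \<longrightarrow>
          (1 - \<epsilon>) * \<bar>x - y\<bar> powr \<alpha> \<le> ln (kern \<theta> (mu_pot \<alpha> x - mu_pot \<alpha> y)) \<or>
          (x - y)\<^sup>2 \<le> D * ln (kern \<theta> (mu_pot \<alpha> x - mu_pot \<alpha> y)))"
      using e1 e2 e3 e4 e5 growth(1)[OF False]
    proof eventually_elim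
      fix n
      assume n: "real n * (C * (1 + ?L n powr (1/\<alpha>)) * exp (- ?L n)) < 1 / 8" "1 \<le> ?L n"
        "A * (?L n) powr (2 / \<alpha> + 2) * \<tau> \<le> exp (ln (real n) powr (\<alpha> / 2))"
        "norm (ln (real n) powr (\<alpha> / 2)) \<le> 1 * norm (ln ((t n)\<^sup>2 / v n))" "0 < v n" "0 < ln ((t n)\<^sup>2 / v n)"
      define D where "D = A * (?L n) powr (2 / \<alpha> + 2)"
      define a where "a = ?L n powr (1/\<alpha>)"
      have a: "0 \<le> a" "a powr \<alpha> = ?L n" using n(2) alpha by (simp_all add: a_def powr_powr)
      have "0 < (t n)\<^sup>2 / v n"
      proof (rule ccontr)
        assume "\<not> ?thesis"
        then have "(t n)\<^sup>2 / v n = 0" using n(5) by (meson divide_nonneg_pos linorder_neqE_linordered_idom not_less zero_le_power2)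
        then have "ln ((t n)\<^sup>2 / v n) = 0" by (simp only: ln_0)
        then show False using n(6) by linarith
      qed
      then have "exp (ln (real n) powr (\<alpha> / 2)) \<le> (t n)\<^sup>2 / v n"
        using n(4,6) by (subst ln_ge_iff[symmetric]) auto
      then have "D * \<tau> \<le> (t n)\<^sup>2 / v n" using n(3) by (simp add: D_def)
      then have Dt: "D * (\<tau> * v n) \<le> (t n)\<^sup>2" using n(5) by (simp add: field_simps)
      have "measure (mu_prod \<alpha> n) {x \<in> Rn n. \<exists>i<n. x i \<in> {a<..}} \<le> n * measure (mu \<alpha>) {a<..}"
        by (rule mu_prod_coordinate_union_bound[OF alpha]) simp
      also have "measure (mu \<alpha>) {a<..} = exp (- mu_pot \<alpha> a)"
        using emeasure_mu_tail[OF alpha a(1)] by (simp add: measure_def)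
      also have "real n * exp (- mu_pot \<alpha> a) \<le> real n * (C * (1 + ?L n powr (1/\<alpha>)) * exp (- ?L n))"
        using C(2)[OF a(1)] unfolding a(2) by (intro mult_left_mono) (auto simp: a_def)
      also note n(1)
      finally have m: "measure (mu_prod \<alpha> n) {x \<in> Rn n. \<exists>i<n. x i \<in> {a<..}} < 1 / 8" .
      have "y powr \<alpha> \<le> ?L n" if "0 \<le> y" "y \<notin> {a<..}" for y
        using that alpha a(2) powr_mono2[of \<alpha> y a] by simp
      then show "\<exists>D B. 0 \<le> D \<and> D * (\<tau> * v n) \<le> (t n)\<^sup>2 \<and> B \<in> sets borel \<and>
       measure (mu_prod \<alpha> n) {x \<in> Rn n. \<exists>i<n. x i \<in> B} < 1 / 8 \<and>
       (\<forall>x y. 0 \<le> x \<longrightarrow> 0 \<le> y \<longrightarrow> y \<notin> B \<longrightarrow>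
          (1 - \<epsilon>) * \<bar>x - y\<bar> powr \<alpha> \<le> ln (kern \<theta> (mu_pot \<alpha> x - mu_pot \<alpha> y)) \<or>
          (x - y)\<^sup>2 \<le> D * ln (kern \<theta> (mu_pot \<alpha> x - mu_pot \<alpha> y)))"
        using dich[OF n(2)] A Dt m unfolding D_def
        by (intro exI[of _ "A * (?L n) powr (2 / \<alpha> + 2)"] exI[of _ "{a<..}"]) auto
    qed
  qed
qed

section \<open>Probability bounds\<close>

lemma eventually_mem_along: "\<forall>\<^sub>F n in along N. n \<in> N"
  by (auto simp: eventually_along)

text \<open>
  Outer probabilities are turned into measurable exceptional events.
\<close>

lemma tends_to_zero_in_prob_event:
  assumes "tends_to_zero_in_prob F M Y" "0 < \<epsilon>" "0 < c"
  shows "\<forall>\<^sub>F n in F. \<exists>A\<in>sets (M n). {\<omega> \<in> space (M n). ennreal \<epsilon> < Y n \<omega>} \<subseteq> A \<and> emeasure (M n) A < ennreal c"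
proof -
  have "\<forall>\<^sub>F n in F. outer_measure_of (M n) {\<omega> \<in> space (M n). ennreal \<epsilon> < Y n \<omega>} < ennreal c"
    using assms unfolding tends_to_zero_in_prob_def by (intro order_tendstoD(2)) auto
  then show ?thesis
    by eventually_elim (auto simp: outer_measure_of_def INF_less_iff)
qed

text \<open>
  Markov's inequality for a measurable majorant. The factor \<open>2\<close> pays for the majorant, which
  only almost attains the upper expectation.
\<close>

lemma upper_expectation_event:
  assumes le: "upper_expectation M Y \<le> ennreal (\<delta> * c)" and pos: "0 < \<delta>" "0 < c"
  shows "\<exists>A\<in>sets M. emeasure M A \<le> ennreal (2 * c) \<and> (\<forall>\<omega>\<in>space M - A. Y \<omega> \<le> ennreal \<delta>)"
proof -
  have "ennreal (\<delta> * c) < ennreal (2 * \<delta> * c)" using pos by (intro ennreal_lessI) auto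
  then have "upper_expectation M Y < ennreal (2 * \<delta> * c)" using le by (rule order.strict_trans1[rotated])
  then obtain g where g[measurable]: "g \<in> borel_measurable M" and Y: "\<forall>\<omega>\<in>space M. Y \<omega> \<le> g \<omega>"
    and int: "(\<integral>\<^sup>+\<omega>. g \<omega> \<partial>M) < ennreal (2 * \<delta> * c)"
    unfolding upper_expectation_def INF_less_iff by auto
  define A where "A = {\<omega> \<in> space M. ennreal \<delta> \<le> g \<omega>}"
  have A[measurable]: "A \<in> sets M" unfolding A_def by measurable
  have "ennreal \<delta> * emeasure M A = (\<integral>\<^sup>+\<omega>. ennreal \<delta> * indicator A \<omega> \<partial>M)"
    by (simp add: nn_integral_cmult_indicator)
  also have "\<dots> \<le> (\<integral>\<^sup>+\<omega>. g \<omega> \<partial>M)" by (intro nn_integral_mono) (auto simp: A_def indicator_def)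
  also have "\<dots> \<le> ennreal \<delta> * ennreal (2 * c)"
    using int pos by (simp add: ennreal_mult'[symmetric] mult_ac)
  finally have "emeasure M A \<le> ennreal (2 * c)"
    using pos by (subst (asm) ennreal_mult_le_mult_iff) auto
  moreover have "Y \<omega> \<le> ennreal \<delta>" if "\<omega> \<in> space M - A" for \<omega>
    using that Y by (force simp: A_def)
  ultimately show ?thesis using A by blast
qed

lemma not_less_SUP_ennreal_abs:
  assumes "\<not> ennreal \<delta> < (SUP h\<in>H. ennreal \<bar>g h\<bar>)" "h \<in> H" "0 \<le> \<delta>"
  shows "\<bar>g h\<bar> \<le> \<delta>"
proof -
  have "ennreal \<bar>g h\<bar> \<le> (SUP h\<in>H. ennreal \<bar>g h\<bar>)" by (rule SUP_upper) fact
  also have "\<dots> \<le> ennreal \<delta>" using assms(1) by simp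
  finally show ?thesis using assms(3) by simp
qed

lemma vscale_vscale: "vscale n a (vscale n b h) = vscale n (a * b) h"
  by (auto simp: vscale_def restrict_def fun_eq_iff)

context
  fixes \<alpha> :: real and N :: "nat set"
    and M :: "nat \<Rightarrow> 'a measure" and X :: "nat \<Rightarrow> 'a \<Rightarrow> (nat \<Rightarrow> real)"
    and f F :: "nat \<Rightarrow> (nat \<Rightarrow> real) \<Rightarrow> real" and v :: "nat \<Rightarrow> real"
  assumes alpha: "0 < \<alpha>" "\<alpha> \<le> 1"
    and prob: "\<And>n. n \<in> N \<Longrightarrow> prob_space (M n)"
    and X_rv: "\<And>n. n \<in> N \<Longrightarrow> X n \<in> M n \<rightarrow>\<^sub>M borel_Rn n"
    and X_law: "\<And>n. n \<in> N \<Longrightarrow> distr (M n) (borel_Rn n) (X n) = mu_prod \<alpha> n"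
    and f_meas: "\<And>n. n \<in> N \<Longrightarrow> f n \<in> borel_measurable (borel_Rn n)"
    and speed: "filterlim v at_top (along N)"
    and i: "\<And>r::real. 0 < r \<Longrightarrow>
      tends_to_zero_in_prob (along N) M
        (\<lambda>n \<omega>. SUP h \<in> vscale n r ` lp_ball \<alpha> n.
           ennreal \<bar>f n (vadd n (X n \<omega>) (vscale n (v n powr (1 / \<alpha>)) h)) - F n h\<bar>)"
begin

lemma eventually_speed_pos: "\<forall>\<^sub>F n in along N. 0 < v n"
  using speed unfolding filterlim_at_top_dense by blast

lemma measure_eq_mu_prod:
  assumes "n \<in> N" "A \<in> sets (borel_Rn n)"
  shows "measure (mu_prod \<alpha> n) A = measure (M n) {\<omega> \<in> space (M n). X n \<omega> \<in> A}"
  unfolding X_law[OF assms(1), symmetric] using measure_distr[OF X_rv[OF assms(1)] assms(2)]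
  by (simp add: vimage_def Int_def conj_commute)

lemma coordinate_event_measurable:
  fixes B :: "real set"
  assumes "B \<in> sets borel"
  shows "{x \<in> Rn n. \<exists>i<n. x i \<in> B} \<in> sets (borel_Rn n)"
proof -
  have "{x \<in> Rn n. \<exists>i<n. x i \<in> B} = (\<Union>i\<in>{..<n}. (\<lambda>x. x i) -` B \<inter> space (borel_Rn n))" by (auto simp: space_PiM)
  also have "\<dots> \<in> sets (borel_Rn n)" using assms by (intro sets.finite_UN measurable_sets[where A = borel]) auto
  finally show ?thesis .
qed

text \<open>
  With probability at least \<open>1 / 2\<close> the sample \<open>y\<close> is good: \<open>f (y + v\<^bsup>1/\<alpha>\<^esup> h1)\<close> is within \<open>\<delta>\<close> of \<open>F h1\<close> for
  all \<open>h1\<close> of the ball, and a further displacement \<open>h2\<close> of \<open>\<ell>\<^sup>2\<close> norm at most \<open>t\<close> changes the value by at most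
  \<open>\<delta>\<close>. If \<open>x\<close> were within cost \<open>(1 - \<epsilon>) \<tau> v\<close> of a good sample, then \<open>x = y + v\<^bsup>1/\<alpha>\<^esup> h1 + h2\<close> with \<open>h1\<close> and \<open>h2\<close> of
  this kind, and \<open>f x\<close> would be within \<open>2 \<delta>\<close> of \<open>F h1\<close>. So the points \<open>x\<close> with \<open>f x\<close> in \<open>B\<close> are separated from
  the good samples.
\<close>

lemma upper_probability_bound:
  assumes ii: "\<And>\<delta> r::real. 0 < \<delta> \<Longrightarrow> 0 < r \<Longrightarrow>
      \<exists>t :: nat \<Rightarrow> real.
        (\<forall>n\<in>N. 0 \<le> t n \<and>
           upper_expectation (M n)
             (\<lambda>\<omega>. SUP h \<in> {h \<in> Rn n. lp_norm 2 n h \<le> t n}.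
                local_osc \<alpha> n (r * v n powr (1 / \<alpha>)) (f n) (X n \<omega>) h) \<le> ennreal \<delta>) \<and>
        (\<alpha> \<noteq> 1 \<longrightarrow>
           (\<forall>\<^sub>F n in along N. 0 < ln ((t n)\<^sup>2 / v n)) \<and>
           (\<lambda>n. ln (real n) powr (\<alpha> / 2)) \<in> o[along N](\<lambda>n. ln ((t n)\<^sup>2 / v n))) \<and>
        (\<alpha> = 1 \<longrightarrow> v \<in> o[along N](\<lambda>n. (t n)\<^sup>2))"
    and eps: "0 < \<epsilon>" "\<epsilon> < 1" and tau: "0 < \<tau>" and delta: "0 < \<delta>" and B: "B \<in> sets borel"
    and far: "\<And>n h b. n \<in> N \<Longrightarrow> h \<in> Rn n \<Longrightarrow> (\<Sum>i<n. \<bar>h i\<bar> powr \<alpha>) \<le> \<tau> \<Longrightarrow> b \<in> B \<Longrightarrow> 2 * \<delta> < \<bar>F n h - b\<bar>"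
  shows "\<forall>\<^sub>F n in along N. measure (M n) {\<omega> \<in> space (M n). f n (X n \<omega>) \<in> B} \<le> 2 * exp (- ((1 - \<epsilon>) * \<tau> * v n))"
proof -
  define r where "r = \<tau> powr (1 / \<alpha>)"
  have r: "0 < r" "r powr \<alpha> = \<tau>" using tau alpha by (simp_all add: r_def powr_powr)
  have "0 < \<delta> * (1 / 8)" using delta by simp
  from ii[OF this r(1)] obtain t where t0: "\<And>n. n \<in> N \<Longrightarrow> 0 \<le> t n"
    and tE: "\<And>n. n \<in> N \<Longrightarrow> upper_expectation (M n)
             (\<lambda>\<omega>. SUP h \<in> {h \<in> Rn n. lp_norm 2 n h \<le> t n}.
                local_osc \<alpha> n (r * v n powr (1 / \<alpha>)) (f n) (X n \<omega>) h) \<le> ennreal (\<delta> * (1 / 8))"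
    and g1: "\<alpha> \<noteq> 1 \<Longrightarrow> \<forall>\<^sub>F n in along N. 0 < ln ((t n)\<^sup>2 / v n)"
    and g2: "\<alpha> \<noteq> 1 \<Longrightarrow> (\<lambda>n. ln (real n) powr (\<alpha> / 2)) \<in> o[along N](\<lambda>n. ln ((t n)\<^sup>2 / v n))"
    and g3: "\<alpha> = 1 \<Longrightarrow> v \<in> o[along N](\<lambda>n. (t n)\<^sup>2)"
    by (elim exE conjE) (rule that, auto)
  obtain \<theta> where th: "0 < \<theta>" "\<theta> < 1"
    and dich: "\<forall>\<^sub>F n in along N. \<exists>D B. 0 \<le> D \<and> D * (\<tau> * v n) \<le> (t n)\<^sup>2 \<and> B \<in> sets borel \<and>
       measure (mu_prod \<alpha> n) {x \<in> Rn n. \<exists>i<n. x i \<in> B} < 1 / 8 \<and>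
       (\<forall>x y. 0 \<le> x \<longrightarrow> 0 \<le> y \<longrightarrow> y \<notin> B \<longrightarrow>
          (1 - \<epsilon>) * \<bar>x - y\<bar> powr \<alpha> \<le> ln (kern \<theta> (mu_pot \<alpha> x - mu_pot \<alpha> y)) \<or>
          (x - y)\<^sup>2 \<le> D * ln (kern \<theta> (mu_pot \<alpha> x - mu_pot \<alpha> y)))"
    by (rule eventually_coordinate_dichotomy[OF alpha eps tau speed g1 g2 g3]) (assumption | rule that)+
  have ev1: "\<forall>\<^sub>F n in along N. \<exists>A\<in>sets (M n). {\<omega> \<in> space (M n). ennreal \<delta> < (SUP h \<in> vscale n r ` lp_ball \<alpha> n.
           ennreal \<bar>f n (vadd n (X n \<omega>) (vscale n (v n powr (1 / \<alpha>)) h)) - F n h\<bar>)} \<subseteq> A \<and> emeasure (M n) A < ennreal (1 / 8)"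
    by (rule tends_to_zero_in_prob_event[OF i[OF r(1)] delta]) simp
  show ?thesis using dich ev1 eventually_mem_along eventually_speed_pos
  proof eventually_elim
    case (elim n)
    then have n: "n \<in> N" and v: "0 < v n" by auto
    interpret P: prob_space "M n" by (rule prob[OF n])
    define q where "q = v n powr (1 / \<alpha>)"
    obtain D B' where D: "0 \<le> D" "D * (\<tau> * v n) \<le> (t n)\<^sup>2" and B': "B' \<in> sets borel"
       "measure (mu_prod \<alpha> n) {x \<in> Rn n. \<exists>i<n. x i \<in> B'} < 1 / 8"
      and dich: "\<And>x y. 0 \<le> x \<Longrightarrow> 0 \<le> y \<Longrightarrow> y \<notin> B' \<Longrightarrow>
          (1 - \<epsilon>) * \<bar>x - y\<bar> powr \<alpha> \<le> ln (kern \<theta> (mu_pot \<alpha> x - mu_pot \<alpha> y)) \<or>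
          (x - y)\<^sup>2 \<le> D * ln (kern \<theta> (mu_pot \<alpha> x - mu_pot \<alpha> y))"
      using elim(1) by blast
    obtain N1 where N1: "N1 \<in> sets (M n)" "emeasure (M n) N1 < ennreal (1 / 8)"
      "{\<omega> \<in> space (M n). ennreal \<delta> < (SUP h \<in> vscale n r ` lp_ball \<alpha> n.
           ennreal \<bar>f n (vadd n (X n \<omega>) (vscale n q h)) - F n h\<bar>)} \<subseteq> N1"
      using elim(2) unfolding q_def by blast
    obtain N2 where N2: "N2 \<in> sets (M n)" "emeasure (M n) N2 \<le> ennreal (2 * (1 / 8))"
      "\<And>\<omega>. \<omega> \<in> space (M n) - N2 \<Longrightarrow> (SUP h \<in> {h \<in> Rn n. lp_norm 2 n h \<le> t n}.
                local_osc \<alpha> n (r * q) (f n) (X n \<omega>) h) \<le> ennreal \<delta>"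
      using upper_expectation_event[OF tE[OF n] delta] unfolding q_def by auto
    define W where "W A = {\<omega> \<in> space (M n). X n \<omega> \<in> {x \<in> Rn n. \<exists>i<n. x i \<in> A}}" for A :: "real set"
    have Wm: "W A \<in> sets (M n)" if "A \<in> sets borel" for A
      using measurable_sets[OF X_rv[OF n] coordinate_event_measurable[OF that]]
      by (simp add: W_def vimage_def Int_def conj_commute)
    have WP: "measure (M n) (W A) = measure (mu_prod \<alpha> n) {x \<in> Rn n. \<exists>i<n. x i \<in> A}" if "A \<in> sets borel" for A
      unfolding W_def by (rule measure_eq_mu_prod[OF n coordinate_event_measurable[OF that], symmetric])
    \<comment> \<open>The probabilities of the four parts are at most \<open>1/8\<close>, \<open>1/4\<close>, \<open>1/8\<close> and \<open>0\<close>.\<close>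
    define bad where "bad = N1 \<union> N2 \<union> W B' \<union> W {..<0}"
    have badm: "bad \<in> sets (M n)" unfolding bad_def using N1 N2 Wm[OF B'(1)] Wm[of "{..<0}"] by auto
    have m1: "measure (M n) N1 < 1 / 8" using N1(2) by (simp add: P.emeasure_eq_measure ennreal_less_iff)
    have m2: "measure (M n) N2 \<le> 1 / 4" using N2(2) by (simp add: P.emeasure_eq_measure)
    have m3: "measure (M n) (W B') < 1 / 8" using WP[OF B'(1)] B'(2) by simp
    have m4: "measure (M n) (W {..<0}) \<le> 0" using WP[of "{..<0}"] 
      mu_prod_coordinate_union_bound[OF alpha, of "{..<0}" n] measure_mu_neg[OF alpha] by simp
    have "measure (M n) bad \<le> measure (M n) N1 + measure (M n) N2 + measure (M n) (W B') + measure (M n) (W {..<0})"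
      unfolding bad_def using N1(1) N2(1) Wm[OF B'(1)] Wm[of "{..<0}"]
      by (intro order_trans[OF measure_Un_le] add_mono order_refl) auto
    then have mb: "measure (M n) bad \<le> 1 / 2" using m1 m2 m3 m4 by linarith
    define E where "E = space (M n) - bad"
    have E: "E \<in> sets (M n)" "1 / 2 \<le> measure (M n) E"
      unfolding E_def using badm P.prob_compl[OF badm] mb by auto
    define C where "C = f n -` B \<inter> space (borel_Rn n)"
    have C: "C \<in> sets (borel_Rn n)" unfolding C_def by (rule measurable_sets[OF f_meas[OF n] B])
    have "measure (M n) {\<omega> \<in> space (M n). X n \<omega> \<in> C} \<le> 2 * exp (- ((1 - \<epsilon>) * \<tau> * v n))"
    proof (rule prob_le_of_separated[OF alpha th prob[OF n] X_rv[OF n] X_law[OF n] C E])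
      fix \<omega> x assume w: "\<omega> \<in> E" and x: "x \<in> C" "x \<in> Rn_nonneg n"
      define c where "c j = ln (kern \<theta> (mu_pot \<alpha> (x j) - mu_pot \<alpha> (X n \<omega> j)))" for j
      have prod: "(\<Prod>j<n. kern \<theta> (mu_pot \<alpha> (x j) - mu_pot \<alpha> (X n \<omega> j))) = exp (\<Sum>j<n. c j)"
        unfolding c_def by (simp add: exp_sum kern_pos[OF th])
      have ws: "\<omega> \<in> space (M n)" "\<omega> \<notin> N1" "\<omega> \<notin> N2" "\<omega> \<notin> W B'" "\<omega> \<notin> W {..<0}"
        using w by (auto simp: E_def bad_def)
      have XR: "X n \<omega> \<in> Rn n" using measurable_space[OF X_rv[OF n] ws(1)] by (simp add: space_PiM)
      have Xp: "0 \<le> X n \<omega> j" "X n \<omega> j \<notin> B'" if "j < n" for j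
      proof -
        have "\<forall>i<n. X n \<omega> i \<notin> B'" "\<forall>i<n. \<not> X n \<omega> i < 0" using ws XR by (auto simp: W_def)
        then show "0 \<le> X n \<omega> j" "X n \<omega> j \<notin> B'" using that by (auto simp: not_less)
      qed
      have xR: "x \<in> Rn n" "\<And>j. j < n \<Longrightarrow> 0 \<le> x j" using x(2) by (auto simp: Rn_nonneg_def)
      show "exp ((1 - \<epsilon>) * \<tau> * v n) \<le> (\<Prod>j<n. kern \<theta> (mu_pot \<alpha> (x j) - mu_pot \<alpha> (X n \<omega> j)))"
      proof (rule ccontr)
        assume "\<not> ?thesis"
        then have cs: "(\<Sum>j<n. c j) \<le> (1 - \<epsilon>) * \<tau> * v n" unfolding prod by simp
        have "D * ((1 - \<epsilon>) * \<tau> * v n) \<le> D * (\<tau> * v n)"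
          using D(1) eps tau v by (intro mult_left_mono) (auto simp: algebra_simps)
        also note D(2)
        finally have Dt: "D * ((1 - \<epsilon>) * \<tau> * v n) \<le> (t n)\<^sup>2" .
        have c0: "0 \<le> c j" for j unfolding c_def by (rule ln_kern_nonneg[OF th])
        have cd: "(1 - \<epsilon>) * \<bar>x j - X n \<omega> j\<bar> powr \<alpha> \<le> c j \<or> (x j - X n \<omega> j)\<^sup>2 \<le> D * c j" if "j < n" for j
          unfolding c_def by (rule dich[OF xR(2)[OF that] Xp[OF that]])
        obtain h1 h2 where h1: "h1 \<in> Rn n" "(\<Sum>i<n. \<bar>h1 i\<bar> powr \<alpha>) \<le> \<tau>"
          and h2: "h2 \<in> Rn n" "lp_norm 2 n h2 \<le> t n"
          and xeq: "x = vadd n (vadd n (X n \<omega>) (vscale n q h1)) h2"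
          unfolding q_def
          by (rule cheap_displacement_split[OF alpha eps(2) v tau t0[OF n] D(1) xR(1) XR c0 cs cd Dt])
             (assumption | rule that)+
        have hb: "h1 \<in> vscale n r ` lp_ball \<alpha> n"
          using h1 r alpha by (intro mem_scaled_lp_ball) auto
        let ?z = "vadd n (X n \<omega>) (vscale n q h1)"
        have "\<bar>f n ?z - F n h1\<bar> \<le> \<delta>"
          by (rule not_less_SUP_ennreal_abs[OF _ hb]) (use N1(3) ws delta in auto)
        moreover have "\<bar>f n (vadd n ?z h2) - f n ?z\<bar> \<le> \<delta>"
        proof -
          obtain b where b: "b \<in> lp_ball \<alpha> n" "h1 = vscale n r b" using hb by blast
          have z: "?z \<in> vadd n (X n \<omega>) ` vscale n (r * q) ` lp_ball \<alpha> n"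
            unfolding b(2) vscale_vscale using b(1) by (auto simp: mult.commute)
          have "ennreal \<bar>f n (vadd n ?z h2) - f n ?z\<bar> \<le> local_osc \<alpha> n (r * q) (f n) (X n \<omega>) h2"
            unfolding local_osc_def by (rule SUP_upper[OF z])
          also have "\<dots> \<le> (SUP h \<in> {h \<in> Rn n. lp_norm 2 n h \<le> t n}. local_osc \<alpha> n (r * q) (f n) (X n \<omega>) h)"
            by (rule SUP_upper) (use h2 in auto)
          also have "\<dots> \<le> ennreal \<delta>" by (rule N2(3)) (use ws in auto)
          finally show ?thesis using delta by simp
        qed
        ultimately have "\<bar>F n h1 - f n x\<bar> \<le> 2 * \<delta>" unfolding xeq by linarith
        moreover have "f n x \<in> B" using x(1) by (simp add: C_def)
        ultimately show False using far[OF n h1, of "f n x"] by linarith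
      qed
    qed
    moreover have "{\<omega> \<in> space (M n). X n \<omega> \<in> C} = {\<omega> \<in> space (M n). f n (X n \<omega>) \<in> B}"
      using measurable_space[OF X_rv[OF n]] by (auto simp: C_def)
    ultimately show ?case by simp
  qed
qed

text \<open>
  Translate the good samples by \<open>v\<^bsup>1/\<alpha>\<^esup> h\<close>, where \<open>h\<close> has nonnegative coordinates and almost optimal norm.
  The translation costs at most a factor \<open>exp (- \<tau> v)\<close> and brings \<open>f\<close> close to \<open>F h\<close>.
\<close>

lemma lower_probability_bound:
  assumes tau: "0 < \<tau>" and delta: "0 < \<delta>"
    and h: "\<forall>\<^sub>F n in along N. \<exists>h\<in>Rn_nonneg n. \<bar>F n h - x\<bar> < \<delta> \<and> (\<Sum>i<n. \<bar>h i\<bar> powr \<alpha>) \<le> \<tau>"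
    and B: "B \<in> sets borel" "ball x (2 * \<delta>) \<subseteq> B"
  shows "\<forall>\<^sub>F n in along N. exp (- (\<tau> * v n)) / 2 \<le> measure (M n) {\<omega> \<in> space (M n). f n (X n \<omega>) \<in> B}"
proof -
  define r where "r = \<tau> powr (1 / \<alpha>)"
  have r: "0 < r" "r powr \<alpha> = \<tau>" using tau alpha by (simp_all add: r_def powr_powr)
  have ev1: "\<forall>\<^sub>F n in along N. \<exists>A\<in>sets (M n). {\<omega> \<in> space (M n). ennreal (\<delta> / 2) < (SUP h \<in> vscale n r ` lp_ball \<alpha> n.
           ennreal \<bar>f n (vadd n (X n \<omega>) (vscale n (v n powr (1 / \<alpha>)) h)) - F n h\<bar>)} \<subseteq> A \<and> emeasure (M n) A < ennreal (1 / 2)"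
    by (rule tends_to_zero_in_prob_event[OF i[OF r(1)]]) (use delta in auto)
  show ?thesis using h ev1 eventually_mem_along eventually_speed_pos
  proof eventually_elim
    case (elim n)
    then have n: "n \<in> N" and v: "0 < v n" by auto
    interpret P: prob_space "M n" by (rule prob[OF n])
    interpret Q: prob_space "mu_prod \<alpha> n" by (rule mu_prod_prob_space[OF alpha])
    define q where "q = v n powr (1 / \<alpha>)"
    have q: "0 < q" "q powr \<alpha> = v n" using v alpha by (simp_all add: q_def powr_powr)
    obtain h where h: "h \<in> Rn_nonneg n" "\<bar>F n h - x\<bar> < \<delta>" "(\<Sum>i<n. \<bar>h i\<bar> powr \<alpha>) \<le> \<tau>"
      using elim(1) by blast
    have hR: "h \<in> Rn n" "\<And>i. i < n \<Longrightarrow> 0 \<le> h i" using h(1) by (auto simp: Rn_nonneg_def)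
    have hb: "h \<in> vscale n r ` lp_ball \<alpha> n" using hR(1) h(3) r alpha by (intro mem_scaled_lp_ball) auto
    obtain N1 where N1: "N1 \<in> sets (M n)" "emeasure (M n) N1 < ennreal (1 / 2)"
      "{\<omega> \<in> space (M n). ennreal (\<delta> / 2) < (SUP h \<in> vscale n r ` lp_ball \<alpha> n.
           ennreal \<bar>f n (vadd n (X n \<omega>) (vscale n q h)) - F n h\<bar>)} \<subseteq> N1"
      using elim(2) unfolding q_def by blast
    have m1: "measure (M n) N1 < 1 / 2" using N1(2) unfolding P.emeasure_eq_measure by (subst (asm) ennreal_less_iff) auto
    define C where "C = f n -` B \<inter> space (borel_Rn n)"
    have C: "C \<in> sets (borel_Rn n)" unfolding C_def by (rule measurable_sets[OF f_meas[OF n] B(1)])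
    define k where "k = vscale n q h"
    have vm: "(\<lambda>y. vadd n y k) \<in> borel_Rn n \<rightarrow>\<^sub>M borel_Rn n" unfolding vadd_def by measurable
    define A where "A = (\<lambda>y. vadd n y k) -` C \<inter> space (borel_Rn n)"
    have A: "A \<in> sets (borel_Rn n)" unfolding A_def by (rule measurable_sets[OF vm C])
    have "space (M n) - N1 \<subseteq> {\<omega> \<in> space (M n). X n \<omega> \<in> A}"
    proof
      fix \<omega> assume w: "\<omega> \<in> space (M n) - N1"
      have XR: "X n \<omega> \<in> space (borel_Rn n)" using measurable_space[OF X_rv[OF n]] w by auto
      have "\<bar>f n (vadd n (X n \<omega>) k) - F n h\<bar> \<le> \<delta> / 2"
        unfolding k_def by (rule not_less_SUP_ennreal_abs[OF _ hb]) (use N1(3) w delta in auto)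
      then have "\<bar>f n (vadd n (X n \<omega>) k) - x\<bar> < 2 * \<delta>" using h(2) delta by linarith
      then have "f n (vadd n (X n \<omega>) k) \<in> B" using B(2) by (auto simp: dist_real_def abs_minus_commute)
      then show "\<omega> \<in> {\<omega> \<in> space (M n). X n \<omega> \<in> A}"
        using w XR measurable_space[OF vm XR] by (auto simp: A_def C_def)
    qed
    then have "measure (M n) (space (M n) - N1) \<le> measure (M n) {\<omega> \<in> space (M n). X n \<omega> \<in> A}"
      using measurable_sets[OF X_rv[OF n] A] by (intro P.finite_measure_mono) (auto simp: vimage_def Int_def conj_commute)
    then have mA: "1 / 2 \<le> measure (mu_prod \<alpha> n) A"
      using P.prob_compl[OF N1(1)] m1 measure_eq_mu_prod[OF n A] by linarith
    have ks: "(\<Sum>i<n. k i powr \<alpha>) \<le> \<tau> * v n"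
    proof -
      have "(\<Sum>i<n. k i powr \<alpha>) = v n * (\<Sum>i<n. \<bar>h i\<bar> powr \<alpha>)"
        unfolding sum_distrib_left using q hR by (intro sum.cong refl) (auto simp: k_def vscale_def powr_mult)
      also have "\<dots> \<le> v n * \<tau>" using h(3) v by (intro mult_left_mono) auto
      finally show ?thesis by (simp add: mult.commute)
    qed
    have "ennreal (exp (- (\<Sum>i<n. k i powr \<alpha>))) * (\<integral>\<^sup>+y. indicator C (vadd n y k) \<partial>mu_prod \<alpha> n) \<le> (\<integral>\<^sup>+y. indicator C y \<partial>mu_prod \<alpha> n)"
      by (rule mu_prod_shift[OF alpha])
         (use C hR q in \<open>auto simp: measurable_cong_sets[OF sets_mu_prod refl] k_def vscale_def\<close>)
    also have "(\<integral>\<^sup>+y. indicator C (vadd n y k) \<partial>mu_prod \<alpha> n) = (\<integral>\<^sup>+y. indicator A y \<partial>mu_prod \<alpha> n)"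
      by (intro nn_integral_cong) (auto simp: A_def indicator_def space_mu_prod space_PiM)
    finally have "ennreal (exp (- (\<Sum>i<n. k i powr \<alpha>))) * ennreal (measure (mu_prod \<alpha> n) A) \<le> ennreal (measure (mu_prod \<alpha> n) C)"
      using A C by (simp add: sets_mu_prod Q.emeasure_eq_measure)
    then have "exp (- (\<Sum>i<n. k i powr \<alpha>)) * measure (mu_prod \<alpha> n) A \<le> measure (mu_prod \<alpha> n) C"
      by (simp add: ennreal_mult'[symmetric])
    moreover have "exp (- (\<tau> * v n)) * (1 / 2) \<le> exp (- (\<Sum>i<n. k i powr \<alpha>)) * measure (mu_prod \<alpha> n) A"
      using ks mA by (intro mult_mono) auto
    moreover have "{\<omega> \<in> space (M n). X n \<omega> \<in> C} = {\<omega> \<in> space (M n). f n (X n \<omega>) \<in> B}"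
      using measurable_space[OF X_rv[OF n]] by (auto simp: C_def)
    ultimately show ?case using measure_eq_mu_prod[OF n C] by simp
  qed
qed

end

section \<open>The rate function\<close>

context
  fixes \<alpha> :: real and F :: "nat \<Rightarrow> (nat \<Rightarrow> real) \<Rightarrow> real" and N :: "nat set"
  assumes alpha: "0 < \<alpha>"
begin

lemma I_rate_nonneg: "0 \<le> I_rate \<alpha> F N x"
proof -
  have "0 \<le> (INF n\<in>N. I_loc \<alpha> F n 1 x)"
    unfolding I_loc_def by (intro INF_greatest) simp
  also have "\<dots> \<le> I_rate \<alpha> F N x"
    unfolding I_rate_def by (rule SUP_upper) simp
  finally show ?thesis .
qed

lemma I_rate_le:
  assumes "\<And>e. 0 < e \<Longrightarrow> \<exists>n\<in>N. \<exists>h\<in>Rn n. \<bar>F n h - x\<bar> < e \<and> (\<Sum>i<n. \<bar>h i\<bar> powr \<alpha>) \<le> \<tau>"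
  shows "I_rate \<alpha> F N x \<le> ereal \<tau>"
  unfolding I_rate_def
proof (rule SUP_least)
  fix e :: real assume "e \<in> {0<..}"
  then obtain n h where n: "n \<in> N" "h \<in> Rn n" "\<bar>F n h - x\<bar> < e" "(\<Sum>i<n. \<bar>h i\<bar> powr \<alpha>) \<le> \<tau>"
    using assms[of e] by auto
  have "I_loc \<alpha> F n e x \<le> ereal (lp_norm \<alpha> n h powr \<alpha>)"
    unfolding I_loc_def by (rule INF_lower) (use n in auto)
  also have "\<dots> \<le> ereal \<tau>" using n(4) by (simp add: lp_norm_powr[OF alpha])
  finally show "(INF n\<in>N. I_loc \<alpha> F n e x) \<le> ereal \<tau>" by (rule INF_lower2[OF n(1)])
qed

lemma I_rate_lessD:
  assumes "I_rate \<alpha> F N x < ereal \<tau>" "0 < e"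
  shows "\<exists>n\<in>N. \<exists>h\<in>Rn n. \<bar>F n h - x\<bar> < e \<and> (\<Sum>i<n. \<bar>h i\<bar> powr \<alpha>) < \<tau>"
proof -
  have "(INF n\<in>N. I_loc \<alpha> F n e x) \<le> I_rate \<alpha> F N x"
    unfolding I_rate_def by (rule SUP_upper) (use assms in auto)
  then have "(INF n\<in>N. I_loc \<alpha> F n e x) < ereal \<tau>" using assms(1) by simp
  then show ?thesis unfolding I_loc_def by (auto simp: INF_less_iff lp_norm_powr[OF alpha])
qed

text \<open>
  A ball around a nearby point \<open>z\<close> of half the radius is contained in the ball around \<open>x\<close>.
\<close>

lemma I_rate_eventually_gt:
  assumes "y < I_rate \<alpha> F N x"
  obtains d where "0 < d" "\<And>z. \<bar>z - x\<bar> < d \<Longrightarrow> y < I_rate \<alpha> F N z"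
proof -
  obtain e where e: "0 < e" "y < (INF n\<in>N. I_loc \<alpha> F n e x)"
    using assms unfolding I_rate_def less_SUP_iff by auto
  show ?thesis
  proof (rule that[of "e / 2"])
    fix z assume z: "\<bar>z - x\<bar> < e / 2"
    have "(INF n\<in>N. I_loc \<alpha> F n e x) \<le> (INF n\<in>N. I_loc \<alpha> F n (e / 2) z)"
    proof (rule INF_mono')
      fix n
      show "I_loc \<alpha> F n e x \<le> I_loc \<alpha> F n (e / 2) z"
        unfolding I_loc_def
      proof (rule INF_superset_mono)
        show "{h \<in> Rn n. \<bar>F n h - z\<bar> < e / 2} \<subseteq> {h \<in> Rn n. \<bar>F n h - x\<bar> < e}"
        proof safe
          fix h assume "\<bar>F n h - z\<bar> < e / 2"
          then show "\<bar>F n h - x\<bar> < e" using z by linarith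
        qed
      qed simp
    qed
    also have "\<dots> \<le> I_rate \<alpha> F N z" unfolding I_rate_def by (rule SUP_upper) (use e in auto)
    finally show "y < I_rate \<alpha> F N z" using e(2) by simp
  qed (use e in simp)
qed

lemma I_rate_lower_semicont: "lower_semicont (I_rate \<alpha> F N)"
  unfolding lower_semicont_def le_Liminf_iff
proof (intro allI impI)
  fix x y assume "y < I_rate \<alpha> F N x"
  then obtain d where "0 < d" "\<And>z. \<bar>z - x\<bar> < d \<Longrightarrow> y < I_rate \<alpha> F N z"
    by (rule I_rate_eventually_gt) blast
  then show "\<forall>\<^sub>F z in at x. y < I_rate \<alpha> F N z"
    unfolding eventually_at by (auto simp: dist_real_def)
qed

context
  assumes iii: "\<And>r::real. 0 < r \<Longrightarrow> compact (closure (\<Union>n\<in>N. F n ` vscale n r ` lp_ball \<alpha> n))"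
begin

lemma F_bounded_sublevel_compact:
  assumes "0 < \<tau>"
  obtains K where "compact K" "\<And>n h. n \<in> N \<Longrightarrow> h \<in> Rn n \<Longrightarrow> (\<Sum>i<n. \<bar>h i\<bar> powr \<alpha>) \<le> \<tau> \<Longrightarrow> F n h \<in> K"
proof -
  define r where "r = \<tau> powr (1 / \<alpha>)"
  have r: "0 < r" "r powr \<alpha> = \<tau>" using assms alpha by (simp_all add: r_def powr_powr)
  show ?thesis
  proof (rule that[OF iii[OF r(1)]])
    fix n h assume n: "n \<in> N" "h \<in> Rn n" "(\<Sum>i<n. \<bar>h i\<bar> powr \<alpha>) \<le> \<tau>"
    have "h \<in> vscale n r ` lp_ball \<alpha> n" using n r alpha by (intro mem_scaled_lp_ball) auto
    then show "F n h \<in> closure (\<Union>n\<in>N. F n ` vscale n r ` lp_ball \<alpha> n)"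
      using n(1) by (intro subsetD[OF closure_subset]) blast
  qed
qed

lemma I_rate_good: "good_rate (I_rate \<alpha> F N)"
  unfolding good_rate_def
proof (intro allI impI)
  fix t :: real assume t: "0 \<le> t"
  let ?S = "{x. I_rate \<alpha> F N x \<le> ereal t}"
  have "open (- ?S)"
    unfolding open_dist
  proof
    fix x assume "x \<in> - ?S"
    then have "ereal t < I_rate \<alpha> F N x" by auto
    then obtain d where "0 < d" "\<And>z. \<bar>z - x\<bar> < d \<Longrightarrow> ereal t < I_rate \<alpha> F N z"
      by (rule I_rate_eventually_gt) blast
    then show "\<exists>e>0. \<forall>y. dist y x < e \<longrightarrow> y \<in> - ?S" by (auto simp: dist_real_def not_le)
  qed
  then have cl: "closed ?S" by (simp add: closed_def)
  obtain K where K: "compact K" "\<And>n h. n \<in> N \<Longrightarrow> h \<in> Rn n \<Longrightarrow> (\<Sum>i<n. \<bar>h i\<bar> powr \<alpha>) \<le> t + 1 \<Longrightarrow> F n h \<in> K"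
    using F_bounded_sublevel_compact[of "t + 1"] t by auto
  have "?S \<subseteq> K"
  proof
    fix x assume "x \<in> ?S"
    then have "I_rate \<alpha> F N x < ereal (t + 1)"
      by (auto intro: order.strict_trans1)
    then have "\<forall>e>0. \<exists>y\<in>K. dist y x < e"
      using I_rate_lessD[of x "t + 1"] K(2) by (metis dist_real_def less_imp_le)
    then have "x \<in> closure K" by (simp add: closure_approachable)
    then show "x \<in> K" using K(1) by (simp add: compact_imp_closed)
  qed
  then show "compact ?S" using compact_Int_closed[OF K(1) cl] by (simp add: Int_absorb1)
qed

text \<open>
  Otherwise there are \<open>h\<close> with norm at most \<open>\<tau>\<close> and values \<open>F n h\<close> arbitrarily close to \<open>B\<close>. By compactness these values
  accumulate at a point of \<open>B\<close>, where the rate function is then at most \<open>\<tau>\<close>.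
\<close>

lemma uniformly_far_from_closed_set:
  assumes B: "closed B" and tau: "0 < \<tau>" "ereal \<tau> < (INF x\<in>B. I_rate \<alpha> F N x)"
  obtains d where "0 < d"
    "\<And>n h b. n \<in> N \<Longrightarrow> h \<in> Rn n \<Longrightarrow> (\<Sum>i<n. \<bar>h i\<bar> powr \<alpha>) \<le> \<tau> \<Longrightarrow> b \<in> B \<Longrightarrow> 2 * d < \<bar>F n h - b\<bar>"
proof (rule ccontr)
  assume neg: "\<not> thesis"
  note witness = that
  have "\<exists>n h b. n \<in> N \<and> h \<in> Rn n \<and> (\<Sum>i<n. \<bar>h i\<bar> powr \<alpha>) \<le> \<tau> \<and> b \<in> B \<and> \<bar>F n h - b\<bar> \<le> 2 * d" if "0 < d" for d
    using neg witness[OF that] by (meson linorder_not_le)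
  then have "\<forall>k::nat. \<exists>n h b. n \<in> N \<and> h \<in> Rn n \<and> (\<Sum>i<n. \<bar>h i\<bar> powr \<alpha>) \<le> \<tau> \<and> b \<in> B \<and> \<bar>F n h - b\<bar> \<le> 2 * inverse (real (Suc k))"
    by simp
  then obtain nn hh bb where k: "\<And>k::nat. nn k \<in> N" "\<And>k. hh k \<in> Rn (nn k)" "\<And>k. (\<Sum>i<nn k. \<bar>hh k i\<bar> powr \<alpha>) \<le> \<tau>"
    "\<And>k. bb k \<in> B" "\<And>k. \<bar>F (nn k) (hh k) - bb k\<bar> \<le> 2 * inverse (real (Suc k))"
    by metis
  obtain K where K: "compact K" "\<And>n h. n \<in> N \<Longrightarrow> h \<in> Rn n \<Longrightarrow> (\<Sum>i<n. \<bar>h i\<bar> powr \<alpha>) \<le> \<tau> \<Longrightarrow> F n h \<in> K"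
    using F_bounded_sublevel_compact[OF tau(1)] by blast
  define z where "z k = F (nn k) (hh k)" for k
  have "\<forall>k. z k \<in> K" using K(2) k(1-3) by (simp add: z_def)
  then obtain l s where s: "strict_mono s" "(z \<circ> s) \<longlonglongrightarrow> l"
    using K(1) unfolding compact_eq_seq_compact_metric seq_compact_def by metis
  have "(\<lambda>k. 2 * inverse (real (Suc k))) \<longlonglongrightarrow> 2 * 0" by (intro tendsto_intros LIMSEQ_inverse_real_of_nat)
  then have lim0: "(\<lambda>k. 2 * inverse (real (Suc k))) \<longlonglongrightarrow> 0" by simp
  have "norm (z k - bb k) \<le> 2 * inverse (real (Suc k))" for k using k(5)[of k] by (simp only: z_def real_norm_def)
  then have "(\<lambda>k. z k - bb k) \<longlonglongrightarrow> 0"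
    by (intro Lim_null_comparison[OF _ lim0] always_eventually allI)
  then have "((\<lambda>k. z k - bb k) \<circ> s) \<longlonglongrightarrow> 0" using s(1) by (rule LIMSEQ_subseq_LIMSEQ)
  then have "(\<lambda>k. (z \<circ> s) k - ((\<lambda>k. z k - bb k) \<circ> s) k) \<longlonglongrightarrow> l - 0" using s(2) by (intro tendsto_diff)
  then have "(\<lambda>k. bb (s k)) \<longlonglongrightarrow> l" by (simp add: o_def)
  then have "l \<in> B" using B k(4) by (meson closed_sequentially)
  moreover have "I_rate \<alpha> F N l \<le> ereal \<tau>"
  proof (rule I_rate_le)
    fix e :: real assume "0 < e"
    then have "\<forall>\<^sub>F k in sequentially. dist ((z \<circ> s) k) l < e" using s(2) by (rule tendstoD[rotated])
    then obtain k0 where "dist (z (s k0)) l < e" unfolding eventually_sequentially by auto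
    then show "\<exists>n\<in>N. \<exists>h\<in>Rn n. \<bar>F n h - l\<bar> < e \<and> (\<Sum>i<n. \<bar>h i\<bar> powr \<alpha>) \<le> \<tau>"
      using k(1-3) by (auto simp: z_def dist_real_def intro!: bexI[of _ "nn (s k0)"] bexI[of _ "hh (s k0)"])
  qed
  moreover have "(INF x\<in>B. I_rate \<alpha> F N x) \<le> I_rate \<alpha> F N l" by (rule INF_lower) fact
  ultimately show False using tau(2) by (meson leD order_trans)
qed

end

end

section \<open>The large deviation principle\<close>

lemma scaled_eln_le:
  assumes v: "0 < v" and m: "0 \<le> m" "m \<le> 2 * exp (- (s * v))"
  shows "ereal (1 / v) * eln m \<le> ereal (ln 2 / v - s)"
proof (cases "m = 0")
  case True then show ?thesis using v by (simp add: eln_def)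
next
  case False
  then have "0 < m" using m by simp
  then have "ln m \<le> ln (2 * exp (- (s * v)))" using m by (intro ln_mono) auto
  then have "ln m \<le> ln 2 - s * v" by (simp add: ln_mult)
  then have "1 / v * ln m \<le> 1 / v * (ln 2 - s * v)" using v by (intro mult_left_mono) auto
  then show ?thesis using False v by (simp add: eln_def field_simps)
qed

lemma scaled_eln_ge:
  assumes v: "0 < v" and m: "exp (- (s * v)) / 2 \<le> m"
  shows "ereal (- s - ln 2 / v) \<le> ereal (1 / v) * eln m"
proof -
  have m0: "0 < m" using m by (smt (verit) exp_gt_zero half_gt_zero)
  have "ln (exp (- (s * v)) / 2) \<le> ln m" using m by (intro ln_mono) auto
  then have "- (s * v) - ln 2 \<le> ln m" by (simp add: ln_div)
  then have "1 / v * (- (s * v) - ln 2) \<le> 1 / v * ln m" using v by (intro mult_left_mono) auto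
  then show ?thesis using m0 v by (simp add: eln_def field_simps)
qed

lemma eventually_ln2_div_speed_less:
  fixes v :: "'b \<Rightarrow> real"
  assumes "filterlim v at_top F" "0 < d"
  shows "\<forall>\<^sub>F n in F. 0 < v n \<and> ln 2 / v n < d"
proof -
  have "\<forall>\<^sub>F n in F. max 0 (ln 2 / d) < v n" using assms(1) unfolding filterlim_at_top_dense by blast
  then show ?thesis
  proof eventually_elim
    case (elim n)
    then have "0 < v n" "ln 2 / d < v n" by simp_all
    then show ?case using assms(2) by (simp add: field_simps)
  qed
qed

theorem theorem2p3:
  fixes \<alpha> :: real and N :: "nat set"
    and M :: "nat \<Rightarrow> 'a measure" and X :: "nat \<Rightarrow> 'a \<Rightarrow> (nat \<Rightarrow> real)"
    and f F :: "nat \<Rightarrow> (nat \<Rightarrow> real) \<Rightarrow> real" and v :: "nat \<Rightarrow> real"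
  assumes alpha: "0 < \<alpha>" "\<alpha> \<le> 1"
    and N_infinite: "infinite N"
    and prob: "\<And>n. n \<in> N \<Longrightarrow> prob_space (M n)"
    and X_rv: "\<And>n. n \<in> N \<Longrightarrow> X n \<in> M n \<rightarrow>\<^sub>M borel_Rn n"
    and X_law: "\<And>n. n \<in> N \<Longrightarrow> distr (M n) (borel_Rn n) (X n) = mu_prod \<alpha> n"
    and f_meas: "\<And>n. n \<in> N \<Longrightarrow> f n \<in> borel_measurable (borel_Rn n)"
    and F_meas: "\<And>n. n \<in> N \<Longrightarrow> F n \<in> borel_measurable (borel_Rn n)"
    and speed: "filterlim v at_top (along N)"
    and i: "\<And>r::real. 0 < r \<Longrightarrow>
      tends_to_zero_in_prob (along N) M
        (\<lambda>n \<omega>. SUP h \<in> vscale n r ` lp_ball \<alpha> n.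
           ennreal \<bar>f n (vadd n (X n \<omega>) (vscale n (v n powr (1 / \<alpha>)) h)) - F n h\<bar>)"
    and ii: "\<And>\<delta> r::real. 0 < \<delta> \<Longrightarrow> 0 < r \<Longrightarrow>
      \<exists>t :: nat \<Rightarrow> real.
        (\<forall>n\<in>N. 0 \<le> t n \<and>
           upper_expectation (M n)
             (\<lambda>\<omega>. SUP h \<in> {h \<in> Rn n. lp_norm 2 n h \<le> t n}.
                local_osc \<alpha> n (r * v n powr (1 / \<alpha>)) (f n) (X n \<omega>) h) \<le> ennreal \<delta>) \<and>
        (\<alpha> \<noteq> 1 \<longrightarrow>
           (\<forall>\<^sub>F n in along N. 0 < ln ((t n)\<^sup>2 / v n)) \<and>
           (\<lambda>n. ln (real n) powr (\<alpha> / 2)) \<in> o[along N](\<lambda>n. ln ((t n)\<^sup>2 / v n))) \<and>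
        (\<alpha> = 1 \<longrightarrow> v \<in> o[along N](\<lambda>n. (t n)\<^sup>2))"
    and iii: "\<And>r::real. 0 < r \<Longrightarrow>
      compact (closure (\<Union>n\<in>N. F n ` vscale n r ` lp_ball \<alpha> n))"
    and iv': "\<And>x::real.
      I_rate \<alpha> F N x = (SUP \<delta> \<in> {0<..}. Limsup (along N) (\<lambda>n. I_loc_plus \<alpha> F n \<delta> x))"
  shows "satisfies_LDP N M (\<lambda>n \<omega>. f n (X n \<omega>)) v (I_rate \<alpha> F N) \<and> good_rate (I_rate \<alpha> F N)"
proof -
  let ?I = "I_rate \<alpha> F N"
  let ?P = "\<lambda>B n. measure (M n) {\<omega> \<in> space (M n). f n (X n \<omega>) \<in> B}"
  let ?p = "\<lambda>B n. ereal (1 / v n) * eln (?P B n)"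
  have meas: "(\<lambda>\<omega>. f n (X n \<omega>)) \<in> M n \<rightarrow>\<^sub>M borel" if "n \<in> N" for n
    by (rule measurable_compose[OF X_rv[OF that] f_meas[OF that]])
  have nontriv: "along N \<noteq> bot"
    using N_infinite unfolding trivial_limit_def eventually_along infinite_nat_iff_unbounded_le by blast
  have upper: "Limsup (along N) (?p B) \<le> ereal (- a)"
    if B: "B \<in> sets borel" and a: "0 < a" "ereal a < (INF x\<in>closure B. ?I x)" for B :: "real set" and a
  proof -
    obtain \<tau> where tau: "ereal a < ereal \<tau>" "ereal \<tau> < (INF x\<in>closure B. ?I x)"
      using ereal_dense2[OF a(2)] by blast
    then have at: "a < \<tau>" "0 < \<tau>" using a by auto
    \<comment> \<open>Chosen such that \<open>(1 - \<epsilon>) \<tau>\<close> is the midpoint of \<open>a\<close> and \<open>\<tau>\<close>, which leaves room for the factor \<open>2\<close>.\<close>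
    define \<epsilon> where "\<epsilon> = (\<tau> - a) / (2 * \<tau>)"
    have eps: "0 < \<epsilon>" "\<epsilon> < 1" "(1 - \<epsilon>) * \<tau> = (a + \<tau>) / 2"
      using at a by (auto simp: \<epsilon>_def field_simps)
    obtain d where d: "0 < d" "\<And>n h b. n \<in> N \<Longrightarrow> h \<in> Rn n \<Longrightarrow> (\<Sum>i<n. \<bar>h i\<bar> powr \<alpha>) \<le> \<tau> \<Longrightarrow> b \<in> closure B \<Longrightarrow> 2 * d < \<bar>F n h - b\<bar>"
      by (rule uniformly_far_from_closed_set[OF alpha(1) iii closed_closure at(2) tau(2)]) (assumption | rule that)+
    have far: "2 * d < \<bar>F n h - b\<bar>" if "n \<in> N" "h \<in> Rn n" "(\<Sum>i<n. \<bar>h i\<bar> powr \<alpha>) \<le> \<tau>" "b \<in> B" for n h b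
      using d(2)[OF that(1-3)] that(4) closure_subset by blast
    have "\<forall>\<^sub>F n in along N. ?P B n \<le> 2 * exp (- ((1 - \<epsilon>) * \<tau> * v n))"
      by (rule upper_probability_bound[OF alpha prob X_rv X_law f_meas speed i ii eps(1,2) at(2) d(1) B far])
    moreover have "\<forall>\<^sub>F n in along N. 0 < v n \<and> ln 2 / v n < (\<tau> - a) / 2"
      by (rule eventually_ln2_div_speed_less[OF speed]) (use at in simp)
    ultimately have "\<forall>\<^sub>F n in along N. ?p B n \<le> ereal (- a)"
    proof eventually_elim
      case (elim n)
      have "?p B n \<le> ereal (ln 2 / v n - (1 - \<epsilon>) * \<tau>)"
        by (rule scaled_eln_le) (use elim in \<open>simp_all add: mult.assoc\<close>)
      moreover have "ln 2 / v n - (1 - \<epsilon>) * \<tau> \<le> - a" using elim(2) unfolding eps(3) by argo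
      ultimately show ?case by (meson ereal_less_eq(3) order_trans)
    qed
    then show ?thesis by (rule Limsup_bounded)
  qed
  have upper0: "Limsup (along N) (?p B) \<le> 0" for B :: "real set"
  proof (rule Limsup_bounded)
    show "\<forall>\<^sub>F n in along N. ?p B n \<le> 0"
      using eventually_mem_along eventually_ln2_div_speed_less[OF speed zero_less_one]
    proof eventually_elim
      case (elim n)
      interpret prob_space "M n" by (rule prob[OF elim(1)])
      have "eln (?P B n) \<le> 0"
        using prob_le_1 by (auto simp: eln_def less_le)
      then show ?case using elim by (simp add: ereal_mult_le_0_iff)
    qed
  qed
  have upper': "Limsup (along N) (?p B) \<le> - (INF x\<in>closure B. ?I x)" if B: "B \<in> sets borel" for B :: "real set"
  proof (rule ccontr)
    assume "\<not> ?thesis"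
    then have "- Limsup (along N) (?p B) < (INF x\<in>closure B. ?I x)"
      by (simp add: not_le ereal_uminus_less_reorder)
    then obtain a where a: "- Limsup (along N) (?p B) < ereal a" "ereal a < (INF x\<in>closure B. ?I x)"
      using ereal_dense2 by blast
    have "0 \<le> - Limsup (along N) (?p B)" using upper0[of B] by simp
    then have "0 < ereal a" using a(1) by (rule order.strict_trans1)
    then have "0 < a" by simp
    have "Limsup (along N) (?p B) \<le> ereal (- a)" by (rule upper[OF B \<open>0 < a\<close> a(2)])
    moreover have "ereal a \<le> - L" if "L \<le> ereal (- a)" for L
      using that by (cases L) auto
    ultimately have "ereal a \<le> - Limsup (along N) (?p B)" by blast
    then show False using a(1) by simp
  qed
  have lower: "- ?I x \<le> Liminf (along N) (?p B)" if B: "B \<in> sets borel" and x: "x \<in> interior B" for B x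
  proof (rule ccontr)
    assume "\<not> ?thesis"
    then have "Liminf (along N) (?p B) < - ?I x" by simp
    then obtain a where a: "Liminf (along N) (?p B) < ereal a" "ereal a < - ?I x"
      using ereal_dense2 by blast
    have "?I x < ereal (- a)" using a(2) ereal_less_uminus_reorder[of "ereal a" "?I x"] by simp
    then obtain \<tau> where tau: "?I x < ereal \<tau>" "ereal \<tau> < ereal (- a)" using ereal_dense2 by blast
    have "0 < ereal \<tau>" using I_rate_nonneg[OF alpha(1), of F N x] tau(1) by (rule order.strict_trans1)
    then have t0: "0 < \<tau>" by simp
    obtain e where e: "0 < e" "ball x e \<subseteq> B" using x by (auto simp: mem_interior)
    define d where "d = e / 2"
    have d: "0 < d" "ball x (2 * d) \<subseteq> B" using e by (simp_all add: d_def)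
    \<comment> \<open>Here the rate function is required to be attained along \<open>N\<close> with nonnegative \<open>h\<close>.\<close>
    have "Limsup (along N) (\<lambda>n. I_loc_plus \<alpha> F n d x) \<le> ?I x"
      unfolding iv' by (rule SUP_upper) (use d in simp)
    then have "Limsup (along N) (\<lambda>n. I_loc_plus \<alpha> F n d x) < ereal \<tau>" using tau(1) by simp
    then have "\<forall>\<^sub>F n in along N. I_loc_plus \<alpha> F n d x < ereal \<tau>" by (rule Limsup_lessD)
    then have ex: "\<forall>\<^sub>F n in along N. \<exists>h\<in>Rn_nonneg n. \<bar>F n h - x\<bar> < d \<and> (\<Sum>i<n. \<bar>h i\<bar> powr \<alpha>) \<le> \<tau>"
      by eventually_elim (auto simp: I_loc_plus_def INF_less_iff lp_norm_powr[OF alpha(1)] intro: less_imp_le)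
    have "\<forall>\<^sub>F n in along N. exp (- (\<tau> * v n)) / 2 \<le> ?P B n"
      by (rule lower_probability_bound[OF alpha prob X_rv X_law f_meas speed i t0 d(1) ex B d(2)])
    moreover have "\<forall>\<^sub>F n in along N. 0 < v n \<and> ln 2 / v n < - a - \<tau>"
      by (rule eventually_ln2_div_speed_less[OF speed]) (use tau in simp)
    ultimately have "\<forall>\<^sub>F n in along N. ereal a \<le> ?p B n"
    proof eventually_elim
      case (elim n)
      have "ereal a \<le> ereal (- \<tau> - ln 2 / v n)" using elim by simp
      also have "\<dots> \<le> ?p B n" using elim by (intro scaled_eln_ge) auto
      finally show ?case .
    qed
    then have "ereal a \<le> Liminf (along N) (?p B)" by (rule Liminf_bounded)
    then show False using a(1) by simp
  qed
  have lower': "- (INF x\<in>interior B. ?I x) \<le> Liminf (along N) (?p B)" if "B \<in> sets borel" for B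
  proof -
    have "- Liminf (along N) (?p B) \<le> (INF x\<in>interior B. ?I x)"
      using lower[OF that] by (intro INF_greatest) (simp add: ereal_uminus_le_reorder)
    then show ?thesis by (simp add: ereal_uminus_le_reorder)
  qed
  have "satisfies_LDP N M (\<lambda>n \<omega>. f n (X n \<omega>)) v ?I"
    unfolding satisfies_LDP_def Let_def
    using meas speed I_rate_nonneg[OF alpha(1)] I_rate_lower_semicont[OF alpha(1)] lower' upper' Liminf_le_Limsup[OF nontriv]
    by auto
  then show ?thesis using I_rate_good[OF alpha(1) iii] by simp
qed

end
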